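(* There exist an $\text{Ł}_{\mathrm{Chang}}$-chain $\mathcal A$ and a $\mathrm{BL}_{\mathrm{Chang}}$-chain $\mathcal B$ such that $\text{Ł}_{\mathrm{Chang}}$ is strongly complete with respect to $\mathcal A$ and $\mathrm{BL}_{\mathrm{Chang}}$ is strongly complete with respect to $\mathcal B$.
   Context: **BL-algebras.** A BL-algebra is $\mathcal A=\langle A,*,\Rightarrow,\sqcap,\sqcup,0,1\rangle$ such that $\langle A,\sqcap,\sqcup,0,1\rangle$ is a bounded lattice, $\langle A,*,1\rangle$ is a commutative monoid, $z*x\le y$ iff $z\le x\Rightarrow y$, and $(x\Rightarrow y)\sqcup(y\Rightarrow x)=1$, $x\sqcap y=x*(x\Rightarrow y)$. **Logic.** Formulas are built from a denumerable set $VAR$ of variables with $\&,\to,\bot$. Derived connectives: $\neg\varphi=\varphi\to\bot$, $\varphi\land\psi=\varphi\&(\varphi\to\psi)$, $\varphi\leftrightarrow\psi=(\varphi\to\psi)\&(\psi\to\varphi)$, $\varphi^2=\varphi\&\varphi$, $2\varphi=\neg(\neg\varphi\&\neg\varphi)$, $\varphi\veebar\psi=((\varphi\to(\varphi\&\psi))\to\psi)\land((\psi\to(\varphi\&\psi))\to\varphi)$, $\overline 2\varphi=\varphi\veebar\varphi$. BL has modus ponens as only rule and axioms: $(\varphi\to\psi)\to((\psi\to\chi)\to(\varphi\to\chi))$; $(\varphi\&\psi)\to\varphi$; $(\varphi\&\psi)\to(\psi\&\varphi)$; $(\varphi\&(\varphi\to\psi))\to(\psi\&(\psi\to\varphi))$;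 $(\varphi\to(\psi\to\chi))\to((\varphi\&\psi)\to\chi)$; $((\varphi\&\psi)\to\chi)\to(\varphi\to(\psi\to\chi))$; $((\varphi\to\psi)\to\chi)\to(((\psi\to\varphi)\to\chi)\to\chi)$; $\bot\to\varphi$. Łukasiewicz logic Ł is BL plus $\neg\neg\varphi\to\varphi$. $\text{Ł}_{\mathrm{Chang}}$ is Ł plus the schema $(2\varphi)^2\leftrightarrow2(\varphi^2)$. $\mathrm{BL}_{\mathrm{Chang}}$ is BL plus the schema $(\overline2\varphi)^2\leftrightarrow\overline2(\varphi^2)$. $T\vdash_L\varphi$ denotes derivability of $\varphi$ from a set of formulas $T$ in $L$. **Semantics.** An $\mathcal A$-evaluation $v$ maps $VAR$ to $A$ and is extended to formulas by interpreting $\&,\to,\bot$ as $*,\Rightarrow,0$. An $L$-algebra ($L$ an axiomatic extension of BL) is a BL-algebra in which every axiom of $L$ takes value $1$ under every evaluation; an $L$-chain is a totally ordered $L$-algebra. $T\models_{\mathcal A}\varphi$ means: every $\mathcal A$-evaluation $v$ with $v(\psi)=1$ for all $\psi\in T$ satisfies $v(\varphi)=1$. $L$ is strongly complete with respect to $\mathcal A$ if for every (possibly infinite) set $T$ of formulas and every formula $\varphi$: $T\vdash_L\varphi$ iff $T\models_{\mathcal A}\varphi$. *)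

theory Defs
  imports "HOL-Algebra.Group"
begin

section \<open>BL-algebras\<close>

text \<open>
  The monoid part (carrier, multiplication, unit) is that of HOL-Algebra; the top element of the
  lattice is the unit of the monoid.
\<close>

record 'a bl_structure = "'a monoid" +
  residuum :: "'a \<Rightarrow> 'a \<Rightarrow> 'a" (infixr \<open>\<triangleright>\<index>\<close> 66)
  bl_meet :: "'a \<Rightarrow> 'a \<Rightarrow> 'a" (infixl \<open>\<curlywedge>\<index>\<close> 65)
  bl_join :: "'a \<Rightarrow> 'a \<Rightarrow> 'a" (infixl \<open>\<curlyvee>\<index>\<close> 65)
  bl_bot :: "'a" (\<open>\<zero>\<index>\<close>)

definition bl_le :: "('a, 'm) bl_structure_scheme \<Rightarrow> 'a \<Rightarrow> 'a \<Rightarrow> bool" (infix \<open>\<preceq>\<index>\<close> 50)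
  where "x \<preceq>\<^bsub>A\<^esub> y \<longleftrightarrow> x \<curlywedge>\<^bsub>A\<^esub> y = x"

locale bl_algebra = comm_monoid A
  for A :: "('a, 'm) bl_structure_scheme" (structure) +
  assumes residuum_closed: "\<lbrakk>x \<in> carrier A; y \<in> carrier A\<rbrakk> \<Longrightarrow> x \<triangleright> y \<in> carrier A"
    and meet_closed: "\<lbrakk>x \<in> carrier A; y \<in> carrier A\<rbrakk> \<Longrightarrow> x \<curlywedge> y \<in> carrier A"
    and join_closed: "\<lbrakk>x \<in> carrier A; y \<in> carrier A\<rbrakk> \<Longrightarrow> x \<curlyvee> y \<in> carrier A"
    and bot_closed: "\<zero> \<in> carrier A"
    and meet_comm: "\<lbrakk>x \<in> carrier A; y \<in> carrier A\<rbrakk> \<Longrightarrow> x \<curlywedge> y = y \<curlywedge> x"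
    and join_comm: "\<lbrakk>x \<in> carrier A; y \<in> carrier A\<rbrakk> \<Longrightarrow> x \<curlyvee> y = y \<curlyvee> x"
    and meet_assoc: "\<lbrakk>x \<in> carrier A; y \<in> carrier A; z \<in> carrier A\<rbrakk>
          \<Longrightarrow> (x \<curlywedge> y) \<curlywedge> z = x \<curlywedge> (y \<curlywedge> z)"
    and join_assoc: "\<lbrakk>x \<in> carrier A; y \<in> carrier A; z \<in> carrier A\<rbrakk>
          \<Longrightarrow> (x \<curlyvee> y) \<curlyvee> z = x \<curlyvee> (y \<curlyvee> z)"
    and meet_absorb: "\<lbrakk>x \<in> carrier A; y \<in> carrier A\<rbrakk> \<Longrightarrow> x \<curlywedge> (x \<curlyvee> y) = x"
    and join_absorb: "\<lbrakk>x \<in> carrier A; y \<in> carrier A\<rbrakk> \<Longrightarrow> x \<curlyvee> (x \<curlywedge> y) = x"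
    and bot_least: "x \<in> carrier A \<Longrightarrow> \<zero> \<preceq> x"
    and one_greatest: "x \<in> carrier A \<Longrightarrow> x \<preceq> \<one>"
    and residuation: "\<lbrakk>x \<in> carrier A; y \<in> carrier A; z \<in> carrier A\<rbrakk>
          \<Longrightarrow> z \<otimes> x \<preceq> y \<longleftrightarrow> z \<preceq> (x \<triangleright> y)"
    and prelinearity: "\<lbrakk>x \<in> carrier A; y \<in> carrier A\<rbrakk> \<Longrightarrow> (x \<triangleright> y) \<curlyvee> (y \<triangleright> x) = \<one>"
    and divisibility: "\<lbrakk>x \<in> carrier A; y \<in> carrier A\<rbrakk> \<Longrightarrow> x \<curlywedge> y = x \<otimes> (x \<triangleright> y)"


section \<open>Formulas\<close>

datatype fm =
    Var nat
  | Falsum (\<open>\<^bold>\<bottom>\<close>)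
  | Conj fm fm (infixl \<open>\<^bold>&\<close> 70)
  | Imp fm fm (infixr \<open>\<^bold>\<rightarrow>\<close> 60)

definition Neg :: "fm \<Rightarrow> fm" (\<open>\<^bold>\<not> _\<close> [80] 80)
  where "\<^bold>\<not> p = p \<^bold>\<rightarrow> \<^bold>\<bottom>"

definition Min_conj :: "fm \<Rightarrow> fm \<Rightarrow> fm" (infixl \<open>\<^bold>\<and>\<close> 68)
  where "p \<^bold>\<and> q = p \<^bold>& (p \<^bold>\<rightarrow> q)"

definition Iff :: "fm \<Rightarrow> fm \<Rightarrow> fm" (infix \<open>\<^bold>\<leftrightarrow>\<close> 55)
  where "p \<^bold>\<leftrightarrow> q = (p \<^bold>\<rightarrow> q) \<^bold>& (q \<^bold>\<rightarrow> p)"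

definition sq :: "fm \<Rightarrow> fm"
  where "sq p = p \<^bold>& p"

definition dbl :: "fm \<Rightarrow> fm"
  where "dbl p = \<^bold>\<not> (\<^bold>\<not> p \<^bold>& \<^bold>\<not> p)"

definition Vee_bar :: "fm \<Rightarrow> fm \<Rightarrow> fm" (infixl \<open>\<^bold>\<squnion>\<close> 65)
  where "p \<^bold>\<squnion> q =
    ((p \<^bold>\<rightarrow> (p \<^bold>& q)) \<^bold>\<rightarrow> q) \<^bold>\<and> ((q \<^bold>\<rightarrow> (p \<^bold>& q)) \<^bold>\<rightarrow> p)"

definition dbl_bar :: "fm \<Rightarrow> fm"
  where "dbl_bar p = p \<^bold>\<squnion> p"


section \<open>Logics\<close>

text \<open>
  An axiomatic extension of BL is represented by the set of all instances of its axiom schemata.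
\<close>

inductive_set BL :: "fm set" where
  A1: "(p \<^bold>\<rightarrow> q) \<^bold>\<rightarrow> ((q \<^bold>\<rightarrow> r) \<^bold>\<rightarrow> (p \<^bold>\<rightarrow> r)) \<in> BL"
| A2: "(p \<^bold>& q) \<^bold>\<rightarrow> p \<in> BL"
| A3: "(p \<^bold>& q) \<^bold>\<rightarrow> (q \<^bold>& p) \<in> BL"
| A4: "(p \<^bold>& (p \<^bold>\<rightarrow> q)) \<^bold>\<rightarrow> (q \<^bold>& (q \<^bold>\<rightarrow> p)) \<in> BL"
| A5a: "(p \<^bold>\<rightarrow> (q \<^bold>\<rightarrow> r)) \<^bold>\<rightarrow> ((p \<^bold>& q) \<^bold>\<rightarrow> r) \<in> BL"
| A5b: "((p \<^bold>& q) \<^bold>\<rightarrow> r) \<^bold>\<rightarrow> (p \<^bold>\<rightarrow> (q \<^bold>\<rightarrow> r)) \<in> BL"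
| A6: "((p \<^bold>\<rightarrow> q) \<^bold>\<rightarrow> r) \<^bold>\<rightarrow> (((q \<^bold>\<rightarrow> p) \<^bold>\<rightarrow> r) \<^bold>\<rightarrow> r) \<in> BL"
| A7: "\<^bold>\<bottom> \<^bold>\<rightarrow> p \<in> BL"

definition Luk :: "fm set"
  where "Luk = BL \<union> {\<^bold>\<not> \<^bold>\<not> p \<^bold>\<rightarrow> p | p. True}"

definition Luk_Chang :: "fm set"
  where "Luk_Chang = Luk \<union> {sq (dbl p) \<^bold>\<leftrightarrow> dbl (sq p) | p. True}"

definition BL_Chang :: "fm set"
  where "BL_Chang = BL \<union> {sq (dbl_bar p) \<^bold>\<leftrightarrow> dbl_bar (sq p) | p. True}"

inductive derivable :: "fm set \<Rightarrow> fm set \<Rightarrow> fm \<Rightarrow> bool" (\<open>_ \<turnstile>\<^bsub>_\<^esub> _\<close> [51, 0, 51] 50)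
  for T L :: "fm set" where
  axiom: "p \<in> L \<Longrightarrow> T \<turnstile>\<^bsub>L\<^esub> p"
| premise: "p \<in> T \<Longrightarrow> T \<turnstile>\<^bsub>L\<^esub> p"
| modus_ponens: "\<lbrakk>T \<turnstile>\<^bsub>L\<^esub> p; T \<turnstile>\<^bsub>L\<^esub> p \<^bold>\<rightarrow> q\<rbrakk> \<Longrightarrow> T \<turnstile>\<^bsub>L\<^esub> q"


section \<open>Semantics\<close>

definition evaluation :: "('a, 'm) bl_structure_scheme \<Rightarrow> (nat \<Rightarrow> 'a) \<Rightarrow> bool"
  where "evaluation A v \<longleftrightarrow> (\<forall>n. v n \<in> carrier A)"

primrec interp :: "('a, 'm) bl_structure_scheme \<Rightarrow> (nat \<Rightarrow> 'a) \<Rightarrow> fm \<Rightarrow> 'a" where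
  "interp A v (Var n) = v n"
| "interp A v \<^bold>\<bottom> = \<zero>\<^bsub>A\<^esub>"
| "interp A v (p \<^bold>& q) = interp A v p \<otimes>\<^bsub>A\<^esub> interp A v q"
| "interp A v (p \<^bold>\<rightarrow> q) = interp A v p \<triangleright>\<^bsub>A\<^esub> interp A v q"

definition L_algebra :: "fm set \<Rightarrow> ('a, 'm) bl_structure_scheme \<Rightarrow> bool"
  where "L_algebra L A \<longleftrightarrow>
    bl_algebra A \<and> (\<forall>p \<in> L. \<forall>v. evaluation A v \<longrightarrow> interp A v p = \<one>\<^bsub>A\<^esub>)"

definition L_chain :: "fm set \<Rightarrow> ('a, 'm) bl_structure_scheme \<Rightarrow> bool"
  where "L_chain L A \<longleftrightarrow>
    L_algebra L A \<and> (\<forall>x \<in> carrier A. \<forall>y \<in> carrier A. x \<preceq>\<^bsub>A\<^esub> y \<or> y \<preceq>\<^bsub>A\<^esub> x)"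

definition entails :: "fm set \<Rightarrow> ('a, 'm) bl_structure_scheme \<Rightarrow> fm \<Rightarrow> bool"
    (\<open>_ \<Turnstile>\<^bsub>_\<^esub> _\<close> [51, 0, 51] 50)
  where "T \<Turnstile>\<^bsub>A\<^esub> p \<longleftrightarrow>
    (\<forall>v. evaluation A v \<and> (\<forall>q \<in> T. interp A v q = \<one>\<^bsub>A\<^esub>) \<longrightarrow> interp A v p = \<one>\<^bsub>A\<^esub>)"

definition strongly_complete :: "fm set \<Rightarrow> ('a, 'm) bl_structure_scheme \<Rightarrow> bool"
  where "strongly_complete L A \<longleftrightarrow> (\<forall>T p. T \<turnstile>\<^bsub>L\<^esub> p \<longleftrightarrow> T \<Turnstile>\<^bsub>A\<^esub> p)"

text \<open>
  HOL cannot quantify existentially over types, so an existence claim about algebras has to name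
  a type containing the carriers. This one has \<open>2\<close> to the power continuum many elements; since
  the carrier may be any of its subsets, this bounds the size of the algebra from above only.
  There are continuum many pairs of a set of formulas and a formula, and countable countermodels
  suffice, so the bound leaves room for all of them at once.
\<close>

type_synonym bl_universe = "nat set set"

end

theory Submission
  imports Defs "HOL-Library.Countable"
begin

text \<open>
  A chain of the right kind is sound for its logic, so what has to be found is one chain that
  refutes every consequence \<open>T \<turnstile> p\<close> that is not derivable. For a single pair \<open>(T, p)\<close> a refuting
  chain comes from Lindenbaum's construction: extend \<open>T\<close> to a prime theory that omits \<open>p\<close>
  (\<open>prime_theory_exists\<close>) and identify provably equivalent formulas. The theorem follows once the
  Lindenbaum chains of all prime theories embed together into one chain satisfying the same axioms.

  The embedding rests on how such a chain is built. In a BL-chain an element \<open>x\<close> has either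
  \<open>\<not>x = 0\<close> (it is dense) or \<open>\<not>\<not>x = x\<close> (\<open>regular_neg_neg\<close>). Dense elements lie above the regular ones and
  act trivially on them, so the chain is the ordinal sum of an MV-chain, consisting of the regular
  elements and \<open>1\<close>, and of its dense elements. Chang's identity makes the MV-chain perfect: if \<open>P\<close>
  consists of its elements \<open>x\<close> with \<open>\<not>x \<le> x\<close>, then each of its elements is either in \<open>P\<close> or the negation of an element of \<open>P\<close>,
  and \<open>P\<close> is a cancellative monoid (\<open>coradical_mult\<close>, \<open>coradical_cancel\<close>). So the MV-chain is the
  disconnected rotation of \<open>P\<close>, that is, \<open>P\<close> together with an upside-down copy of itself below.

  Let now a family of such chains be given. Their dense parts do not interact with anything below
  them, so they can be put on top of one another in any order. Their MV-chains, on the other hand,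
  share the bottom element and have to be merged. The product of all the monoids \<open>P\<close>, ordered
  lexicographically along a well-order of the index set, is an ordered cancellative monoid, and the
  fractions \<open>f / g\<close> with \<open>f \<le> g\<close> over it form the negative cone of an ordered abelian group. The
  rotation of this cone is a perfect MV-chain that contains every given MV-chain. The ordinal sum of
  this rotation and of all dense parts is the chain that was sought.

  Chang's identity passes to the sum because it has one variable only and each element of the sum
  lies in the rotation or in the image of a member of the family (\<open>chang_B\<close>). If double negation is the
  identity in all members, then \<open>1\<close> is their only dense element and the sum is just the rotation, in
  which double negation is the identity too (\<open>B_involutive\<close>); this is the case of Lukasiewicz logic.
\<close>

section \<open>Totally preordered hoops and their quotients\<close>

text \<open>
  Formulas modulo provable equivalence and fractions modulo equality of their values both arise as
  sets of representatives with a total preorder. Proving the algebraic laws for representatives, up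
  to the preorder, avoids reasoning about equivalence classes until one quotient is taken at the end.
\<close>

locale prehoop_chain =
  fixes S :: "'a set"
    and le :: "'a \<Rightarrow> 'a \<Rightarrow> bool" (infix \<open>\<lesssim>\<close> 50)
    and mul :: "'a \<Rightarrow> 'a \<Rightarrow> 'a" (infixl \<open>\<odot>\<close> 70)
    and imp :: "'a \<Rightarrow> 'a \<Rightarrow> 'a" (infixr \<open>\<leadsto>\<close> 66)
    and e :: 'a
  assumes mul_closed [simp, intro]: "\<lbrakk>x \<in> S; y \<in> S\<rbrakk> \<Longrightarrow> x \<odot> y \<in> S"
    and imp_closed [simp, intro]: "\<lbrakk>x \<in> S; y \<in> S\<rbrakk> \<Longrightarrow> x \<leadsto> y \<in> S"
    and e_closed [simp, intro]: "e \<in> S"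
    and refl [simp, intro]: "x \<in> S \<Longrightarrow> x \<lesssim> x"
    and trans: "\<lbrakk>x \<lesssim> y; y \<lesssim> z; x \<in> S; y \<in> S; z \<in> S\<rbrakk> \<Longrightarrow> x \<lesssim> z"
    and total: "\<lbrakk>x \<in> S; y \<in> S\<rbrakk> \<Longrightarrow> x \<lesssim> y \<or> y \<lesssim> x"
    and le_e [simp, intro]: "x \<in> S \<Longrightarrow> x \<lesssim> e"
    and comm: "\<lbrakk>x \<in> S; y \<in> S\<rbrakk> \<Longrightarrow> x \<odot> y \<lesssim> y \<odot> x"
    and assoc: "\<lbrakk>x \<in> S; y \<in> S; z \<in> S\<rbrakk> \<Longrightarrow> (x \<odot> y) \<odot> z \<lesssim> x \<odot> (y \<odot> z)"
    and unit: "x \<in> S \<Longrightarrow> x \<lesssim> x \<odot> e"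
    and unit': "x \<in> S \<Longrightarrow> x \<odot> e \<lesssim> x"
    and residuated: "\<lbrakk>x \<in> S; y \<in> S; z \<in> S\<rbrakk> \<Longrightarrow> z \<odot> x \<lesssim> y \<longleftrightarrow> z \<lesssim> x \<leadsto> y"
    and divisible: "\<lbrakk>y \<lesssim> x; x \<in> S; y \<in> S\<rbrakk> \<Longrightarrow> y \<lesssim> x \<odot> (x \<leadsto> y)"
begin

lemma not_le: "\<lbrakk>\<not> x \<lesssim> y; x \<in> S; y \<in> S\<rbrakk> \<Longrightarrow> y \<lesssim> x"
  using total by blast

lemma mul_mono_left:
  assumes "x \<lesssim> y" "x \<in> S" "y \<in> S" "z \<in> S"
  shows "x \<odot> z \<lesssim> y \<odot> z"
proof -
  have "y \<lesssim> z \<leadsto> (y \<odot> z)"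
    using assms residuated[of z "y \<odot> z" y] by simp
  then have "x \<lesssim> z \<leadsto> (y \<odot> z)"
    using assms trans[of x y] by simp
  then show ?thesis
    using assms residuated by simp
qed

lemma mul_mono_right:
  assumes "x \<lesssim> y" "x \<in> S" "y \<in> S" "z \<in> S"
  shows "z \<odot> x \<lesssim> z \<odot> y"
proof -
  have "z \<odot> x \<lesssim> x \<odot> z" "x \<odot> z \<lesssim> y \<odot> z" "y \<odot> z \<lesssim> z \<odot> y"
    using assms comm mul_mono_left by auto
  then show ?thesis
    using assms trans[of "z \<odot> x" "x \<odot> z" "y \<odot> z"] trans[of "z \<odot> x" "y \<odot> z" "z \<odot> y"] by simp
qed

lemma mul_mono:
  assumes "x \<lesssim> y" "z \<lesssim> w" "x \<in> S" "y \<in> S" "z \<in> S" "w \<in> S"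
  shows "x \<odot> z \<lesssim> y \<odot> w"
  using mul_mono_left[of x y z] mul_mono_right[of z w y] assms
    trans[of "x \<odot> z" "y \<odot> z" "y \<odot> w"] by simp

lemma assoc': "\<lbrakk>x \<in> S; y \<in> S; z \<in> S\<rbrakk> \<Longrightarrow> x \<odot> (y \<odot> z) \<lesssim> (x \<odot> y) \<odot> z"
proof -
  assume S: "x \<in> S" "y \<in> S" "z \<in> S"
  have a: "x \<odot> (y \<odot> z) \<lesssim> (y \<odot> z) \<odot> x"
    using S by (simp add: comm)
  have "(y \<odot> z) \<odot> x \<lesssim> (z \<odot> y) \<odot> x"
    using S by (simp add: comm mul_mono_left)
  moreover have "(z \<odot> y) \<odot> x \<lesssim> z \<odot> (y \<odot> x)"
    using S by (simp add: assoc)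
  moreover have "z \<odot> (y \<odot> x) \<lesssim> (y \<odot> x) \<odot> z"
    using S by (simp add: comm)
  moreover have "(y \<odot> x) \<odot> z \<lesssim> (x \<odot> y) \<odot> z"
    using S by (simp add: comm mul_mono_left)
  ultimately show ?thesis
    using S trans[OF trans[OF trans[OF trans[OF a]]]] by simp
qed

lemma mul_le_left: "\<lbrakk>x \<in> S; y \<in> S\<rbrakk> \<Longrightarrow> x \<odot> y \<lesssim> x"
  using mul_mono_right[of y e x] unit'[of x] trans[of "x \<odot> y" "x \<odot> e" x] by simp

lemma mul_le_right: "\<lbrakk>x \<in> S; y \<in> S\<rbrakk> \<Longrightarrow> x \<odot> y \<lesssim> y"
  using mul_le_left[of y x] comm[of x y] trans[of "x \<odot> y" "y \<odot> x" y] by simp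

lemma le_e_mul: "x \<in> S \<Longrightarrow> x \<lesssim> e \<odot> x"
  using unit[of x] comm[of x e] trans[of x "x \<odot> e" "e \<odot> x"] by simp

lemma imp_eval: "\<lbrakk>x \<in> S; y \<in> S\<rbrakk> \<Longrightarrow> x \<odot> (x \<leadsto> y) \<lesssim> y"
  using residuated[of x y "x \<leadsto> y"] comm[of x "x \<leadsto> y"]
  trans[of "x \<odot> (x \<leadsto> y)" _ y] by simp

lemma le_imp: "\<lbrakk>x \<in> S; y \<in> S\<rbrakk> \<Longrightarrow> y \<lesssim> x \<leadsto> y"
  using residuated[of x y y] mul_le_left by simp

lemma e_le_imp_iff:
  assumes "x \<in> S" "y \<in> S"
  shows "e \<lesssim> x \<leadsto> y \<longleftrightarrow> x \<lesssim> y"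
proof -
  have "e \<odot> x \<lesssim> y \<longleftrightarrow> x \<lesssim> y"
  proof
    assume "e \<odot> x \<lesssim> y"
    then show "x \<lesssim> y"
      using assms trans[OF le_e_mul[of x]] by simp
  next
    assume "x \<lesssim> y"
    then show "e \<odot> x \<lesssim> y"
      using assms trans[OF mul_le_right[of e x]] by simp
  qed
  then show ?thesis
    using assms residuated[of x y e] by simp
qed

lemma imp_mono:
  assumes "x' \<lesssim> x" "y \<lesssim> y'" "x \<in> S" "y \<in> S" "x' \<in> S" "y' \<in> S"
  shows "x \<leadsto> y \<lesssim> x' \<leadsto> y'"
proof -
  have "(x \<leadsto> y) \<odot> x' \<lesssim> (x \<leadsto> y) \<odot> x"
    using assms by (simp add: mul_mono_right)
  moreover have "(x \<leadsto> y) \<odot> x \<lesssim> y"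
    using assms residuated by simp
  ultimately have "(x \<leadsto> y) \<odot> x' \<lesssim> y'"
    using assms trans[OF trans[of _ _ y]] by simp
  then show ?thesis
    using assms residuated by simp
qed

lemma le_imp_iff:
  "\<lbrakk>x \<in> S; y \<in> S; z \<in> S; w \<in> S\<rbrakk> \<Longrightarrow> w \<lesssim> (x \<odot> y) \<leadsto> z \<longleftrightarrow> w \<lesssim> x \<leadsto> (y \<leadsto> z)"
proof -
  assume S: "x \<in> S" "y \<in> S" "z \<in> S" "w \<in> S"
  have "w \<lesssim> (x \<odot> y) \<leadsto> z \<longleftrightarrow> w \<odot> (x \<odot> y) \<lesssim> z"
    using S residuated by simp
  also have "\<dots> \<longleftrightarrow> (w \<odot> x) \<odot> y \<lesssim> z"
    using S assoc[of w x y] assoc'[of w x y] 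
      trans[of "w \<odot> (x \<odot> y)" "(w \<odot> x) \<odot> y" z] trans[of "(w \<odot> x) \<odot> y" "w \<odot> (x \<odot> y)" z] by auto
  also have "\<dots> \<longleftrightarrow> w \<lesssim> x \<leadsto> (y \<leadsto> z)"
    using S residuated by simp
  finally show ?thesis .
qed

lemma curry: "\<lbrakk>x \<in> S; y \<in> S; z \<in> S\<rbrakk> \<Longrightarrow> (x \<odot> y) \<leadsto> z \<lesssim> x \<leadsto> (y \<leadsto> z)"
  and uncurry: "\<lbrakk>x \<in> S; y \<in> S; z \<in> S\<rbrakk> \<Longrightarrow> x \<leadsto> (y \<leadsto> z) \<lesssim> (x \<odot> y) \<leadsto> z"
  using le_imp_iff[of x y z "(x \<odot> y) \<leadsto> z"] le_imp_iff[of x y z "x \<leadsto> (y \<leadsto> z)"]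
  by simp_all

end

locale preBL_chain = prehoop_chain +
  fixes z :: 'a
  assumes z_closed [simp, intro]: "z \<in> S"
    and z_le [simp, intro]: "x \<in> S \<Longrightarrow> z \<lesssim> x"

locale bl_chain = bl_algebra +
  assumes chain: "\<lbrakk>x \<in> carrier A; y \<in> carrier A\<rbrakk> \<Longrightarrow> x \<preceq> y \<or> y \<preceq> x"

text \<open>
  The target of the quotient map \<open>q\<close> is left open: it may be a choice of representatives or an
  injective encoding into another type.
\<close>

locale preBL_quotient = preBL_chain +
  fixes q :: "'a \<Rightarrow> 'b"
  assumes q_eq_iff: "\<lbrakk>x \<in> S; y \<in> S\<rbrakk> \<Longrightarrow> q x = q y \<longleftrightarrow> x \<lesssim> y \<and> y \<lesssim> x"
begin

abbreviation rep :: "'b \<Rightarrow> 'a"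
  where "rep \<equiv> inv_into S q"

definition Q :: "'b bl_structure"
  where "Q = \<lparr>carrier = q ` S, monoid.mult = \<lambda>a b. q (rep a \<odot> rep b), one = q e,
    residuum = \<lambda>a b. q (rep a \<leadsto> rep b),
    bl_meet = \<lambda>a b. if rep a \<lesssim> rep b then a else b,
    bl_join = \<lambda>a b. if rep a \<lesssim> rep b then b else a, bl_bot = q z\<rparr>"

lemma carrier_Q: "carrier Q = q ` S"
  by (simp add: Q_def)

lemma rep_closed: "x \<in> S \<Longrightarrow> rep (q x) \<in> S"
  by (simp add: inv_into_into)

lemma rep_le: "x \<in> S \<Longrightarrow> rep (q x) \<lesssim> x"
  and le_rep: "x \<in> S \<Longrightarrow> x \<lesssim> rep (q x)"
  using q_eq_iff[of "rep (q x)" x] rep_closed[of x] by (simp_all add: f_inv_into_f)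

lemma rep_le_rep_iff:
  assumes "x \<in> S" "y \<in> S"
  shows "rep (q x) \<lesssim> rep (q y) \<longleftrightarrow> x \<lesssim> y"
proof
  assume "rep (q x) \<lesssim> rep (q y)"
  then have "x \<lesssim> rep (q y)"
    using assms trans[OF le_rep] rep_closed by blast
  then show "x \<lesssim> y"
    using assms trans[OF _ rep_le] rep_closed by blast
next
  assume "x \<lesssim> y"
  then have "rep (q x) \<lesssim> y"
    using assms trans[OF rep_le] rep_closed by blast
  then show "rep (q x) \<lesssim> rep (q y)"
    using assms trans[OF _ le_rep] rep_closed by blast
qed

lemma mult_Q: "\<lbrakk>x \<in> S; y \<in> S\<rbrakk> \<Longrightarrow> q x \<otimes>\<^bsub>Q\<^esub> q y = q (x \<odot> y)"
  by (simp add: Q_def q_eq_iff rep_closed mul_mono rep_le le_rep)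

lemma residuum_Q: "\<lbrakk>x \<in> S; y \<in> S\<rbrakk> \<Longrightarrow> q x \<triangleright>\<^bsub>Q\<^esub> q y = q (x \<leadsto> y)"
  by (simp add: Q_def q_eq_iff rep_closed imp_mono rep_le le_rep)

lemma one_Q: "\<one>\<^bsub>Q\<^esub> = q e"
  and bot_Q: "\<zero>\<^bsub>Q\<^esub> = q z"
  by (simp_all add: Q_def)

lemma meet_Q: "\<lbrakk>x \<in> S; y \<in> S\<rbrakk> \<Longrightarrow> q x \<curlywedge>\<^bsub>Q\<^esub> q y = (if x \<lesssim> y then q x else q y)"
  and join_Q: "\<lbrakk>x \<in> S; y \<in> S\<rbrakk> \<Longrightarrow> q x \<curlyvee>\<^bsub>Q\<^esub> q y = (if x \<lesssim> y then q y else q x)"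
  by (simp_all add: Q_def rep_le_rep_iff)

lemma le_Q: "\<lbrakk>x \<in> S; y \<in> S\<rbrakk> \<Longrightarrow> q x \<preceq>\<^bsub>Q\<^esub> q y \<longleftrightarrow> x \<lesssim> y"
  by (auto simp: bl_le_def meet_Q q_eq_iff not_le)

lemmas Q_simps = carrier_Q mult_Q residuum_Q one_Q bot_Q meet_Q join_Q le_Q

text \<open>
  All identities of BL-algebras hold up to the preorder; the lattice operations are minimum and
  maximum, and prelinearity is totality read through the residuum.
\<close>

lemma bl_chain_Q: "bl_chain Q"
proof unfold_locales
  show "x \<otimes>\<^bsub>Q\<^esub> y \<in> carrier Q" if "x \<in> carrier Q" "y \<in> carrier Q" for x y
    using that by (auto simp: Q_simps)
  show "x \<otimes>\<^bsub>Q\<^esub> y \<otimes>\<^bsub>Q\<^esub> z = x \<otimes>\<^bsub>Q\<^esub> (y \<otimes>\<^bsub>Q\<^esub> z)"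
    if "x \<in> carrier Q" "y \<in> carrier Q" "z \<in> carrier Q" for x y z
    using that by (auto simp: Q_simps q_eq_iff assoc assoc')
  show "\<one>\<^bsub>Q\<^esub> \<in> carrier Q"
    by (auto simp: Q_simps)
  show "x \<otimes>\<^bsub>Q\<^esub> \<one>\<^bsub>Q\<^esub> = x" if "x \<in> carrier Q" for x
    using that by (auto simp: Q_simps q_eq_iff unit unit')
  show "\<one>\<^bsub>Q\<^esub> \<otimes>\<^bsub>Q\<^esub> x = x" if "x \<in> carrier Q" for x
    using that by (auto simp: Q_simps q_eq_iff mul_le_right le_e_mul)
  show "x \<otimes>\<^bsub>Q\<^esub> y = y \<otimes>\<^bsub>Q\<^esub> x" if "x \<in> carrier Q" "y \<in> carrier Q" for x y
    using that by (auto simp: Q_simps q_eq_iff comm)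
  show "x \<triangleright>\<^bsub>Q\<^esub> y \<in> carrier Q" if "x \<in> carrier Q" "y \<in> carrier Q" for x y
    using that by (auto simp: Q_simps)
  show "\<zero>\<^bsub>Q\<^esub> \<in> carrier Q"
    by (auto simp: Q_simps)
  show "x \<curlywedge>\<^bsub>Q\<^esub> y \<in> carrier Q" if "x \<in> carrier Q" "y \<in> carrier Q" for x y
    using that by (auto simp: Q_simps)
  show "x \<curlyvee>\<^bsub>Q\<^esub> y \<in> carrier Q" if "x \<in> carrier Q" "y \<in> carrier Q" for x y
    using that by (auto simp: Q_simps)
  show "x \<curlywedge>\<^bsub>Q\<^esub> y = y \<curlywedge>\<^bsub>Q\<^esub> x" if "x \<in> carrier Q" "y \<in> carrier Q" for x y
    using that by (auto simp: Q_simps q_eq_iff not_le)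
  show "x \<curlyvee>\<^bsub>Q\<^esub> y = y \<curlyvee>\<^bsub>Q\<^esub> x" if "x \<in> carrier Q" "y \<in> carrier Q" for x y
    using that by (auto simp: Q_simps q_eq_iff not_le)
  show "x \<curlywedge>\<^bsub>Q\<^esub> y \<curlywedge>\<^bsub>Q\<^esub> z = x \<curlywedge>\<^bsub>Q\<^esub> (y \<curlywedge>\<^bsub>Q\<^esub> z)"
    if xyz: "x \<in> carrier Q" "y \<in> carrier Q" "z \<in> carrier Q" for x y z
  proof -
    obtain a b c where "x = q a" "y = q b" "z = q c" "a \<in> S" "b \<in> S" "c \<in> S"
      using xyz by (auto simp: carrier_Q)
    then show ?thesis
      using trans[of a b c] trans[of c b a] not_le[of a b] not_le[of b c] not_le[of a c]
      by (auto simp: Q_simps q_eq_iff)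
  qed
  show "x \<curlyvee>\<^bsub>Q\<^esub> y \<curlyvee>\<^bsub>Q\<^esub> z = x \<curlyvee>\<^bsub>Q\<^esub> (y \<curlyvee>\<^bsub>Q\<^esub> z)"
    if xyz: "x \<in> carrier Q" "y \<in> carrier Q" "z \<in> carrier Q" for x y z
  proof -
    obtain a b c where "x = q a" "y = q b" "z = q c" "a \<in> S" "b \<in> S" "c \<in> S"
      using xyz by (auto simp: carrier_Q)
    then show ?thesis
      using trans[of a b c] trans[of c b a] not_le[of a b] not_le[of b c] not_le[of a c]
      by (auto simp: Q_simps q_eq_iff)
  qed
  show "x \<curlywedge>\<^bsub>Q\<^esub> (x \<curlyvee>\<^bsub>Q\<^esub> y) = x" if "x \<in> carrier Q" "y \<in> carrier Q" for x y
    using that by (auto simp: Q_simps)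
  show "x \<curlyvee>\<^bsub>Q\<^esub> (x \<curlywedge>\<^bsub>Q\<^esub> y) = x" if "x \<in> carrier Q" "y \<in> carrier Q" for x y
    using that by (auto simp: Q_simps)
  show "\<zero>\<^bsub>Q\<^esub> \<preceq>\<^bsub>Q\<^esub> x" if "x \<in> carrier Q" for x
    using that by (auto simp: Q_simps)
  show "x \<preceq>\<^bsub>Q\<^esub> \<one>\<^bsub>Q\<^esub>" if "x \<in> carrier Q" for x
    using that by (auto simp: Q_simps)
  show "z \<otimes>\<^bsub>Q\<^esub> x \<preceq>\<^bsub>Q\<^esub> y \<longleftrightarrow> z \<preceq>\<^bsub>Q\<^esub> x \<triangleright>\<^bsub>Q\<^esub> y"
    if "x \<in> carrier Q" "y \<in> carrier Q" "z \<in> carrier Q" for x y z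
    using that by (auto simp: Q_simps residuated)
  show "(x \<triangleright>\<^bsub>Q\<^esub> y) \<curlyvee>\<^bsub>Q\<^esub> (y \<triangleright>\<^bsub>Q\<^esub> x) = \<one>\<^bsub>Q\<^esub>"
    if "x \<in> carrier Q" "y \<in> carrier Q" for x y
  proof -
    obtain a b where ab: "x = q a" "y = q b" "a \<in> S" "b \<in> S"
      using \<open>x \<in> carrier Q\<close> \<open>y \<in> carrier Q\<close> by (auto simp: carrier_Q)
    have "e \<lesssim> a \<leadsto> b \<or> e \<lesssim> b \<leadsto> a"
      using total[of a b] ab e_le_imp_iff by auto
    then show ?thesis
      using ab trans[of e "a \<leadsto> b" "b \<leadsto> a"] trans[of "a \<leadsto> b" e "b \<leadsto> a"] by (auto simp: Q_simps q_eq_iff)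
  qed
  show "x \<curlywedge>\<^bsub>Q\<^esub> y = x \<otimes>\<^bsub>Q\<^esub> (x \<triangleright>\<^bsub>Q\<^esub> y)"
    if "x \<in> carrier Q" "y \<in> carrier Q" for x y
  proof -
    obtain a b where ab: "x = q a" "y = q b" "a \<in> S" "b \<in> S"
      using \<open>x \<in> carrier Q\<close> \<open>y \<in> carrier Q\<close> by (auto simp: carrier_Q)
    have "a \<lesssim> a \<odot> (a \<leadsto> b)" if "a \<lesssim> b"
    proof -
      have "a \<odot> e \<lesssim> a \<odot> (a \<leadsto> b)"
        using ab that by (simp add: mul_mono_right e_le_imp_iff)
      then show ?thesis
        using ab unit[of a] trans[of a "a \<odot> e"] by simp
    qed
    moreover have "b \<lesssim> a \<odot> (a \<leadsto> b)" if "\<not> a \<lesssim> b"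
      using ab that by (simp add: not_le divisible)
    ultimately show ?thesis
      using ab by (auto simp: Q_simps q_eq_iff mul_le_left imp_eval)
  qed
  show "x \<preceq>\<^bsub>Q\<^esub> y \<or> y \<preceq>\<^bsub>Q\<^esub> x" if "x \<in> carrier Q" "y \<in> carrier Q" for x y
    using that by (auto simp: Q_simps not_le)
qed

end

section \<open>BL-chains\<close>

context bl_algebra
begin

lemma meet_idem: "x \<in> carrier A \<Longrightarrow> x \<curlywedge> x = x"
  by (metis join_absorb meet_absorb meet_closed)

lemma le_refl: "x \<in> carrier A \<Longrightarrow> x \<preceq> x"
  by (simp add: bl_le_def meet_idem)

lemma le_antisym: "\<lbrakk>x \<preceq> y; y \<preceq> x; x \<in> carrier A; y \<in> carrier A\<rbrakk> \<Longrightarrow> x = y"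
  by (metis bl_le_def meet_comm)

lemma le_trans:
  "\<lbrakk>x \<preceq> y; y \<preceq> z; x \<in> carrier A; y \<in> carrier A; z \<in> carrier A\<rbrakk> \<Longrightarrow> x \<preceq> z"
  by (metis bl_le_def meet_assoc)

end

sublocale bl_chain \<subseteq> preBL_chain "carrier A" "bl_le A" "(\<otimes>)" "(\<triangleright>)" "\<one>" "\<zero>"
proof unfold_locales
  show "y \<preceq> x \<otimes> (x \<triangleright> y)" if "y \<preceq> x" "x \<in> carrier A" "y \<in> carrier A" for x y
    using that divisibility[of x y] meet_comm[of x y] bl_le_def[of A y x] by (simp add: le_refl)
next
  show "x \<otimes> y \<otimes> z \<preceq> x \<otimes> (y \<otimes> z)"
    if "x \<in> carrier A" "y \<in> carrier A" "z \<in> carrier A" for x y z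
    using that by (simp add: m_assoc le_refl)
  show "x \<otimes> y \<preceq> y \<otimes> x" if "x \<in> carrier A" "y \<in> carrier A" for x y
    using that by (simp add: m_comm[of x y] le_refl)
  show "x \<preceq> z" if "x \<preceq> y" "y \<preceq> z" "x \<in> carrier A" "y \<in> carrier A" "z \<in> carrier A" for x y z
    using that le_trans by blast
qed (simp_all add: residuum_closed le_refl chain one_greatest bot_closed bot_least residuation)

context bl_chain
begin

abbreviation neg :: "'a \<Rightarrow> 'a"
  where "neg x \<equiv> x \<triangleright> \<zero>"

text \<open>
  The unit is dense. The set \<open>insert \<one> regular\<close> is the carrier of the greatest MV-subalgebra, the
  lowest component of the chain.
\<close>

definition regular :: "'a set"
  where "regular = {x \<in> carrier A. neg x \<noteq> \<zero>}"

definition dense :: "'a set"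
  where "dense = {x \<in> carrier A. neg x = \<zero>}"

lemma le_one_iff [simp]: "x \<in> carrier A \<Longrightarrow> \<one> \<preceq> x \<longleftrightarrow> x = \<one>"
  using le_antisym[of x \<one>] by auto

lemma le_bot_iff [simp]: "x \<in> carrier A \<Longrightarrow> x \<preceq> \<zero> \<longleftrightarrow> x = \<zero>"
  using le_antisym[of x \<zero>] by auto

lemma imp_eq_one_iff: "\<lbrakk>x \<in> carrier A; y \<in> carrier A\<rbrakk> \<Longrightarrow> x \<triangleright> y = \<one> \<longleftrightarrow> x \<preceq> y"
  using e_le_imp_iff[of x y] by simp

lemma one_imp: "x \<in> carrier A \<Longrightarrow> \<one> \<triangleright> x = x"
  using imp_eval[of \<one> x] le_imp[of \<one> x] by (simp add: le_antisym)

lemma imp_one [simp]: "x \<in> carrier A \<Longrightarrow> x \<triangleright> \<one> = \<one>"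
  by (simp add: imp_eq_one_iff)

lemma imp_imp: "\<lbrakk>x \<in> carrier A; y \<in> carrier A; z \<in> carrier A\<rbrakk>
    \<Longrightarrow> x \<triangleright> (y \<triangleright> z) = (x \<otimes> y) \<triangleright> z"
  by (simp add: curry uncurry le_antisym)

lemma mul_imp_eq: "\<lbrakk>y \<preceq> x; x \<in> carrier A; y \<in> carrier A\<rbrakk> \<Longrightarrow> x \<otimes> (x \<triangleright> y) = y"
  by (simp add: imp_eval divisible le_antisym)

lemma neg_bot [simp]: "neg \<zero> = \<one>" and neg_one [simp]: "neg \<one> = \<zero>"
  by (simp_all add: imp_eq_one_iff one_imp)

lemma bot_mult [simp]: "x \<in> carrier A \<Longrightarrow> \<zero> \<otimes> x = \<zero>"
  and mult_bot [simp]: "x \<in> carrier A \<Longrightarrow> x \<otimes> \<zero> = \<zero>"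
  using mul_le_left[of \<zero> x] mul_le_right[of x \<zero>] by simp_all

lemma mult_eq_bot_iff: "\<lbrakk>x \<in> carrier A; y \<in> carrier A\<rbrakk> \<Longrightarrow> x \<otimes> y = \<zero> \<longleftrightarrow> x \<preceq> neg y"
  using residuated[of y \<zero> x] by simp

lemma neg_antimono: "\<lbrakk>x \<preceq> y; x \<in> carrier A; y \<in> carrier A\<rbrakk> \<Longrightarrow> neg y \<preceq> neg x"
  by (simp add: imp_mono)

lemma le_neg_neg: "x \<in> carrier A \<Longrightarrow> x \<preceq> neg (neg x)"
  using residuated[of "neg x" \<zero> x] imp_eval[of x \<zero>] by simp

lemma neg_neg_neg: "x \<in> carrier A \<Longrightarrow> neg (neg (neg x)) = neg x"
  by (simp add: le_neg_neg neg_antimono le_antisym)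

lemma neg_mult: "\<lbrakk>x \<in> carrier A; y \<in> carrier A\<rbrakk> \<Longrightarrow> neg (x \<otimes> y) = x \<triangleright> neg y"
  by (simp add: imp_imp)

lemma regular_closed: "x \<in> regular \<Longrightarrow> x \<in> carrier A"
  and dense_closed: "x \<in> dense \<Longrightarrow> x \<in> carrier A"
  by (simp_all add: regular_def dense_def)

lemma regular_iff_not_dense: "x \<in> carrier A \<Longrightarrow> x \<in> regular \<longleftrightarrow> x \<notin> dense"
  by (simp add: regular_def dense_def)

text \<open>
  Put \<open>u = \<not>\<not>x\<close> and \<open>y = u \<rightarrow> x\<close>, so that \<open>u * y = x\<close> and \<open>\<not>u = \<not>x\<close>. Since \<open>u \<rightarrow> \<not>y = \<not>(u * y) = \<not>u\<close>,
  divisibility gives \<open>\<not>y = u * \<not>u = 0\<close> unless \<open>u = 0\<close>. As \<open>\<not>u \<noteq> 0\<close>, this puts \<open>y\<close> above \<open>u\<close>, and \<open>w = y \<rightarrow> u\<close> satisfies \<open>w * y = u\<close> and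
  \<open>\<not>w = \<not>u\<close>, which squeezes \<open>w\<close> to \<open>u\<close>. So multiplying \<open>u\<close> by \<open>y\<close> gives both \<open>u\<close> and \<open>x\<close>.
\<close>

lemma regular_neg_neg:
  assumes x: "x \<in> regular"
  shows "neg (neg x) = x"
proof -
  have xA: "x \<in> carrier A" and nx: "neg x \<noteq> \<zero>"
    using x by (simp_all add: regular_def)
  define u where "u = neg (neg x)"
  define y where "y = u \<triangleright> x"
  define w where "w = y \<triangleright> u"
  have A [simp]: "u \<in> carrier A" "y \<in> carrier A" "w \<in> carrier A"
    using xA by (simp_all add: u_def y_def w_def)
  have nu: "neg u = neg x"
    using xA by (simp add: u_def neg_neg_neg)
  have uy: "u \<otimes> y = x"
    unfolding y_def using xA le_neg_neg[of x] by (simp add: mul_imp_eq u_def)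
  show ?thesis
  proof (cases "u \<preceq> neg y")
    case True
    have "neg u = u \<triangleright> neg y"
      using nu uy by (simp add: neg_mult[symmetric])
    with True have "neg u = \<one>"
      by (simp add: imp_eq_one_iff)
    then have "u = \<zero>"
      by (simp add: imp_eq_one_iff)
    then have "x = \<zero>"
      using uy by simp
    then show ?thesis
      by simp
  next
    case False
    then have "neg y = u \<otimes> (u \<triangleright> neg y)"
      using not_le[of u "neg y"] by (simp add: mul_imp_eq)
    also have "\<dots> = u \<otimes> neg u"
      using nu uy by (simp add: neg_mult[symmetric])
    also have "\<dots> = \<zero>"
      by (simp add: mult_eq_bot_iff le_neg_neg)
    finally have ny: "neg y = \<zero>" .
    have "u \<preceq> y"
      using not_le[of u y] neg_antimono[of y u] nx nu ny xA by auto
    then have yw: "w \<otimes> y = u"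
      unfolding w_def by (simp add: mul_imp_eq m_comm[of "y \<triangleright> u" y])
    have "neg w = neg u"
      using yw ny by (simp add: neg_mult[of w y, symmetric, unfolded ny yw])
    then have "w \<preceq> u"
      using le_neg_neg[of w] nu by (simp add: u_def)
    then have "w = u"
      unfolding w_def by (simp add: le_imp le_antisym)
    then have "x = u"
      using yw uy by simp
    then show ?thesis
      by (simp add: u_def)
  qed
qed

lemma regular_le_dense: "\<lbrakk>x \<in> regular; d \<in> dense\<rbrakk> \<Longrightarrow> x \<preceq> d"
  using not_le[of x d] neg_antimono[of d x] by (auto simp: regular_def dense_def)

text \<open>
  Both \<open>x\<close> and \<open>d \<rightarrow> x\<close> are regular with the same negation, and a regular element is determined by its
  negation.
\<close>

lemma dense_imp_regular:
  assumes "x \<in> regular" "d \<in> dense"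
  shows "d \<triangleright> x = x"
proof -
  define w where "w = d \<triangleright> x"
  have A [simp]: "x \<in> carrier A" "d \<in> carrier A" "w \<in> carrier A"
    using assms by (simp_all add: regular_closed dense_closed w_def)
  have "w \<otimes> d = x"
    using regular_le_dense[OF assms] by (simp add: w_def mul_imp_eq m_comm[of "d \<triangleright> x" d])
  moreover have "neg (w \<otimes> d) = neg w"
    using assms by (simp add: neg_mult dense_def)
  ultimately have nw: "neg x = neg w"
    by simp
  then have "w \<in> regular"
    using assms by (simp add: regular_def)
  then show ?thesis
    using nw regular_neg_neg[of w] regular_neg_neg[of x] assms by (simp flip: w_def)
qed

lemma dense_mult_regular:
  assumes "x \<in> regular" "d \<in> dense"
  shows "d \<otimes> x = x"
  using mul_imp_eq[OF regular_le_dense[OF assms]] dense_imp_regular[OF assms] assms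
  by (simp add: regular_closed dense_closed)

lemma regular_mult: "\<lbrakk>x \<in> regular; y \<in> carrier A\<rbrakk> \<Longrightarrow> x \<otimes> y \<in> regular"
  using neg_antimono[of "x \<otimes> y" x] mul_le_left[of x y] by (auto simp: regular_def)

lemma dense_mult: "\<lbrakk>x \<in> dense; y \<in> dense\<rbrakk> \<Longrightarrow> x \<otimes> y \<in> dense"
  by (simp add: dense_def neg_mult)

lemma dense_imp: "\<lbrakk>x \<in> carrier A; y \<in> dense\<rbrakk> \<Longrightarrow> x \<triangleright> y \<in> dense"
  using neg_antimono[of y "x \<triangleright> y"] by (auto simp: dense_def le_imp)

lemma regular_or_one_imp:
  assumes "x \<in> insert \<one> regular" "y \<in> insert \<one> regular"
  shows "x \<triangleright> y \<in> insert \<one> regular"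
proof -
  have A: "x \<in> carrier A" "y \<in> carrier A"
    using assms by (auto simp: regular_closed)
  show ?thesis
  proof (cases "x \<preceq> y")
    case True
    then show ?thesis
      using A by (simp add: imp_eq_one_iff)
  next
    case False
    then have "x \<otimes> (x \<triangleright> y) = y"
      using A not_le[of x y] by (simp add: mul_imp_eq)
    then show ?thesis
      using dense_mult_regular[of x "x \<triangleright> y"] regular_iff_not_dense[of "x \<triangleright> y"] assms A False
      by (cases "x \<triangleright> y \<in> dense") (auto simp: one_imp m_comm[of _ x])
  qed
qed

lemma regular_or_one_neg_neg: "x \<in> insert \<one> regular \<Longrightarrow> neg (neg x) = x"
  by (auto simp: regular_neg_neg)

text \<open>
  The value of \<open>dbl_bar\<close>: the outer minimum in its definition is taken of two equal terms.
\<close>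

definition bar :: "'a \<Rightarrow> 'a"
  where "bar x = (x \<triangleright> (x \<otimes> x)) \<triangleright> x"

lemma neg_mult_neg_neg: "x \<in> insert \<one> regular \<Longrightarrow> neg (neg x \<otimes> neg x) = neg x \<triangleright> x"
  by (auto simp: neg_mult regular_neg_neg regular_closed)

text \<open>
  For regular \<open>x\<close> the element \<open>x \<rightarrow> x * x\<close> is the maximum of \<open>x\<close> and \<open>\<not>x\<close>, so on the MV-part \<open>bar\<close> is the
  ordinary doubling \<open>x \<oplus> x\<close>.
\<close>

lemma bar_regular:
  assumes "x \<in> insert \<one> regular"
  shows "bar x = neg x \<triangleright> x"
proof (cases "x = \<one>")
  case True
  then show ?thesis
    by (simp add: bar_def imp_eq_one_iff)
next
  case False
  then have x: "x \<in> regular" and A: "x \<in> carrier A"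
    using assms by (auto simp: regular_closed)
  have *: "x \<triangleright> (x \<otimes> x) = neg (x \<otimes> (x \<triangleright> neg x))"
    using regular_neg_neg[OF regular_mult[OF x A]] A by (metis imp_closed neg_mult z_closed)
  show ?thesis
  proof (cases "neg x \<preceq> x")
    case True
    then have "x \<triangleright> (x \<otimes> x) = x"
      using A x * by (simp add: mul_imp_eq regular_neg_neg)
    moreover have "x \<triangleright> x = \<one>" "neg x \<triangleright> x = \<one>"
      using True A by (simp_all add: imp_eq_one_iff)
    ultimately show ?thesis
      by (simp add: bar_def)
  next
    case False
    then have "x \<triangleright> neg x = \<one>"
      using A by (simp add: imp_eq_one_iff not_le)
    then show ?thesis
      using A * by (simp add: bar_def)
  qed
qed

end

text \<open>
  The nontrivial chains of both logics at once. Chang's identity is stated with the doubling of BL,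
  which on MV-chains is the ordinary one.
\<close>

locale chang_chain = bl_chain +
  assumes nontrivial: "\<zero> \<noteq> \<one>"
    and bar_square: "x \<in> carrier A \<Longrightarrow> bar x \<otimes> bar x = bar (x \<otimes> x)"
begin

text \<open>
  The elements infinitely close to \<open>1\<close>, that is, the negations of the elements of the radical.
\<close>

definition coradical :: "'a set"
  where "coradical = {x \<in> insert \<one> regular. neg x \<preceq> x}"

lemma coradical_regular: "x \<in> coradical \<Longrightarrow> x \<in> insert \<one> regular"
  by (simp add: coradical_def)

lemma coradical_closed: "x \<in> coradical \<Longrightarrow> x \<in> carrier A"
  by (auto simp: coradical_def regular_closed)

lemma coradical_neg_neg: "x \<in> coradical \<Longrightarrow> neg (neg x) = x"
  by (simp add: coradical_def regular_or_one_neg_neg)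

lemma one_coradical: "\<one> \<in> coradical"
  by (simp add: coradical_def)

lemma bot_not_coradical: "\<zero> \<notin> coradical"
  using nontrivial by (auto simp: coradical_def)

lemma coradical_upward:
  "\<lbrakk>x \<in> coradical; x \<preceq> y; y \<in> insert \<one> regular\<rbrakk> \<Longrightarrow> y \<in> coradical"
proof -
  assume *: "x \<in> coradical" "x \<preceq> y" "y \<in> insert \<one> regular"
  then have A: "x \<in> carrier A" "y \<in> carrier A"
    by (auto simp: coradical_closed regular_closed)
  have "neg y \<preceq> x"
    using * A trans[OF neg_antimono[of x y]] by (auto simp: coradical_def)
  then have "neg y \<preceq> y"
    using * A trans[of "neg y" x y] by auto
  then show ?thesis
    using * by (simp add: coradical_def)
qed

text \<open>
  The condition \<open>\<not>x \<le> x\<close> says that \<open>2x = 1\<close>, and Chang's identity turns \<open>(2x)\<^sup>2 = 1\<close> into \<open>2(x\<^sup>2) = 1\<close>.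
\<close>

lemma coradical_square:
  assumes "x \<in> coradical"
  shows "x \<otimes> x \<in> coradical"
proof -
  have A: "x \<in> carrier A"
    by (simp add: assms coradical_closed)
  have W: "x \<otimes> x \<in> insert \<one> regular"
    using assms A regular_mult[of x x] by (auto simp: coradical_def)
  have "bar x = \<one>"
    using assms A by (simp add: bar_regular coradical_def imp_eq_one_iff)
  then have "neg (x \<otimes> x) \<triangleright> (x \<otimes> x) = \<one>"
    using bar_square[of x] A bar_regular[OF W] by simp
  then show ?thesis
    using W A by (simp add: imp_eq_one_iff coradical_def)
qed

lemma coradical_mult:
  assumes "x \<in> coradical" "y \<in> coradical"
  shows "x \<otimes> y \<in> coradical"
proof -
  have A: "x \<in> carrier A" "y \<in> carrier A"
    by (simp_all add: assms coradical_closed)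
  have W: "x \<otimes> y \<in> insert \<one> regular"
    using assms A regular_mult[of x y] by (auto simp: coradical_def)
  show ?thesis
  proof (cases "x \<preceq> y")
    case True
    then show ?thesis
      using coradical_upward[OF coradical_square[OF assms(1)] _ W] A by (simp add: mul_mono_right)
  next
    case False
    then show ?thesis
      using coradical_upward[OF coradical_square[OF assms(2)] _ W] A
      by (simp add: mul_mono_left not_le)
  qed
qed

lemma coradical_imp: "\<lbrakk>x \<in> coradical; y \<in> coradical\<rbrakk> \<Longrightarrow> x \<triangleright> y \<in> coradical"
  by (rule coradical_upward[of y])
    (simp_all only: coradical_closed le_imp coradical_regular regular_or_one_imp)

text \<open>
  As \<open>0\<close> is outside the coradical, \<open>z * t \<noteq> 0\<close>, which means \<open>\<not>t \<le> z\<close>. Then \<open>\<not>t = z * \<not>(z * t)\<close> by divisibility: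
  the product \<open>z * t\<close> determines \<open>\<not>t\<close> and so \<open>t\<close>.
\<close>

lemma coradical_cancel:
  assumes "x \<in> coradical" "y \<in> coradical" "z \<in> coradical" "z \<otimes> x \<preceq> z \<otimes> y"
  shows "x \<preceq> y"
proof (rule ccontr)
  assume n: "\<not> x \<preceq> y"
  have A: "x \<in> carrier A" "y \<in> carrier A" "z \<in> carrier A"
    by (simp_all add: assms coradical_closed)
  have "z \<otimes> y \<preceq> z \<otimes> x"
    using A n by (simp add: mul_mono_right not_le)
  then have eq: "z \<otimes> x = z \<otimes> y"
    using assms A by (simp add: le_antisym)
  have nle: "neg t \<preceq> z" and neg_eq: "neg t = z \<otimes> (neg (z \<otimes> t))" if "t \<in> coradical" for t
  proof -
    have t: "t \<in> carrier A"
      by (simp add: that coradical_closed)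
    have "z \<otimes> t \<noteq> \<zero>"
      using coradical_mult[OF assms(3) that] bot_not_coradical by metis
    then show "neg t \<preceq> z"
      using mult_eq_bot_iff[of z t] A t by (simp add: not_le)
    then show "neg t = z \<otimes> (neg (z \<otimes> t))"
      using A t by (simp add: neg_mult mul_imp_eq)
  qed
  have "neg x = neg y"
    using neg_eq assms eq by metis
  then have "x = y"
    using assms coradical_neg_neg by metis
  then show False
    using n A by simp
qed

text \<open>
  A fixed point \<open>\<not>x = x\<close> would have \<open>x\<^sup>2 = 0\<close> and \<open>2x = 1\<close>, against Chang's identity.
\<close>

lemma coradical_dichotomy:
  assumes "x \<in> insert \<one> regular"
  shows "x \<in> coradical \<longleftrightarrow> neg x \<notin> coradical"
proof -
  have A: "x \<in> carrier A"
    using assms by (auto simp: regular_closed)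
  have nn: "neg (neg x) = x"
    using assms regular_or_one_neg_neg by simp
  have "neg x \<noteq> x"
  proof
    assume x: "neg x = x"
    have "x \<otimes> x = \<zero>"
      using x A by (simp add: mult_eq_bot_iff)
    then have "bar x \<otimes> bar x = bar \<zero>"
      using A by (simp add: bar_square)
    moreover have "bar x = \<one>"
      using bar_regular[OF assms] x A by (simp add: imp_eq_one_iff)
    moreover have "bar \<zero> = \<zero>"
      by (simp add: bar_def one_imp)
    ultimately show False
      using nontrivial by simp
  qed
  moreover have W: "neg x \<in> insert \<one> regular"
  proof -
    have "x = \<zero> \<or> neg x \<in> regular"
      using nn A by (auto simp: regular_def)
    then show ?thesis
      by auto
  qed
  ultimately have "\<not> (neg x \<preceq> x \<and> x \<preceq> neg x)"
    using A le_antisym[of x "neg x"] by auto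
  moreover have "neg x \<preceq> x \<or> x \<preceq> neg x"
    using A total by simp
  ultimately show ?thesis
    using assms W nn unfolding coradical_def mem_Collect_eq by simp blast
qed

lemma below_coradical:
  assumes "x \<in> coradical" "y \<in> insert \<one> regular" "y \<notin> coradical"
  shows "y \<preceq> x"
proof (rule ccontr)
  have A: "x \<in> carrier A" "y \<in> carrier A"
    using assms by (auto simp: coradical_closed regular_closed)
  assume "\<not> y \<preceq> x"
  then have "x \<preceq> y"
    using A by (simp add: not_le)
  then show False
    using coradical_upward assms by blast
qed

lemma neg_not_coradical: "x \<in> coradical \<Longrightarrow> neg x \<notin> coradical"
  using coradical_dichotomy coradical_regular by blast

lemma neg_coradical: "\<lbrakk>x \<in> insert \<one> regular; x \<notin> coradical\<rbrakk> \<Longrightarrow> neg x \<in> coradical"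
  using coradical_dichotomy by blast

lemma neg_regular_or_one: "x \<in> coradical \<Longrightarrow> neg x \<in> insert \<one> regular"
  using regular_or_one_imp[of x \<zero>] nontrivial coradical_regular by (auto simp: regular_def)

text \<open>
  Together with \<open>neg_mult\<close>, this lemma and the next three express all operations of the MV-part through
  the multiplication and the residuum of the coradical; they match the defining equations of the
  rotation.
\<close>

lemma coradical_mult_neg:
  assumes "x \<in> coradical" "p \<in> coradical"
  shows "x \<otimes> neg p = neg (x \<triangleright> p)"
proof -
  have A: "x \<in> carrier A" "p \<in> carrier A"
    by (simp_all add: assms coradical_closed)
  have "neg p \<in> regular"
    using assms A nontrivial coradical_neg_neg[of p] bot_not_coradical
    by (auto simp: regular_def)
  then have "neg p \<otimes> x \<in> regular"
    using A by (simp add: regular_mult)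
  then have "x \<otimes> neg p = neg (neg (x \<otimes> neg p))"
    using A by (simp add: regular_neg_neg m_comm[of x])
  also have "neg (x \<otimes> neg p) = x \<triangleright> p"
    using A assms by (simp add: neg_mult coradical_neg_neg)
  finally show ?thesis .
qed

lemma neg_mult_neg_coradical:
  assumes "x \<in> coradical" "p \<in> coradical"
  shows "neg x \<otimes> neg p = \<zero>"
proof -
  have A: "x \<in> carrier A" "p \<in> carrier A"
    by (simp_all add: assms coradical_closed)
  have "neg x \<preceq> p"
    using assms below_coradical[of p "neg x"] neg_not_coradical neg_regular_or_one by blast
  then show ?thesis
    using A assms by (simp add: mult_eq_bot_iff coradical_neg_neg)
qed

lemma neg_imp_neg_coradical:
  assumes "x \<in> coradical" "p \<in> coradical"
  shows "neg x \<triangleright> neg p = p \<triangleright> x"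
proof -
  have A: "x \<in> carrier A" "p \<in> carrier A"
    by (simp_all add: assms coradical_closed)
  have "neg x \<triangleright> neg p = neg (p \<otimes> neg x)"
    using A by (simp add: neg_mult m_comm[of p])
  then show ?thesis
    using A assms by (simp add: neg_mult coradical_neg_neg)
qed

lemma neg_imp_coradical: "\<lbrakk>x \<in> coradical; p \<in> coradical\<rbrakk> \<Longrightarrow> neg x \<triangleright> p = \<one>"
  using below_coradical[of p "neg x"] neg_not_coradical neg_regular_or_one
  by (simp add: imp_eq_one_iff coradical_closed)

end

section \<open>Fractions over an ordered cancellative monoid\<close>

locale ordered_cancel_monoid = comm_monoid G
  for G :: "('a, 'm) monoid_scheme" (structure) +
  fixes le :: "'a \<Rightarrow> 'a \<Rightarrow> bool" (infix \<open>\<sqsubseteq>\<close> 50)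
  assumes le_trans: "\<lbrakk>x \<sqsubseteq> y; y \<sqsubseteq> z; x \<in> carrier G; y \<in> carrier G; z \<in> carrier G\<rbrakk> \<Longrightarrow> x \<sqsubseteq> z"
    and le_total: "\<lbrakk>x \<in> carrier G; y \<in> carrier G\<rbrakk> \<Longrightarrow> x \<sqsubseteq> y \<or> y \<sqsubseteq> x"
    and le_mult_iff: "\<lbrakk>x \<in> carrier G; y \<in> carrier G; z \<in> carrier G\<rbrakk>
          \<Longrightarrow> x \<otimes> z \<sqsubseteq> y \<otimes> z \<longleftrightarrow> x \<sqsubseteq> y"
begin

definition fractions :: "('a \<times> 'a) set"
  where "fractions = {(f, g). f \<in> carrier G \<and> g \<in> carrier G \<and> f \<sqsubseteq> g}"

text \<open>
  The pair \<open>(f, g)\<close> stands for \<open>f / g\<close>, and the operations are those of fractions: an inequality is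
  cleared of denominators, and the residuum is division cut off at \<open>1\<close>.
\<close>

fun frac_le :: "'a \<times> 'a \<Rightarrow> 'a \<times> 'a \<Rightarrow> bool"
  where "frac_le (f, g) (f', g') \<longleftrightarrow> f \<otimes> g' \<sqsubseteq> f' \<otimes> g"

fun frac_mult :: "'a \<times> 'a \<Rightarrow> 'a \<times> 'a \<Rightarrow> 'a \<times> 'a"
  where "frac_mult (f, g) (f', g') = (f \<otimes> f', g \<otimes> g')"

fun frac_imp :: "'a \<times> 'a \<Rightarrow> 'a \<times> 'a \<Rightarrow> 'a \<times> 'a"
  where "frac_imp (f, g) (f', g') = (if f \<otimes> g' \<sqsubseteq> f' \<otimes> g then (\<one>, \<one>) else (f' \<otimes> g, f \<otimes> g'))"

lemma le_refl: "x \<in> carrier G \<Longrightarrow> x \<sqsubseteq> x"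
  using le_total by blast

lemma not_le: "\<lbrakk>\<not> x \<sqsubseteq> y; x \<in> carrier G; y \<in> carrier G\<rbrakk> \<Longrightarrow> y \<sqsubseteq> x"
  using le_total by blast

lemma mult_mono:
  assumes "x \<sqsubseteq> y" "z \<sqsubseteq> w" "x \<in> carrier G" "y \<in> carrier G" "z \<in> carrier G" "w \<in> carrier G"
  shows "x \<otimes> z \<sqsubseteq> y \<otimes> w"
proof -
  have "x \<otimes> z \<sqsubseteq> y \<otimes> z"
    using assms by (simp add: le_mult_iff)
  moreover have "y \<otimes> z \<sqsubseteq> y \<otimes> w"
    using assms by (simp add: le_mult_iff m_comm[of y])
  ultimately show ?thesis
    using assms le_trans[of "x \<otimes> z" "y \<otimes> z"] by simp
qed

text \<open>
  Multiply both inequalities by the missing denominator, chain them and cancel the common factor.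
\<close>

lemma frac_trans:
  assumes "frac_le x y" "frac_le y z" "x \<in> fractions" "y \<in> fractions" "z \<in> fractions"
  shows "frac_le x z"
proof -
  obtain f g f' g' f'' g'' where x: "x = (f, g)" and y: "y = (f', g')" and z: "z = (f'', g'')"
    by (metis prod.exhaust)
  have G: "f \<in> carrier G" "g \<in> carrier G" "f' \<in> carrier G" "g' \<in> carrier G"
    "f'' \<in> carrier G" "g'' \<in> carrier G"
    using assms by (auto simp: x y z fractions_def)
  have "(f \<otimes> g') \<otimes> g'' \<sqsubseteq> (f' \<otimes> g) \<otimes> g''"
    using assms G by (simp add: x y le_mult_iff)
  moreover have "(f' \<otimes> g'') \<otimes> g \<sqsubseteq> (f'' \<otimes> g') \<otimes> g"
    using assms G by (simp add: z y le_mult_iff)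
  ultimately have "(f \<otimes> g'') \<otimes> g' \<sqsubseteq> (f'' \<otimes> g) \<otimes> g'"
    using G le_trans[of "(f \<otimes> g') \<otimes> g''" "(f' \<otimes> g) \<otimes> g''" "(f'' \<otimes> g') \<otimes> g"]
    by (simp add: m_ac)
  then show ?thesis
    using G by (simp add: x z le_mult_iff)
qed

lemma frac_residuated:
  assumes "x \<in> fractions" "y \<in> fractions" "z \<in> fractions"
  shows "frac_le (frac_mult z x) y \<longleftrightarrow> frac_le z (frac_imp x y)"
proof -
  obtain f g f' g' k l where x: "x = (f, g)" and y: "y = (f', g')" and z: "z = (k, l)"
    by (metis prod.exhaust)
  have G: "f \<in> carrier G" "g \<in> carrier G" "f' \<in> carrier G" "g' \<in> carrier G"
    "k \<in> carrier G" "l \<in> carrier G" and kl: "k \<sqsubseteq> l"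
    using assms by (auto simp: x y z fractions_def)
  show ?thesis
  proof (cases "f \<otimes> g' \<sqsubseteq> f' \<otimes> g")
    case True
    then have "k \<otimes> (f \<otimes> g') \<sqsubseteq> l \<otimes> (f' \<otimes> g)"
      using G kl by (simp add: mult_mono)
    then show ?thesis
      using G kl True by (simp add: x y z m_ac)
  next
    case False
    then show ?thesis
      using G by (simp add: x y z m_ac)
  qed
qed

lemma frac_cancel:
  assumes "frac_le (frac_mult x y) (frac_mult x z)" "x \<in> fractions" "y \<in> fractions" "z \<in> fractions"
  shows "frac_le y z"
proof -
  obtain f g f' g' k l where x: "x = (f, g)" and y: "y = (f', g')" and z: "z = (k, l)"
    by (metis prod.exhaust)
  have G: "f \<in> carrier G" "g \<in> carrier G" "f' \<in> carrier G" "g' \<in> carrier G"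
    "k \<in> carrier G" "l \<in> carrier G"
    using assms by (auto simp: x y z fractions_def)
  have "(f' \<otimes> l) \<otimes> (f \<otimes> g) \<sqsubseteq> (k \<otimes> g') \<otimes> (f \<otimes> g)"
    using G assms by (simp add: x y z m_ac)
  then show ?thesis
    using G le_mult_iff[of "f' \<otimes> l" "k \<otimes> g'" "f \<otimes> g"] by (simp add: y z)
qed

lemma prehoop_fractions: "prehoop_chain fractions frac_le frac_mult frac_imp (\<one>, \<one>)"
proof unfold_locales
  show "frac_le x z" if "frac_le x y" "frac_le y z" "x \<in> fractions" "y \<in> fractions" "z \<in> fractions"
    for x y z
    using that by (rule frac_trans)
  show "frac_le (frac_mult z x) y \<longleftrightarrow> frac_le z (frac_imp x y)"
    if "x \<in> fractions" "y \<in> fractions" "z \<in> fractions" for x y z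
    using that by (rule frac_residuated)
  show "frac_mult x y \<in> fractions" if "x \<in> fractions" "y \<in> fractions" for x y
    using that by (auto simp: fractions_def mult_mono)
  show "frac_imp x y \<in> fractions" if "x \<in> fractions" "y \<in> fractions" for x y
    using that by (auto simp: fractions_def le_refl not_le split: if_splits)
  show "(\<one>, \<one>) \<in> fractions"
    by (simp add: fractions_def le_refl)
  show "frac_le x x" if "x \<in> fractions" for x
    using that by (auto simp: fractions_def le_refl)
  show "frac_le x y \<or> frac_le y x" if "x \<in> fractions" "y \<in> fractions" for x y
    using that by (auto simp: fractions_def not_le)
  show "frac_le x (\<one>, \<one>)" if "x \<in> fractions" for x
    using that by (auto simp: fractions_def)
  show "frac_le (frac_mult x y) (frac_mult y x)" if "x \<in> fractions" "y \<in> fractions" for x y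
    using that by (auto simp: fractions_def m_ac le_refl)
  show "frac_le (frac_mult (frac_mult x y) z) (frac_mult x (frac_mult y z))"
    if "x \<in> fractions" "y \<in> fractions" "z \<in> fractions" for x y z
    using that by (auto simp: fractions_def m_ac le_refl)
  show "frac_le x (frac_mult x (\<one>, \<one>))" "frac_le (frac_mult x (\<one>, \<one>)) x"
    if "x \<in> fractions" for x
    using that by (auto simp: fractions_def le_refl)
  show "frac_le y (frac_mult x (frac_imp x y))"
    if "frac_le y x" "x \<in> fractions" "y \<in> fractions" for x y
    using that by (auto simp: fractions_def le_refl m_ac)
qed

end

section \<open>The disconnected rotation of a cancellative hoop\<close>

locale cancel_prehoop_chain = prehoop_chain +
  assumes cancel: "\<lbrakk>x \<odot> y \<lesssim> x \<odot> z; x \<in> S; y \<in> S; z \<in> S\<rbrakk> \<Longrightarrow> y \<lesssim> z"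
begin

text \<open>
  \<open>(True, x)\<close> stands for \<open>x\<close> itself and \<open>(False, x)\<close> for its negation. Given the
  operations on \<open>S\<close>, the remaining values are forced by residuation and \<open>\<not>\<not>x = x\<close>, together with the requirement that two negations multiply to \<open>0\<close>.
\<close>

fun rot_le :: "bool \<times> 'a \<Rightarrow> bool \<times> 'a \<Rightarrow> bool" where
  "rot_le (True, x) (True, y) \<longleftrightarrow> x \<lesssim> y"
| "rot_le (True, x) (False, y) \<longleftrightarrow> False"
| "rot_le (False, x) (True, y) \<longleftrightarrow> True"
| "rot_le (False, x) (False, y) \<longleftrightarrow> y \<lesssim> x"

fun rot_mult :: "bool \<times> 'a \<Rightarrow> bool \<times> 'a \<Rightarrow> bool \<times> 'a" where
  "rot_mult (True, x) (True, y) = (True, x \<odot> y)"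
| "rot_mult (True, x) (False, y) = (False, x \<leadsto> y)"
| "rot_mult (False, x) (True, y) = (False, y \<leadsto> x)"
| "rot_mult (False, x) (False, y) = (False, e)"

fun rot_imp :: "bool \<times> 'a \<Rightarrow> bool \<times> 'a \<Rightarrow> bool \<times> 'a" where
  "rot_imp (True, x) (True, y) = (True, x \<leadsto> y)"
| "rot_imp (True, x) (False, y) = (False, x \<odot> y)"
| "rot_imp (False, x) (True, y) = (True, e)"
| "rot_imp (False, x) (False, y) = (True, y \<leadsto> x)"

lemma mul_le_swap:
  "\<lbrakk>x \<in> S; y \<in> S; z \<in> S\<rbrakk> \<Longrightarrow> x \<odot> y \<lesssim> z \<longleftrightarrow> y \<odot> x \<lesssim> z"
  using comm[of x y] comm[of y x] trans[of "x \<odot> y" "y \<odot> x" z] trans[of "y \<odot> x" "x \<odot> y" z]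
  by (meson mul_closed)

lemma le_imp_swap: "\<lbrakk>x \<in> S; y \<in> S; z \<in> S\<rbrakk> \<Longrightarrow> x \<lesssim> y \<leadsto> z \<longleftrightarrow> y \<lesssim> x \<leadsto> z"
  using mul_le_swap[of x y z] residuated by simp

text \<open>
  Cancellativity enters the rotation only through this inequality and the next one; they are
  divisibility for a negated element below a positive one and below another negated one.
\<close>

lemma imp_mul_le: "\<lbrakk>x \<in> S; y \<in> S\<rbrakk> \<Longrightarrow> x \<leadsto> x \<odot> y \<lesssim> y"
  by (rule cancel[of x]) (simp_all add: imp_eval)

lemma imp_imp_le:
  assumes "x \<lesssim> y" "x \<in> S" "y \<in> S"
  shows "(y \<leadsto> x) \<leadsto> x \<lesssim> y"
proof -
  have "(y \<leadsto> x) \<odot> ((y \<leadsto> x) \<leadsto> x) \<lesssim> x"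
    using assms by (simp add: imp_eval)
  moreover have "x \<lesssim> y \<odot> (y \<leadsto> x)"
    using assms by (simp add: divisible)
  moreover have "y \<odot> (y \<leadsto> x) \<lesssim> (y \<leadsto> x) \<odot> y"
    using assms by (simp add: comm)
  ultimately have "(y \<leadsto> x) \<odot> ((y \<leadsto> x) \<leadsto> x) \<lesssim> (y \<leadsto> x) \<odot> y"
    using assms trans[of "(y \<leadsto> x) \<odot> ((y \<leadsto> x) \<leadsto> x)" x "y \<odot> (y \<leadsto> x)"]
      trans[of "(y \<leadsto> x) \<odot> ((y \<leadsto> x) \<leadsto> x)" "y \<odot> (y \<leadsto> x)" "(y \<leadsto> x) \<odot> y"]
    by simp
  then show ?thesis
    by (rule cancel) (simp_all add: assms)
qed

lemma imp_swap: "\<lbrakk>x \<in> S; y \<in> S; z \<in> S\<rbrakk> \<Longrightarrow> x \<leadsto> (y \<leadsto> z) \<lesssim> y \<leadsto> (x \<leadsto> z)"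
proof -
  assume S: "x \<in> S" "y \<in> S" "z \<in> S"
  have "x \<leadsto> (y \<leadsto> z) \<lesssim> (x \<odot> y) \<leadsto> z" "(x \<odot> y) \<leadsto> z \<lesssim> (y \<odot> x) \<leadsto> z"
    "(y \<odot> x) \<leadsto> z \<lesssim> y \<leadsto> (x \<leadsto> z)"
    using S by (simp_all add: uncurry curry imp_mono comm)
  then show ?thesis
    using S trans[of "x \<leadsto> (y \<leadsto> z)" "(x \<odot> y) \<leadsto> z" "(y \<odot> x) \<leadsto> z"]
      trans[of "x \<leadsto> (y \<leadsto> z)" "(y \<odot> x) \<leadsto> z" "y \<leadsto> (x \<leadsto> z)"] by simp
qed

lemma curry_swap: "\<lbrakk>x \<in> S; y \<in> S; z \<in> S\<rbrakk> \<Longrightarrow> (x \<odot> y) \<leadsto> z \<lesssim> y \<leadsto> (x \<leadsto> z)"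
  using trans[of "(x \<odot> y) \<leadsto> z" "x \<leadsto> (y \<leadsto> z)" "y \<leadsto> (x \<leadsto> z)"]
  by (simp add: curry imp_swap)

lemma e_imp_le: "x \<in> S \<Longrightarrow> e \<leadsto> x \<lesssim> x"
  using trans[of "e \<leadsto> x" "e \<odot> (e \<leadsto> x)" x] by (simp add: le_e_mul imp_eval)

lemma preBL_rotation:
  "preBL_chain (UNIV \<times> S) rot_le rot_mult rot_imp (True, e) (False, e)"
proof unfold_locales
  show "rot_mult u v \<in> UNIV \<times> S" if "u \<in> UNIV \<times> S" "v \<in> UNIV \<times> S" for u v
    using that by (cases "(u, v)" rule: rot_mult.cases) auto
  show "rot_imp u v \<in> UNIV \<times> S" if "u \<in> UNIV \<times> S" "v \<in> UNIV \<times> S" for u v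
    using that by (cases "(u, v)" rule: rot_imp.cases) auto
  show "(True, e) \<in> UNIV \<times> S" "(False, e) \<in> UNIV \<times> S"
    by auto
  show "rot_le u u" if "u \<in> UNIV \<times> S" for u
    using that by (cases "(u, u)" rule: rot_le.cases) auto
  show "rot_le u w" if "rot_le u v" "rot_le v w" "u \<in> UNIV \<times> S" "v \<in> UNIV \<times> S" "w \<in> UNIV \<times> S"
    for u v w
    using that by (cases "fst u"; cases "fst v"; cases "fst w"; cases u; cases v; cases w)
      (auto intro: trans)
  show "rot_le u v \<or> rot_le v u" if "u \<in> UNIV \<times> S" "v \<in> UNIV \<times> S" for u v
    using that by (cases "(u, v)" rule: rot_le.cases) (auto simp: not_le)
  show "rot_le u (True, e)" "rot_le (False, e) u" if "u \<in> UNIV \<times> S" for u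
    using that by (cases "fst u"; cases u; auto)+
  show "rot_le (rot_mult u v) (rot_mult v u)" if "u \<in> UNIV \<times> S" "v \<in> UNIV \<times> S" for u v
    using that by (cases "(u, v)" rule: rot_mult.cases) (auto simp: comm)
  show "rot_le (rot_mult (rot_mult u v) w) (rot_mult u (rot_mult v w))"
    if "u \<in> UNIV \<times> S" "v \<in> UNIV \<times> S" "w \<in> UNIV \<times> S" for u v w
    using that by (cases "fst u"; cases "fst v"; cases "fst w"; cases u; cases v; cases w)
      (auto simp: assoc uncurry imp_swap curry_swap e_le_imp_iff)
  show "rot_le u (rot_mult u (True, e))" "rot_le (rot_mult u (True, e)) u" if "u \<in> UNIV \<times> S" for u
    using that by (cases "fst u"; cases u; auto simp: unit unit' le_imp e_imp_le)+
  show "rot_le (rot_mult w u) v \<longleftrightarrow> rot_le w (rot_imp u v)"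
    if "u \<in> UNIV \<times> S" "v \<in> UNIV \<times> S" "w \<in> UNIV \<times> S" for u v w
    using that by (cases "fst u"; cases "fst v"; cases "fst w"; cases u; cases v; cases w)
      (auto simp: residuated le_imp_swap)
  show "rot_le v (rot_mult u (rot_imp u v))"
    if "rot_le v u" "u \<in> UNIV \<times> S" "v \<in> UNIV \<times> S" for u v
    using that by (cases "fst u"; cases "fst v"; cases u; cases v)
      (auto simp: divisible imp_mul_le imp_imp_le)
qed

end

section \<open>Lexicographic products\<close>

locale lex_product =
  fixes J :: "'i set" and r :: "('i \<times> 'i) set"
    and G :: "'i \<Rightarrow> ('a, 'm) monoid_scheme"
    and le :: "'i \<Rightarrow> 'a \<Rightarrow> 'a \<Rightarrow> bool"
  assumes wf: "wf r"
    and r_trans: "trans r"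
    and r_total: "\<lbrakk>i \<in> J; j \<in> J; i \<noteq> j\<rbrakk> \<Longrightarrow> (i, j) \<in> r \<or> (j, i) \<in> r"
    and factor: "i \<in> J \<Longrightarrow> ordered_cancel_monoid (G i) (le i)"
    and antisym: "\<lbrakk>i \<in> J; le i x y; le i y x; x \<in> carrier (G i); y \<in> carrier (G i)\<rbrakk> \<Longrightarrow> x = y"
begin

definition lex_monoid :: "('i \<Rightarrow> 'a) monoid"
  where "lex_monoid = \<lparr>carrier = (\<Pi>\<^sub>E i\<in>J. carrier (G i)),
    monoid.mult = (\<lambda>f g. \<lambda>i\<in>J. f i \<otimes>\<^bsub>G i\<^esub> g i), one = (\<lambda>i\<in>J. \<one>\<^bsub>G i\<^esub>)\<rparr>"

text \<open>
  The first index at which two elements differ exists because \<open>r\<close> is well-founded, so arbitrary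
  functions can be compared.
\<close>

definition lex_le :: "('i \<Rightarrow> 'a) \<Rightarrow> ('i \<Rightarrow> 'a) \<Rightarrow> bool"
  where "lex_le f g \<longleftrightarrow> f = g \<or>
    (\<exists>i\<in>J. le i (f i) (g i) \<and> f i \<noteq> g i \<and> (\<forall>j\<in>J. (j, i) \<in> r \<longrightarrow> f j = g j))"

lemma factor_mult_eq_iff:
  assumes "i \<in> J" "x \<in> carrier (G i)" "y \<in> carrier (G i)" "z \<in> carrier (G i)"
  shows "x \<otimes>\<^bsub>G i\<^esub> z = y \<otimes>\<^bsub>G i\<^esub> z \<longleftrightarrow> x = y"
proof -
  interpret ordered_cancel_monoid "G i" "le i"
    using assms(1) by (rule factor)
  show ?thesis
    using assms antisym[of i x y] le_mult_iff[of x y z] le_mult_iff[of y x z] le_refl by auto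
qed

lemma lex_trans:
  assumes "lex_le f g" "lex_le g h"
    and M: "f \<in> carrier lex_monoid" "g \<in> carrier lex_monoid" "h \<in> carrier lex_monoid"
  shows "lex_le f h"
proof (cases "f = g \<or> g = h")
  case True
  then show ?thesis
    using assms by auto
next
  case False
  then obtain i j where i: "i \<in> J" "le i (f i) (g i)" "f i \<noteq> g i"
      "\<And>k. k \<in> J \<Longrightarrow> (k, i) \<in> r \<Longrightarrow> f k = g k"
    and j: "j \<in> J" "le j (g j) (h j)" "g j \<noteq> h j" "\<And>k. k \<in> J \<Longrightarrow> (k, j) \<in> r \<Longrightarrow> g k = h k"
    using assms unfolding lex_le_def by blast
  have C: "f i \<in> carrier (G i)" "g i \<in> carrier (G i)" "h i \<in> carrier (G i)" if "i \<in> J" for i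
    using M that by (auto simp: lex_monoid_def)
  consider "i = j" | "(i, j) \<in> r" | "(j, i) \<in> r"
    using r_total i(1) j(1) by blast
  then show ?thesis
  proof cases
    case 1
    interpret ordered_cancel_monoid "G i" "le i"
      using i(1) by (rule factor)
    have "le i (f i) (h i)"
      using le_trans[of "f i" "g i" "h i"] C i(1,2) j(2) 1 by simp
    moreover have "f i \<noteq> h i"
      using antisym[of i "f i" "g i"] C i j 1 by metis
    moreover have "f k = h k" if "k \<in> J" "(k, i) \<in> r" for k
      using that i(4) j(4) 1 by simp
    ultimately show ?thesis
      using i(1) unfolding lex_le_def by blast
  next
    case 2
    then have "f k = h k" if "k \<in> J" "(k, i) \<in> r" for k
      using that i(4) j(4) transD[OF r_trans] by metis
    moreover have "g i = h i"
      using 2 i(1) j(4) by simp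
    ultimately show ?thesis
      using i(1-3) unfolding lex_le_def by metis
  next
    case 3
    then have "f k = h k" if "k \<in> J" "(k, j) \<in> r" for k
      using that i(4) j(4) transD[OF r_trans] by metis
    moreover have "f j = g j"
      using 3 j(1) i(4) by simp
    ultimately show ?thesis
      using j(1-3) unfolding lex_le_def by metis
  qed
qed

lemma lex_total:
  assumes M: "f \<in> carrier lex_monoid" "g \<in> carrier lex_monoid"
  shows "lex_le f g \<or> lex_le g f"
proof (cases "f = g")
  case True
  then show ?thesis
    by (simp add: lex_le_def)
next
  case False
  then have "{i \<in> J. f i \<noteq> g i} \<noteq> {}"
    using M PiE_ext[of f J "\<lambda>i. carrier (G i)" g] by (auto simp: lex_monoid_def)
  then obtain i where i: "i \<in> J" "f i \<noteq> g i" "\<And>j. (j, i) \<in> r \<Longrightarrow> j \<in> J \<Longrightarrow> f j = g j"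
    using wfE_min[OF wf, of _ "{i \<in> J. f i \<noteq> g i}"] by (metis (mono_tags, lifting) ex_in_conv mem_Collect_eq)
  interpret ordered_cancel_monoid "G i" "le i"
    using i(1) by (rule factor)
  have "le i (f i) (g i) \<or> le i (g i) (f i)"
    using le_total M i(1) by (auto simp: lex_monoid_def)
  then show ?thesis
    using i unfolding lex_le_def by metis
qed

text \<open>
  Multiplying by \<open>h\<close> changes neither the set of indices where \<open>f\<close> and \<open>g\<close> differ nor the comparison at any
  index, because every factor is cancellative.
\<close>

lemma lex_mult_iff:
  assumes M: "f \<in> carrier lex_monoid" "g \<in> carrier lex_monoid" "h \<in> carrier lex_monoid"
  shows "lex_le (f \<otimes>\<^bsub>lex_monoid\<^esub> h) (g \<otimes>\<^bsub>lex_monoid\<^esub> h) \<longleftrightarrow> lex_le f g"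
proof -
  have C: "f i \<in> carrier (G i)" "g i \<in> carrier (G i)" "h i \<in> carrier (G i)" if "i \<in> J" for i
    using M that by (auto simp: lex_monoid_def)
  have eq: "(f \<otimes>\<^bsub>lex_monoid\<^esub> h) i = (g \<otimes>\<^bsub>lex_monoid\<^esub> h) i \<longleftrightarrow> f i = g i" if "i \<in> J" for i
    using that C by (simp add: lex_monoid_def factor_mult_eq_iff)
  have le: "le i ((f \<otimes>\<^bsub>lex_monoid\<^esub> h) i) ((g \<otimes>\<^bsub>lex_monoid\<^esub> h) i) \<longleftrightarrow> le i (f i) (g i)"
    if "i \<in> J" for i
    using that C ordered_cancel_monoid.le_mult_iff[OF factor[OF that]] by (simp add: lex_monoid_def)
  have "f \<otimes>\<^bsub>lex_monoid\<^esub> h = g \<otimes>\<^bsub>lex_monoid\<^esub> h \<longleftrightarrow> f = g"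
  proof
    assume "f \<otimes>\<^bsub>lex_monoid\<^esub> h = g \<otimes>\<^bsub>lex_monoid\<^esub> h"
    then have "f i = g i" if "i \<in> J" for i
      using eq[OF that] by simp
    then show "f = g"
      using M PiE_ext[of f J "\<lambda>i. carrier (G i)" g] by (auto simp: lex_monoid_def)
  qed simp
  then show ?thesis
    unfolding lex_le_def using eq le by (metis (no_types, lifting))
qed

lemma comm_monoid_lex: "comm_monoid lex_monoid"
proof (rule comm_monoidI)
  have C: "x i \<in> carrier (G i)" if "x \<in> carrier lex_monoid" "i \<in> J" for x i
    using that by (auto simp: lex_monoid_def)
  have cm: "comm_monoid (G i)" if "i \<in> J" for i
    using factor[OF that] by (simp add: ordered_cancel_monoid_def)
  have m: "monoid (G i)" if "i \<in> J" for i
    using cm[OF that] by (rule comm_monoid.axioms)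
  show "x \<otimes>\<^bsub>lex_monoid\<^esub> y \<in> carrier lex_monoid"
    if "x \<in> carrier lex_monoid" "y \<in> carrier lex_monoid" for x y
  proof -
    have "x i \<otimes>\<^bsub>G i\<^esub> y i \<in> carrier (G i)" if "i \<in> J" for i
      using monoid.m_closed[OF m] C \<open>x \<in> _\<close> \<open>y \<in> _\<close> that by blast
    then show ?thesis
      by (simp add: lex_monoid_def)
  qed
  show "\<one>\<^bsub>lex_monoid\<^esub> \<in> carrier lex_monoid"
    using monoid.one_closed[OF m] by (simp add: lex_monoid_def)
  show "x \<otimes>\<^bsub>lex_monoid\<^esub> y \<otimes>\<^bsub>lex_monoid\<^esub> z = x \<otimes>\<^bsub>lex_monoid\<^esub> (y \<otimes>\<^bsub>lex_monoid\<^esub> z)"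
    if "x \<in> carrier lex_monoid" "y \<in> carrier lex_monoid" "z \<in> carrier lex_monoid" for x y z
  proof -
    have "x i \<otimes>\<^bsub>G i\<^esub> y i \<otimes>\<^bsub>G i\<^esub> z i = x i \<otimes>\<^bsub>G i\<^esub> (y i \<otimes>\<^bsub>G i\<^esub> z i)" if "i \<in> J" for i
      using monoid.m_assoc[OF m] C \<open>x \<in> _\<close> \<open>y \<in> _\<close> \<open>z \<in> _\<close> that by blast
    then show ?thesis
      by (simp add: lex_monoid_def cong: restrict_cong)
  qed
  show "\<one>\<^bsub>lex_monoid\<^esub> \<otimes>\<^bsub>lex_monoid\<^esub> x = x" if "x \<in> carrier lex_monoid" for x
  proof -
    have "\<one>\<^bsub>G i\<^esub> \<otimes>\<^bsub>G i\<^esub> x i = x i" if "i \<in> J" for i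
      using monoid.l_one[OF m] C \<open>x \<in> _\<close> that by blast
    moreover have "restrict x J = x"
      using that by (simp add: lex_monoid_def)
    ultimately show ?thesis
      by (simp add: lex_monoid_def cong: restrict_cong)
  qed
  show "x \<otimes>\<^bsub>lex_monoid\<^esub> y = y \<otimes>\<^bsub>lex_monoid\<^esub> x"
    if "x \<in> carrier lex_monoid" "y \<in> carrier lex_monoid" for x y
  proof -
    have "x i \<otimes>\<^bsub>G i\<^esub> y i = y i \<otimes>\<^bsub>G i\<^esub> x i" if "i \<in> J" for i
      using comm_monoid.m_comm[OF cm] C \<open>x \<in> _\<close> \<open>y \<in> _\<close> that by blast
    then show ?thesis
      by (simp add: lex_monoid_def cong: restrict_cong)
  qed
qed

lemma ordered_cancel_monoid_lex: "ordered_cancel_monoid lex_monoid lex_le"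
  by (intro ordered_cancel_monoid.intro ordered_cancel_monoid_axioms.intro comm_monoid_lex)
    (use lex_trans lex_total lex_mult_iff in blast)+

definition coord :: "'i \<Rightarrow> 'a \<Rightarrow> 'i \<Rightarrow> 'a"
  where "coord i x = (\<lambda>j\<in>J. if j = i then x else \<one>\<^bsub>G j\<^esub>)"

lemma coord_closed:
  assumes "i \<in> J" "x \<in> carrier (G i)"
  shows "coord i x \<in> carrier lex_monoid"
proof -
  have "\<one>\<^bsub>G j\<^esub> \<in> carrier (G j)" if "j \<in> J" for j
    using factor[OF that] by (simp add: ordered_cancel_monoid_def comm_monoid_def monoid.one_closed)
  then show ?thesis
    using assms by (auto simp: coord_def lex_monoid_def)
qed

lemma coord_one: "i \<in> J \<Longrightarrow> coord i \<one>\<^bsub>G i\<^esub> = \<one>\<^bsub>lex_monoid\<^esub>"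
  by (auto simp: coord_def lex_monoid_def)

lemma coord_mult:
  assumes "i \<in> J"
  shows "coord i (x \<otimes>\<^bsub>G i\<^esub> y) = coord i x \<otimes>\<^bsub>lex_monoid\<^esub> coord i y"
proof -
  have "\<one>\<^bsub>G j\<^esub> \<otimes>\<^bsub>G j\<^esub> \<one>\<^bsub>G j\<^esub> = \<one>\<^bsub>G j\<^esub>" if "j \<in> J" for j
    using factor[OF that] by (simp add: ordered_cancel_monoid_def comm_monoid_def monoid.l_one)
  then show ?thesis
    by (auto simp: coord_def lex_monoid_def)
qed

lemma coord_le_iff:
  assumes "i \<in> J" "x \<in> carrier (G i)"
  shows "lex_le (coord i x) (coord i y) \<longleftrightarrow> le i x y"
proof -
  interpret ordered_cancel_monoid "G i" "le i"
    using assms(1) by (rule factor)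
  show ?thesis
  proof
    assume "lex_le (coord i x) (coord i y)"
    then show "le i x y"
      unfolding lex_le_def
    proof
      assume "coord i x = coord i y"
      then have "x = y"
        using assms(1) by (auto simp: coord_def fun_eq_iff split: if_splits)
      then show ?thesis
        using assms le_refl by simp
    qed (auto simp: coord_def split: if_splits)
  next
    assume "le i x y"
    then show "lex_le (coord i x) (coord i y)"
      using assms wf_not_refl[OF wf] unfolding lex_le_def by (auto simp: coord_def)
  qed
qed

end

section \<open>Ordinal sums\<close>

locale ordinal_sum = A: bl_chain A
  for A :: "('a, 'm) bl_structure_scheme" (structure) +
  fixes J :: "'i set" and r :: "('i \<times> 'i) set"
    and C :: "'i \<Rightarrow> ('c, 'n) bl_structure_scheme"
  assumes A_nontrivial: "\<zero> \<noteq> \<one>"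
    and wf: "wf r"
    and r_trans: "trans r"
    and r_total: "\<lbrakk>i \<in> J; j \<in> J; i \<noteq> j\<rbrakk> \<Longrightarrow> (i, j) \<in> r \<or> (j, i) \<in> r"
    and summand: "i \<in> J \<Longrightarrow> bl_chain (C i)"
begin

text \<open>
  The unit is left out because all summands share the unit of \<open>A\<close>.
\<close>

definition upper :: "'i \<Rightarrow> 'c set"
  where "upper i = bl_chain.dense (C i) - {\<one>\<^bsub>C i\<^esub>}"

definition sum_carrier :: "('a + 'i \<times> 'c) set"
  where "sum_carrier = Inl ` carrier A \<union> Inr ` Sigma J upper"

text \<open>
  The chain \<open>A\<close> without its unit comes first, the summands follow in the order \<open>r\<close>, and \<open>Inl \<one>\<close> is on
  top. Across components multiplication is the minimum, and \<open>u \<rightarrow> v\<close> is \<open>\<one>\<close> or \<open>v\<close>.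
\<close>

fun sum_le :: "'a + 'i \<times> 'c \<Rightarrow> 'a + 'i \<times> 'c \<Rightarrow> bool" where
  "sum_le (Inl a) (Inl b) \<longleftrightarrow> a \<preceq> b"
| "sum_le (Inl a) (Inr (j, q)) \<longleftrightarrow> a \<noteq> \<one>"
| "sum_le (Inr (i, p)) (Inl b) \<longleftrightarrow> b = \<one>"
| "sum_le (Inr (i, p)) (Inr (j, q)) \<longleftrightarrow> (i, j) \<in> r \<or> i = j \<and> p \<preceq>\<^bsub>C i\<^esub> q"

fun sum_mult :: "'a + 'i \<times> 'c \<Rightarrow> 'a + 'i \<times> 'c \<Rightarrow> 'a + 'i \<times> 'c" where
  "sum_mult (Inl a) (Inl b) = Inl (a \<otimes> b)"
| "sum_mult (Inl a) (Inr (j, q)) = (if a = \<one> then Inr (j, q) else Inl a)"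
| "sum_mult (Inr (i, p)) (Inl b) = (if b = \<one> then Inr (i, p) else Inl b)"
| "sum_mult (Inr (i, p)) (Inr (j, q)) =
    (if i = j then Inr (i, p \<otimes>\<^bsub>C i\<^esub> q) else if (i, j) \<in> r then Inr (i, p) else Inr (j, q))"

fun sum_imp :: "'a + 'i \<times> 'c \<Rightarrow> 'a + 'i \<times> 'c \<Rightarrow> 'a + 'i \<times> 'c" where
  "sum_imp (Inl a) (Inl b) = Inl (a \<triangleright> b)"
| "sum_imp (Inl a) (Inr (j, q)) = (if a = \<one> then Inr (j, q) else Inl \<one>)"
| "sum_imp (Inr (i, p)) (Inl b) = Inl b"
| "sum_imp (Inr (i, p)) (Inr (j, q)) =
    (if i = j then if p \<preceq>\<^bsub>C i\<^esub> q then Inl \<one> else Inr (i, p \<triangleright>\<^bsub>C i\<^esub> q)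
     else if (i, j) \<in> r then Inl \<one> else Inr (j, q))"

lemma upper_closed: "\<lbrakk>i \<in> J; p \<in> upper i\<rbrakk> \<Longrightarrow> p \<in> carrier (C i)"
  using bl_chain.dense_closed[OF summand] by (simp add: upper_def)

lemma upper_mult:
  assumes "i \<in> J" "p \<in> upper i" "q \<in> upper i"
  shows "p \<otimes>\<^bsub>C i\<^esub> q \<in> upper i"
proof -
  interpret bl_chain "C i"
    using assms(1) by (rule summand)
  have "p \<in> carrier (C i)" "q \<in> carrier (C i)"
    using assms upper_closed by auto
  moreover from this have "p \<otimes>\<^bsub>C i\<^esub> q \<noteq> \<one>\<^bsub>C i\<^esub>"
    using assms mul_le_left[of p q] by (auto simp: upper_def)
  ultimately show ?thesis
    using assms by (simp add: upper_def dense_mult)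
qed

lemma upper_imp:
  assumes "i \<in> J" "p \<in> upper i" "q \<in> upper i" "\<not> p \<preceq>\<^bsub>C i\<^esub> q"
  shows "p \<triangleright>\<^bsub>C i\<^esub> q \<in> upper i"
proof -
  interpret bl_chain "C i"
    using assms(1) by (rule summand)
  have "p \<in> carrier (C i)" "q \<in> carrier (C i)"
    using assms upper_closed by auto
  then show ?thesis
    using assms by (simp add: upper_def dense_imp imp_eq_one_iff)
qed

text \<open>
  The chain properties of a summand in the form needed for case distinctions over indices.
\<close>

lemma upper_facts:
  assumes "i \<in> J"
  shows "p \<in> upper i \<Longrightarrow> p \<preceq>\<^bsub>C i\<^esub> p"
    and "\<lbrakk>p \<in> upper i; q \<in> upper i\<rbrakk> \<Longrightarrow> p \<preceq>\<^bsub>C i\<^esub> q \<or> q \<preceq>\<^bsub>C i\<^esub> p"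
    and "\<lbrakk>p \<preceq>\<^bsub>C i\<^esub> q; q \<preceq>\<^bsub>C i\<^esub> s; p \<in> upper i; q \<in> upper i; s \<in> upper i\<rbrakk> \<Longrightarrow> p \<preceq>\<^bsub>C i\<^esub> s"
    and "\<lbrakk>p \<in> upper i; q \<in> upper i\<rbrakk> \<Longrightarrow> p \<otimes>\<^bsub>C i\<^esub> q = q \<otimes>\<^bsub>C i\<^esub> p"
    and "\<lbrakk>p \<in> upper i; q \<in> upper i; s \<in> upper i\<rbrakk>
        \<Longrightarrow> p \<otimes>\<^bsub>C i\<^esub> q \<otimes>\<^bsub>C i\<^esub> s = p \<otimes>\<^bsub>C i\<^esub> (q \<otimes>\<^bsub>C i\<^esub> s)"
    and "\<lbrakk>p \<in> upper i; q \<in> upper i\<rbrakk> \<Longrightarrow> p \<otimes>\<^bsub>C i\<^esub> q \<preceq>\<^bsub>C i\<^esub> p"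
    and "\<lbrakk>p \<in> upper i; q \<in> upper i\<rbrakk> \<Longrightarrow> p \<otimes>\<^bsub>C i\<^esub> q \<preceq>\<^bsub>C i\<^esub> q"
    and "\<lbrakk>p \<in> upper i; q \<in> upper i; s \<in> upper i\<rbrakk>
        \<Longrightarrow> s \<otimes>\<^bsub>C i\<^esub> p \<preceq>\<^bsub>C i\<^esub> q \<longleftrightarrow> s \<preceq>\<^bsub>C i\<^esub> p \<triangleright>\<^bsub>C i\<^esub> q"
    and "\<lbrakk>q \<preceq>\<^bsub>C i\<^esub> p; p \<in> upper i; q \<in> upper i\<rbrakk> \<Longrightarrow> p \<otimes>\<^bsub>C i\<^esub> (p \<triangleright>\<^bsub>C i\<^esub> q) = q"
proof -
  interpret bl_chain "C i"
    using assms by (rule summand)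
  note c [simp] = upper_closed[OF assms]
  show "p \<in> upper i \<Longrightarrow> p \<preceq>\<^bsub>C i\<^esub> p"
    by (simp add: le_refl)
  show "\<lbrakk>p \<in> upper i; q \<in> upper i\<rbrakk> \<Longrightarrow> p \<preceq>\<^bsub>C i\<^esub> q \<or> q \<preceq>\<^bsub>C i\<^esub> p"
    by (simp add: chain)
  show "\<lbrakk>p \<preceq>\<^bsub>C i\<^esub> q; q \<preceq>\<^bsub>C i\<^esub> s; p \<in> upper i; q \<in> upper i; s \<in> upper i\<rbrakk> \<Longrightarrow> p \<preceq>\<^bsub>C i\<^esub> s"
    by (rule le_trans[of p q s]) simp_all
  show "\<lbrakk>p \<in> upper i; q \<in> upper i\<rbrakk> \<Longrightarrow> p \<otimes>\<^bsub>C i\<^esub> q = q \<otimes>\<^bsub>C i\<^esub> p"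
    by (rule m_comm) simp_all
  show "\<lbrakk>p \<in> upper i; q \<in> upper i; s \<in> upper i\<rbrakk>
        \<Longrightarrow> p \<otimes>\<^bsub>C i\<^esub> q \<otimes>\<^bsub>C i\<^esub> s = p \<otimes>\<^bsub>C i\<^esub> (q \<otimes>\<^bsub>C i\<^esub> s)"
    by (simp add: m_assoc)
  show "\<lbrakk>p \<in> upper i; q \<in> upper i\<rbrakk> \<Longrightarrow> p \<otimes>\<^bsub>C i\<^esub> q \<preceq>\<^bsub>C i\<^esub> p"
    by (simp add: mul_le_left)
  show "\<lbrakk>p \<in> upper i; q \<in> upper i\<rbrakk> \<Longrightarrow> p \<otimes>\<^bsub>C i\<^esub> q \<preceq>\<^bsub>C i\<^esub> q"
    by (simp add: mul_le_right)
  show "\<lbrakk>p \<in> upper i; q \<in> upper i; s \<in> upper i\<rbrakk>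
        \<Longrightarrow> s \<otimes>\<^bsub>C i\<^esub> p \<preceq>\<^bsub>C i\<^esub> q \<longleftrightarrow> s \<preceq>\<^bsub>C i\<^esub> p \<triangleright>\<^bsub>C i\<^esub> q"
    by (rule residuation) simp_all
  show "\<lbrakk>q \<preceq>\<^bsub>C i\<^esub> p; p \<in> upper i; q \<in> upper i\<rbrakk> \<Longrightarrow> p \<otimes>\<^bsub>C i\<^esub> (p \<triangleright>\<^bsub>C i\<^esub> q) = q"
    by (simp add: mul_imp_eq)
qed

lemma sum_cases:
  assumes "u \<in> sum_carrier"
  obtains (lower) a where "u = Inl a" "a \<in> carrier A"
  | (upper) i p where "u = Inr (i, p)" "i \<in> J" "p \<in> upper i"
  using assms by (auto simp: sum_carrier_def)

lemma sum_carrier_iff [simp]: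
  "Inl a \<in> sum_carrier \<longleftrightarrow> a \<in> carrier A"
  "Inr (i, p) \<in> sum_carrier \<longleftrightarrow> i \<in> J \<and> p \<in> upper i"
  by (auto simp: sum_carrier_def)

lemma mult_eq_one_iff: "\<lbrakk>a \<in> carrier A; b \<in> carrier A\<rbrakk> \<Longrightarrow> a \<otimes> b = \<one> \<longleftrightarrow> a = \<one> \<and> b = \<one>"
  using A.mul_le_left[of a b] A.mul_le_right[of a b] by auto

lemma r_irrefl [simp]: "(i, i) \<notin> r"
  using wf by (rule wf_not_refl)

lemma r_asym: "(i, j) \<in> r \<Longrightarrow> (j, i) \<notin> r"
  using wf by (rule wf_not_sym)

lemma index_trichotomy:
  assumes "i \<in> J" "j \<in> J"
  obtains (eq) "i = j" | (less) "(i, j) \<in> r" "(j, i) \<notin> r" "i \<noteq> j" "j \<noteq> i"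
  | (greater) "(j, i) \<in> r" "(i, j) \<notin> r" "i \<noteq> j" "j \<noteq> i"
  using assms r_total[of i j] r_asym by auto

lemma r_transD: "\<lbrakk>(i, j) \<in> r; (j, k) \<in> r\<rbrakk> \<Longrightarrow> (i, k) \<in> r"
  using r_trans by (rule transD)

lemma sum_mult_closed: "\<lbrakk>u \<in> sum_carrier; v \<in> sum_carrier\<rbrakk> \<Longrightarrow> sum_mult u v \<in> sum_carrier"
  by (elim sum_cases) (auto simp: upper_mult)

lemma sum_refl: "u \<in> sum_carrier \<Longrightarrow> sum_le u u"
  by (elim sum_cases) (auto simp: upper_facts(1))

text \<open>
  When not all indices agree, the product is decided by the smallest index.
\<close>

lemma sum_mult_assoc_upper:
  assumes "i \<in> J" "j \<in> J" "k \<in> J" "p \<in> upper i" "q \<in> upper j" "s \<in> upper k"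
  shows "sum_mult (sum_mult (Inr (i, p)) (Inr (j, q))) (Inr (k, s)) =
    sum_mult (Inr (i, p)) (sum_mult (Inr (j, q)) (Inr (k, s)))"
  using assms
  by (cases rule: index_trichotomy[OF assms(1,2)]; cases rule: index_trichotomy[OF assms(2,3)];
      cases rule: index_trichotomy[OF assms(1,3)])
    (auto simp: upper_facts(5) dest: r_transD)

lemma sum_mult_assoc:
  assumes "u \<in> sum_carrier" "v \<in> sum_carrier" "w \<in> sum_carrier"
  shows "sum_mult (sum_mult u v) w = sum_mult u (sum_mult v w)"
  using assms
  by (elim sum_cases)
    (simp_all add: sum_mult_assoc_upper A.m_assoc mult_eq_one_iff del: sum_mult.simps(4), auto)

lemma sum_residuated_upper:
  assumes "i \<in> J" "j \<in> J" "k \<in> J" "p \<in> upper i" "q \<in> upper j" "s \<in> upper k"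
  shows "sum_le (sum_mult (Inr (k, s)) (Inr (i, p))) (Inr (j, q)) \<longleftrightarrow>
    sum_le (Inr (k, s)) (sum_imp (Inr (i, p)) (Inr (j, q)))"
proof -
  have "s \<otimes>\<^bsub>C i\<^esub> p \<preceq>\<^bsub>C i\<^esub> q" if "i = j" "i = k" "p \<preceq>\<^bsub>C i\<^esub> q"
    using assms that upper_facts(3)[of i "s \<otimes>\<^bsub>C i\<^esub> p" p q] upper_facts(7)[of i s p]
    by (simp add: upper_mult)
  moreover have "(k, j) \<in> r" if "(k, i) \<in> r" "(i, j) \<in> r"
    using that by (rule r_transD)
  moreover have "(k, j) \<notin> r \<and> k \<noteq> j" if "(i, k) \<in> r" "(j, i) \<in> r"
    using that r_transD[of j i k] r_asym by auto
  ultimately show ?thesis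
    using assms(4-6)
    by (cases rule: index_trichotomy[OF assms(1,2)]; cases rule: index_trichotomy[OF assms(1,3)])
      (simp_all add: upper_facts(8)[OF assms(1)] upper_facts(8)[OF assms(2)])
qed

lemma sum_residuated:
  assumes "u \<in> sum_carrier" "v \<in> sum_carrier" "w \<in> sum_carrier"
  shows "sum_le (sum_mult w u) v \<longleftrightarrow> sum_le w (sum_imp u v)"
  using assms(2,1,3)
proof (elim sum_cases)
  fix a b c
  assume "u = Inl a" "v = Inl b" "w = Inl c" "a \<in> carrier A" "b \<in> carrier A" "c \<in> carrier A"
  then show ?thesis
    by (simp add: A.residuated)
qed (simp_all add: sum_residuated_upper A.imp_eq_one_iff A.le_imp mult_eq_one_iff
      del: sum_mult.simps(4) sum_imp.simps(4), auto)

lemma preBL_sum: "preBL_chain sum_carrier sum_le sum_mult sum_imp (Inl \<one>) (Inl \<zero>)"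
proof unfold_locales
  show "sum_mult u v \<in> sum_carrier" if "u \<in> sum_carrier" "v \<in> sum_carrier" for u v
    using that by (elim sum_cases) (auto simp: upper_mult)
  show "sum_imp u v \<in> sum_carrier" if "u \<in> sum_carrier" "v \<in> sum_carrier" for u v
    using that by (elim sum_cases) (auto simp: upper_imp)
  show "Inl \<one> \<in> sum_carrier" "Inl \<zero> \<in> sum_carrier"
    by simp_all
  show "sum_le u u" if "u \<in> sum_carrier" for u
    using that by (elim sum_cases) (auto simp: upper_facts)
  show "sum_le u w"
    if "sum_le u v" "sum_le v w" "u \<in> sum_carrier" "v \<in> sum_carrier" "w \<in> sum_carrier" for u v w
    using that(3-5,1,2)
    by (elim sum_cases; simp) (auto intro: A.trans upper_facts(3) transD[OF r_trans])
  show "sum_le u v \<or> sum_le v u" if "u \<in> sum_carrier" "v \<in> sum_carrier" for u v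
    using that by (elim sum_cases; simp) (use A.total upper_facts(2) r_total in blast)+
  show "sum_le u (Inl \<one>)" "sum_le (Inl \<zero>) u" if "u \<in> sum_carrier" for u
    using that A_nontrivial by (elim sum_cases; simp)+
  show "sum_le (sum_mult u v) (sum_mult v u)" if "u \<in> sum_carrier" "v \<in> sum_carrier" for u v
    using that r_total
    by (elim sum_cases) (auto simp: A.comm upper_facts(1) upper_mult upper_facts(4) r_asym)
  show "sum_le (sum_mult (sum_mult u v) w) (sum_mult u (sum_mult v w))"
    if "u \<in> sum_carrier" "v \<in> sum_carrier" "w \<in> sum_carrier" for u v w
    using that sum_refl sum_mult_closed by (simp add: sum_mult_assoc)
  show "sum_le u (sum_mult u (Inl \<one>))" "sum_le (sum_mult u (Inl \<one>)) u" if "u \<in> sum_carrier" for u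
    using that by (elim sum_cases; simp add: upper_facts)+
  show "sum_le (sum_mult w u) v \<longleftrightarrow> sum_le w (sum_imp u v)"
    if "u \<in> sum_carrier" "v \<in> sum_carrier" "w \<in> sum_carrier" for u v w
    using that by (rule sum_residuated)
  show "sum_le v (sum_mult u (sum_imp u v))"
    if "sum_le v u" "u \<in> sum_carrier" "v \<in> sum_carrier" for u v
    using that(2,3,1)
    by (elim sum_cases) (auto simp: A.divisible upper_facts(1,2,9) r_asym split: if_splits)
qed

end

section \<open>Homomorphisms\<close>

definition bl_hom :: "('a, 'm) bl_structure_scheme \<Rightarrow> ('b, 'n) bl_structure_scheme \<Rightarrow> ('a \<Rightarrow> 'b) \<Rightarrow> bool"
  where "bl_hom A B h \<longleftrightarrow> h ` carrier A \<subseteq> carrier B \<and> h \<zero>\<^bsub>A\<^esub> = \<zero>\<^bsub>B\<^esub> \<and> h \<one>\<^bsub>A\<^esub> = \<one>\<^bsub>B\<^esub> \<and>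
    (\<forall>x\<in>carrier A. \<forall>y\<in>carrier A. h (x \<otimes>\<^bsub>A\<^esub> y) = h x \<otimes>\<^bsub>B\<^esub> h y \<and>
      h (x \<triangleright>\<^bsub>A\<^esub> y) = h x \<triangleright>\<^bsub>B\<^esub> h y)"

lemma bl_hom_closed: "\<lbrakk>bl_hom A B h; x \<in> carrier A\<rbrakk> \<Longrightarrow> h x \<in> carrier B"
  and bl_hom_bot: "bl_hom A B h \<Longrightarrow> h \<zero>\<^bsub>A\<^esub> = \<zero>\<^bsub>B\<^esub>"
  and bl_hom_mult: "\<lbrakk>bl_hom A B h; x \<in> carrier A; y \<in> carrier A\<rbrakk>
    \<Longrightarrow> h (x \<otimes>\<^bsub>A\<^esub> y) = h x \<otimes>\<^bsub>B\<^esub> h y"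
  and bl_hom_imp: "\<lbrakk>bl_hom A B h; x \<in> carrier A; y \<in> carrier A\<rbrakk>
    \<Longrightarrow> h (x \<triangleright>\<^bsub>A\<^esub> y) = h x \<triangleright>\<^bsub>B\<^esub> h y"
  unfolding bl_hom_def by blast+

lemma bl_hom_bar:
  assumes "bl_chain A" "bl_chain B" "bl_hom A B h" "x \<in> carrier A"
  shows "h (bl_chain.bar A x) = bl_chain.bar B (h x)"
proof -
  interpret A: bl_chain A by fact
  interpret B: bl_chain B by fact
  show ?thesis
    using assms(3,4) by (simp add: A.bar_def B.bar_def bl_hom_mult bl_hom_imp)
qed

text \<open>
  An identity in one variable holds at every element of the image of a homomorphism, even when the
  target is not known to satisfy it.
\<close>

lemma bl_hom_bar_square:
  assumes "chang_chain A" "bl_chain B" "bl_hom A B h" "x \<in> carrier A"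
  shows "bl_chain.bar B (h x) \<otimes>\<^bsub>B\<^esub> bl_chain.bar B (h x) = bl_chain.bar B (h x \<otimes>\<^bsub>B\<^esub> h x)"
proof -
  interpret A: chang_chain A by fact
  have "A.bar x \<in> carrier A"
    using assms(4) by (simp add: A.bar_def)
  then show ?thesis
    using A.bar_square[OF assms(4)] assms
    by (simp add: bl_hom_bar[OF A.bl_chain_axioms, symmetric] bl_hom_mult[symmetric])
qed

lemma bl_hom_neg_neg:
  assumes "bl_chain A" "bl_hom A B h" "x \<in> carrier A"
    and "(x \<triangleright>\<^bsub>A\<^esub> \<zero>\<^bsub>A\<^esub>) \<triangleright>\<^bsub>A\<^esub> \<zero>\<^bsub>A\<^esub> = x"
  shows "(h x \<triangleright>\<^bsub>B\<^esub> \<zero>\<^bsub>B\<^esub>) \<triangleright>\<^bsub>B\<^esub> \<zero>\<^bsub>B\<^esub> = h x"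
proof -
  interpret A: bl_chain A by fact
  have "h ((x \<triangleright>\<^bsub>A\<^esub> \<zero>\<^bsub>A\<^esub>) \<triangleright>\<^bsub>A\<^esub> \<zero>\<^bsub>A\<^esub>) = (h x \<triangleright>\<^bsub>B\<^esub> \<zero>\<^bsub>B\<^esub>) \<triangleright>\<^bsub>B\<^esub> \<zero>\<^bsub>B\<^esub>"
    using assms(2,3) by (simp add: bl_hom_imp bl_hom_bot)
  then show ?thesis
    by (simp add: assms(4))
qed

section \<open>Joint embedding of Chang chains\<close>

text \<open>
  Choosing representatives keeps the quotient inside the type it is formed from, so that its size
  stays under control.
\<close>

lemma (in preBL_chain) preBL_quotient_some:
  "preBL_quotient S (\<lesssim>) (\<odot>) (\<leadsto>) e z (\<lambda>x. SOME y. y \<in> S \<and> x \<lesssim> y \<and> y \<lesssim> x)"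
proof unfold_locales
  fix x y
  assume S: "x \<in> S" "y \<in> S"
  have some: "(SOME y. y \<in> S \<and> x \<lesssim> y \<and> y \<lesssim> x) \<in> S \<and>
      x \<lesssim> (SOME y. y \<in> S \<and> x \<lesssim> y \<and> y \<lesssim> x) \<and> (SOME y. y \<in> S \<and> x \<lesssim> y \<and> y \<lesssim> x) \<lesssim> x"
    if "x \<in> S" for x
    using that someI[of "\<lambda>y. y \<in> S \<and> x \<lesssim> y \<and> y \<lesssim> x" x] by simp
  show "(SOME y. y \<in> S \<and> x \<lesssim> y \<and> y \<lesssim> x) = (SOME x. x \<in> S \<and> y \<lesssim> x \<and> x \<lesssim> y) \<longleftrightarrow>
      x \<lesssim> y \<and> y \<lesssim> x"
  proof
    assume "(SOME y. y \<in> S \<and> x \<lesssim> y \<and> y \<lesssim> x) = (SOME x. x \<in> S \<and> y \<lesssim> x \<and> x \<lesssim> y)"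
    then obtain w where "w \<in> S" "x \<lesssim> w" "w \<lesssim> x" "y \<lesssim> w" "w \<lesssim> y"
      using some[OF S(1)] some[OF S(2)] by metis
    then show "x \<lesssim> y \<and> y \<lesssim> x"
      using S trans[of x w y] trans[of y w x] by simp
  next
    assume xy: "x \<lesssim> y \<and> y \<lesssim> x"
    have "w \<in> S \<and> x \<lesssim> w \<and> w \<lesssim> x \<longleftrightarrow> w \<in> S \<and> y \<lesssim> w \<and> w \<lesssim> y" for w
      using S xy trans[of x y w] trans[of y x w] trans[of w x y] trans[of w y x] by blast
    then show "(SOME y. y \<in> S \<and> x \<lesssim> y \<and> y \<lesssim> x) = (SOME x. x \<in> S \<and> y \<lesssim> x \<and> x \<lesssim> y)"
      by presburger
  qed
qed

context chang_chain
begin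

definition coradical_monoid :: "'a monoid"
  where "coradical_monoid = \<lparr>carrier = coradical, monoid.mult = (\<otimes>), one = \<one>\<rparr>"

lemma ordered_cancel_monoid_coradical: "ordered_cancel_monoid coradical_monoid (bl_le A)"
proof (intro ordered_cancel_monoid.intro ordered_cancel_monoid_axioms.intro comm_monoidI)
  note c = coradical_monoid_def coradical_closed
  show "x \<otimes>\<^bsub>coradical_monoid\<^esub> z \<preceq> y \<otimes>\<^bsub>coradical_monoid\<^esub> z \<longleftrightarrow> x \<preceq> y"
    if "x \<in> carrier coradical_monoid" "y \<in> carrier coradical_monoid"
      "z \<in> carrier coradical_monoid" for x y z
    using that coradical_cancel[of x y z]
    by (auto simp: c mul_mono_left m_comm[of z])
  show "x \<preceq> z" if "x \<preceq> y" "y \<preceq> z" "x \<in> carrier coradical_monoid"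
    "y \<in> carrier coradical_monoid" "z \<in> carrier coradical_monoid" for x y z
    using that le_trans[of x y z] by (simp add: c)
  show "x \<otimes>\<^bsub>coradical_monoid\<^esub> y = y \<otimes>\<^bsub>coradical_monoid\<^esub> x"
    if "x \<in> carrier coradical_monoid" "y \<in> carrier coradical_monoid" for x y
    using that by (simp add: c m_comm)
qed (auto simp: coradical_monoid_def coradical_closed coradical_mult one_coradical chain m_assoc)

end

text \<open>
  The relation \<open>r\<close>, a strict well-order of the index set, serves twice: it orders the lexicographic
  product of the coradicals and it stacks the dense parts.
\<close>

locale chang_family =
  fixes J :: "'i set" and r :: "('i \<times> 'i) set" and C :: "'i \<Rightarrow> 'c bl_structure"
  assumes wf: "wf r"
    and r_trans: "trans r"
    and r_total: "\<lbrakk>i \<in> J; j \<in> J; i \<noteq> j\<rbrakk> \<Longrightarrow> (i, j) \<in> r \<or> (j, i) \<in> r"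
    and member: "i \<in> J \<Longrightarrow> chang_chain (C i)"
begin

lemma member_chain: "i \<in> J \<Longrightarrow> bl_chain (C i)"
  using member by (simp add: chang_chain_def)

sublocale lex: lex_product J r "\<lambda>i. chang_chain.coradical_monoid (C i)" "\<lambda>i. bl_le (C i)"
proof (rule lex_product.intro)
  show "ordered_cancel_monoid (chang_chain.coradical_monoid (C i)) (bl_le (C i))" if "i \<in> J" for i
    using chang_chain.ordered_cancel_monoid_coradical member[OF that] .
  show "x = y" if "i \<in> J" "x \<preceq>\<^bsub>C i\<^esub> y" "y \<preceq>\<^bsub>C i\<^esub> x"
    "x \<in> carrier (chang_chain.coradical_monoid (C i))"
    "y \<in> carrier (chang_chain.coradical_monoid (C i))" for i x y
  proof -
    interpret chang_chain "C i"
      using \<open>i \<in> J\<close> by (rule member)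
    show ?thesis
      using that le_antisym[of x y] by (simp add: coradical_monoid_def coradical_closed)
  qed
qed (fact wf r_trans r_total)+

sublocale frac: ordered_cancel_monoid lex.lex_monoid lex.lex_le
  by (rule lex.ordered_cancel_monoid_lex)

sublocale cone: cancel_prehoop_chain frac.fractions frac.frac_le frac.frac_mult frac.frac_imp
  "(\<one>\<^bsub>lex.lex_monoid\<^esub>, \<one>\<^bsub>lex.lex_monoid\<^esub>)"
  using frac.prehoop_fractions frac.frac_cancel
  by (simp add: cancel_prehoop_chain_def cancel_prehoop_chain_axioms_def)

abbreviation unit_frac :: "('i \<Rightarrow> 'c) \<times> ('i \<Rightarrow> 'c)"
  where "unit_frac \<equiv> (\<one>\<^bsub>lex.lex_monoid\<^esub>, \<one>\<^bsub>lex.lex_monoid\<^esub>)"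

sublocale rot: preBL_chain "UNIV \<times> frac.fractions" cone.rot_le cone.rot_mult cone.rot_imp
  "(True, unit_frac)" "(False, unit_frac)"
  by (rule cone.preBL_rotation)

definition canon :: "bool \<times> ('i \<Rightarrow> 'c) \<times> ('i \<Rightarrow> 'c) \<Rightarrow> bool \<times> ('i \<Rightarrow> 'c) \<times> ('i \<Rightarrow> 'c)"
  where "canon x = (SOME y. y \<in> UNIV \<times> frac.fractions \<and> cone.rot_le x y \<and> cone.rot_le y x)"

sublocale MV: preBL_quotient "UNIV \<times> frac.fractions" cone.rot_le cone.rot_mult cone.rot_imp
  "(True, unit_frac)" "(False, unit_frac)" canon
  using rot.preBL_quotient_some by (simp flip: canon_def)

text \<open>
  With the next lemma, the table of operations from which Chang's identity is read off.
\<close>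

lemma neg_MV:
  assumes "u \<in> frac.fractions"
  shows "canon (True, u) \<triangleright>\<^bsub>MV.Q\<^esub> \<zero>\<^bsub>MV.Q\<^esub> = canon (False, u)"
    and "canon (False, u) \<triangleright>\<^bsub>MV.Q\<^esub> \<zero>\<^bsub>MV.Q\<^esub> = canon (True, u)"
  using assms
  by (simp_all add: MV.bot_Q MV.residuum_Q MV.q_eq_iff cone.unit cone.unit' cone.le_imp cone.e_imp_le
      del: frac.frac_mult.simps frac.frac_imp.simps frac.frac_le.simps)

lemma mult_MV:
  assumes "u \<in> frac.fractions" "v \<in> frac.fractions"
  shows "canon (True, u) \<otimes>\<^bsub>MV.Q\<^esub> canon (True, v) = canon (True, frac.frac_mult u v)"
    and "canon (False, u) \<otimes>\<^bsub>MV.Q\<^esub> canon (False, v) = \<zero>\<^bsub>MV.Q\<^esub>"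
  using assms by (simp_all add: MV.mult_Q MV.bot_Q del: frac.frac_mult.simps)

lemma MV_cases:
  assumes "x \<in> carrier MV.Q"
  obtains b u where "x = canon (b, u)" "u \<in> frac.fractions"
  using assms by (auto simp: MV.carrier_Q)

sublocale MV_chain: bl_chain MV.Q
  by (rule MV.bl_chain_Q)

lemma MV_nontrivial: "\<zero>\<^bsub>MV.Q\<^esub> \<noteq> \<one>\<^bsub>MV.Q\<^esub>"
  by (simp add: MV.bot_Q MV.one_Q MV.q_eq_iff)

lemma MV_neg_neg: "x \<in> carrier MV.Q \<Longrightarrow> MV_chain.neg (MV_chain.neg x) = x"
proof (elim MV_cases)
  fix b u
  assume "x = canon (b, u)" "u \<in> frac.fractions"
  then show "MV_chain.neg (MV_chain.neg x) = x"
    by (cases b) (simp_all add: neg_MV)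
qed

lemma MV_regular: "x \<in> carrier MV.Q \<Longrightarrow> x \<in> insert \<one>\<^bsub>MV.Q\<^esub> MV_chain.regular"
  using MV_neg_neg[of x] by (auto simp: MV_chain.regular_def)

text \<open>
  On \<open>(True, u)\<close> both sides of the identity are \<open>1\<close>, and on \<open>(False, u)\<close> both are \<open>0\<close>.
\<close>

lemma MV_chang: "chang_chain MV.Q"
proof (intro chang_chain.intro chang_chain_axioms.intro MV.bl_chain_Q MV_nontrivial)
  fix x
  assume x: "x \<in> carrier MV.Q"
  then obtain b u where u: "x = canon (b, u)" "u \<in> frac.fractions"
    by (rule MV_cases)
  have bar: "MV_chain.bar y = MV_chain.neg (MV_chain.neg y \<otimes>\<^bsub>MV.Q\<^esub> MV_chain.neg y)"
    if "y \<in> carrier MV.Q" for y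
    using MV_regular[OF that] by (simp add: MV_chain.bar_regular MV_chain.neg_mult_neg_neg)
  have bar_q: "MV_chain.bar (canon (True, v)) = \<one>\<^bsub>MV.Q\<^esub>"
    "MV_chain.bar (canon (False, v)) = canon (False, frac.frac_mult v v)"
    if "v \<in> frac.fractions" for v
  proof -
    have vv: "frac.frac_mult v v \<in> frac.fractions"
      using that by (simp only: cone.mul_closed)
    have "canon (c, v) \<in> carrier MV.Q" for c
      using that by (simp add: MV.carrier_Q)
    then show "MV_chain.bar (canon (True, v)) = \<one>\<^bsub>MV.Q\<^esub>"
      "MV_chain.bar (canon (False, v)) = canon (False, frac.frac_mult v v)"
      using that vv by (simp_all add: bar neg_MV mult_MV)
  qed
  have uu: "frac.frac_mult u u \<in> frac.fractions"
    using u(2) by (simp only: cone.mul_closed)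
  have "MV_chain.bar \<zero>\<^bsub>MV.Q\<^esub> = \<zero>\<^bsub>MV.Q\<^esub>"
    by (simp add: bar)
  then show "MV_chain.bar x \<otimes>\<^bsub>MV.Q\<^esub> MV_chain.bar x = MV_chain.bar (x \<otimes>\<^bsub>MV.Q\<^esub> x)"
    using u uu by (cases b) (simp_all add: bar_q mult_MV)
qed

definition frac_of :: "'i \<Rightarrow> 'c \<Rightarrow> ('i \<Rightarrow> 'c) \<times> ('i \<Rightarrow> 'c)"
  where "frac_of i x = (lex.coord i x, \<one>\<^bsub>lex.lex_monoid\<^esub>)"

lemma coradical_monoid_simps:
  assumes "i \<in> J"
  shows "carrier (chang_chain.coradical_monoid (C i)) = chang_chain.coradical (C i)"
    and "x \<otimes>\<^bsub>chang_chain.coradical_monoid (C i)\<^esub> y = x \<otimes>\<^bsub>C i\<^esub> y"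
    and "\<one>\<^bsub>chang_chain.coradical_monoid (C i)\<^esub> = \<one>\<^bsub>C i\<^esub>"
  using chang_chain.coradical_monoid_def[OF member[OF assms]] by simp_all

lemma coord_facts:
  assumes "i \<in> J" "x \<in> chang_chain.coradical (C i)"
  shows "lex.coord i x \<in> carrier lex.lex_monoid"
    and "lex.lex_le (lex.coord i x) (lex.coord i y) \<longleftrightarrow> x \<preceq>\<^bsub>C i\<^esub> y"
    and "lex.coord i \<one>\<^bsub>C i\<^esub> = \<one>\<^bsub>lex.lex_monoid\<^esub>"
    and "lex.coord i (x \<otimes>\<^bsub>C i\<^esub> y) = lex.coord i x \<otimes>\<^bsub>lex.lex_monoid\<^esub> lex.coord i y"
  using lex.coord_closed[of i x] lex.coord_le_iff[of i x y] lex.coord_one[of i]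
    lex.coord_mult[of i x y] assms by (simp_all add: coradical_monoid_simps)

lemma frac_of_closed:
  assumes "i \<in> J" "x \<in> chang_chain.coradical (C i)"
  shows "frac_of i x \<in> frac.fractions"
proof -
  interpret chang_chain "C i"
    using assms(1) by (rule member)
  have "lex.lex_le (lex.coord i x) (lex.coord i \<one>\<^bsub>C i\<^esub>)"
    using assms by (simp add: coord_facts(2) coradical_closed)
  then show ?thesis
    using assms by (simp add: frac_of_def frac.fractions_def coord_facts(1) coord_facts(3)[OF assms])
qed

lemma frac_le_frac_of:
  assumes "i \<in> J" "x \<in> chang_chain.coradical (C i)" "y \<in> chang_chain.coradical (C i)"
  shows "frac.frac_le (frac_of i x) (frac_of i y) \<longleftrightarrow> x \<preceq>\<^bsub>C i\<^esub> y"
  using assms by (simp add: frac_of_def coord_facts(1,2))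

lemma frac_of_one: "i \<in> J \<Longrightarrow> frac_of i \<one>\<^bsub>C i\<^esub> = unit_frac"
  using coord_facts(3)[OF _ chang_chain.one_coradical[OF member]] by (simp add: frac_of_def)

lemma frac_of_mult:
  assumes "i \<in> J" "x \<in> chang_chain.coradical (C i)" "y \<in> chang_chain.coradical (C i)"
  shows "frac.frac_mult (frac_of i x) (frac_of i y) = frac_of i (x \<otimes>\<^bsub>C i\<^esub> y)"
  using assms by (simp add: frac_of_def coord_facts(4))

text \<open>
  The residuum of fractions is computed in the group of quotients of the whole product, that of
  the coradical by divisibility. They agree because \<open>x * (x \<rightarrow> y) = y\<close> for \<open>y \<le> x\<close>, and \<open>x\<close> can be cancelled.
\<close>

lemma frac_of_imp:
  assumes "i \<in> J" "x \<in> chang_chain.coradical (C i)" "y \<in> chang_chain.coradical (C i)"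
  shows "frac.frac_le (frac.frac_imp (frac_of i x) (frac_of i y)) (frac_of i (x \<triangleright>\<^bsub>C i\<^esub> y))"
    and "frac.frac_le (frac_of i (x \<triangleright>\<^bsub>C i\<^esub> y)) (frac.frac_imp (frac_of i x) (frac_of i y))"
proof -
  interpret chang_chain "C i"
    using assms(1) by (rule member)
  have A: "x \<in> carrier (C i)" "y \<in> carrier (C i)"
    using assms by (simp_all add: coradical_closed)
  have xy: "x \<triangleright>\<^bsub>C i\<^esub> y \<in> coradical"
    using assms by (simp add: coradical_imp)
  note cl = frac_of_closed[OF assms(1,2)] frac_of_closed[OF assms(1,3)] frac_of_closed[OF assms(1) xy]
  have eval: "frac.frac_le (frac.frac_mult (frac_of i (x \<triangleright>\<^bsub>C i\<^esub> y)) (frac_of i x)) (frac_of i y)"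
    using assms A xy imp_eval[of x y]
    by (simp add: frac_of_mult frac_le_frac_of coradical_mult m_comm[of _ x])
  then show "frac.frac_le (frac_of i (x \<triangleright>\<^bsub>C i\<^esub> y)) (frac.frac_imp (frac_of i x) (frac_of i y))"
    using cl cone.residuated by blast
  show "frac.frac_le (frac.frac_imp (frac_of i x) (frac_of i y)) (frac_of i (x \<triangleright>\<^bsub>C i\<^esub> y))"
  proof (cases "x \<preceq>\<^bsub>C i\<^esub> y")
    case True
    then have "frac_of i (x \<triangleright>\<^bsub>C i\<^esub> y) = unit_frac"
      using A assms by (simp add: imp_eq_one_iff[THEN iffD2] frac_of_one)
    then show ?thesis
      using cl by (simp only: cone.le_e cone.imp_closed)
  next
    case False
    then have "y \<preceq>\<^bsub>C i\<^esub> x"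
      using A by (simp add: not_le)
    then have "frac.frac_mult (frac_of i x) (frac_of i (x \<triangleright>\<^bsub>C i\<^esub> y)) = frac_of i y"
      using assms A xy by (simp add: frac_of_mult mul_imp_eq)
    moreover have "frac.frac_le (frac.frac_mult (frac_of i x) (frac.frac_imp (frac_of i x) (frac_of i y)))
        (frac_of i y)"
      using cl by (simp only: cone.imp_eval)
    ultimately show ?thesis
      using cl cone.cancel cone.imp_closed by metis
  qed
qed

text \<open>
  The embedding of the MV-part of a member into the rotation: on the coradical it is the embedding
  into fractions, and elsewhere it is determined by commuting with negation.
\<close>

definition lower :: "'i \<Rightarrow> 'c \<Rightarrow> bool \<times> ('i \<Rightarrow> 'c) \<times> ('i \<Rightarrow> 'c)"
  where "lower i x = (if x \<in> chang_chain.coradical (C i) then canon (True, frac_of i x)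
    else canon (False, frac_of i (x \<triangleright>\<^bsub>C i\<^esub> \<zero>\<^bsub>C i\<^esub>)))"

lemma lower_coradical: "x \<in> chang_chain.coradical (C i) \<Longrightarrow> lower i x = canon (True, frac_of i x)"
  by (simp add: lower_def)

lemma lower_neg:
  assumes "i \<in> J" "x \<in> chang_chain.coradical (C i)"
  shows "lower i (x \<triangleright>\<^bsub>C i\<^esub> \<zero>\<^bsub>C i\<^esub>) = canon (False, frac_of i x)"
proof -
  interpret chang_chain "C i"
    using assms(1) by (rule member)
  show ?thesis
    using assms by (simp add: lower_def neg_not_coradical coradical_neg_neg)
qed

lemma lower_mult_imp:
  assumes "i \<in> J" "x \<in> insert \<one>\<^bsub>C i\<^esub> (bl_chain.regular (C i))"
    "y \<in> insert \<one>\<^bsub>C i\<^esub> (bl_chain.regular (C i))"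
  shows "lower i (x \<otimes>\<^bsub>C i\<^esub> y) = lower i x \<otimes>\<^bsub>MV.Q\<^esub> lower i y"
    and "lower i (x \<triangleright>\<^bsub>C i\<^esub> y) = lower i x \<triangleright>\<^bsub>MV.Q\<^esub> lower i y"
proof -
  interpret chang_chain "C i"
    using assms(1) by (rule member)
  note i = assms(1)
  have cases: "(x' \<in> coradical) \<or> (\<exists>p\<in>coradical. x' = neg p)"
    if "x' \<in> insert \<one>\<^bsub>C i\<^esub> regular" for x'
    using neg_coradical[OF that] regular_or_one_neg_neg[OF that] by metis
  have pos_pos: "lower i (a \<otimes>\<^bsub>C i\<^esub> b) = lower i a \<otimes>\<^bsub>MV.Q\<^esub> lower i b"
      "lower i (a \<triangleright>\<^bsub>C i\<^esub> b) = lower i a \<triangleright>\<^bsub>MV.Q\<^esub> lower i b"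
    and pos_neg: "lower i (a \<otimes>\<^bsub>C i\<^esub> neg b) = lower i a \<otimes>\<^bsub>MV.Q\<^esub> lower i (neg b)"
      "lower i (neg b \<otimes>\<^bsub>C i\<^esub> a) = lower i (neg b) \<otimes>\<^bsub>MV.Q\<^esub> lower i a"
      "lower i (a \<triangleright>\<^bsub>C i\<^esub> neg b) = lower i a \<triangleright>\<^bsub>MV.Q\<^esub> lower i (neg b)"
      "lower i (neg b \<triangleright>\<^bsub>C i\<^esub> a) = lower i (neg b) \<triangleright>\<^bsub>MV.Q\<^esub> lower i a"
    and neg_neg: "lower i (neg a \<otimes>\<^bsub>C i\<^esub> neg b) = lower i (neg a) \<otimes>\<^bsub>MV.Q\<^esub> lower i (neg b)"
      "lower i (neg a \<triangleright>\<^bsub>C i\<^esub> neg b) = lower i (neg a) \<triangleright>\<^bsub>MV.Q\<^esub> lower i (neg b)"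
    if ab: "a \<in> coradical" "b \<in> coradical" for a b
  proof -
    have A: "a \<in> carrier (C i)" "b \<in> carrier (C i)"
      using ab by (simp_all add: coradical_closed)
    note c = coradical_mult coradical_imp one_coradical
    note f = frac_of_closed[OF i] frac_of_mult[OF i] frac_of_imp[OF i] frac_of_one[OF i]
    note qs = MV.mult_Q MV.residuum_Q MV.q_eq_iff MV.one_Q MV.bot_Q
    note fi = cone.imp_closed[OF frac_of_closed[OF i] frac_of_closed[OF i]]
    have zero: "\<zero>\<^bsub>C i\<^esub> = neg \<one>\<^bsub>C i\<^esub>"
      by simp
    note dels = frac.frac_mult.simps frac.frac_imp.simps frac.frac_le.simps
    show "lower i (a \<otimes>\<^bsub>C i\<^esub> b) = lower i a \<otimes>\<^bsub>MV.Q\<^esub> lower i b"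
      using ab by (simp add: lower_coradical c f qs del: dels)
    show "lower i (a \<triangleright>\<^bsub>C i\<^esub> b) = lower i a \<triangleright>\<^bsub>MV.Q\<^esub> lower i b"
      using ab by (simp add: lower_coradical c f qs fi del: dels)
    show *: "lower i (a \<otimes>\<^bsub>C i\<^esub> neg b) = lower i a \<otimes>\<^bsub>MV.Q\<^esub> lower i (neg b)"
      using ab by (simp add: lower_coradical lower_neg[OF i] coradical_mult_neg c f qs fi del: dels)
    show "lower i (neg b \<otimes>\<^bsub>C i\<^esub> a) = lower i (neg b) \<otimes>\<^bsub>MV.Q\<^esub> lower i a"
      using ab A by (simp add: m_comm[of _ a] lower_coradical lower_neg[OF i] coradical_mult_neg c f qs fi del: dels)
    show "lower i (a \<triangleright>\<^bsub>C i\<^esub> neg b) = lower i a \<triangleright>\<^bsub>MV.Q\<^esub> lower i (neg b)"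
      using ab A by (simp add: neg_mult[symmetric] lower_coradical lower_neg[OF i] c f qs fi del: dels)
    show "lower i (neg b \<triangleright>\<^bsub>C i\<^esub> a) = lower i (neg b) \<triangleright>\<^bsub>MV.Q\<^esub> lower i a"
      using ab by (simp add: neg_imp_coradical lower_coradical lower_neg[OF i] c f qs fi del: dels)
    show "lower i (neg a \<otimes>\<^bsub>C i\<^esub> neg b) = lower i (neg a) \<otimes>\<^bsub>MV.Q\<^esub> lower i (neg b)"
      using ab lower_neg[OF i one_coradical]
      by (simp add: neg_mult_neg_coradical lower_neg[OF i] c f qs fi del: dels)
    show "lower i (neg a \<triangleright>\<^bsub>C i\<^esub> neg b) = lower i (neg a) \<triangleright>\<^bsub>MV.Q\<^esub> lower i (neg b)"
      using ab by (simp add: neg_imp_neg_coradical lower_coradical lower_neg[OF i] c f qs fi del: dels)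
  qed
  show "lower i (x \<otimes>\<^bsub>C i\<^esub> y) = lower i x \<otimes>\<^bsub>MV.Q\<^esub> lower i y"
    and "lower i (x \<triangleright>\<^bsub>C i\<^esub> y) = lower i x \<triangleright>\<^bsub>MV.Q\<^esub> lower i y"
    using cases[OF assms(2)] cases[OF assms(3)] pos_pos pos_neg neg_neg by auto
qed

lemma lower_closed:
  assumes "i \<in> J" "x \<in> insert \<one>\<^bsub>C i\<^esub> (bl_chain.regular (C i))"
  shows "lower i x \<in> carrier MV.Q"
  using frac_of_closed[OF assms(1)] chang_chain.neg_coradical[OF member[OF assms(1)] assms(2)]
  by (auto simp: lower_def MV.carrier_Q)

lemma lower_one: "i \<in> J \<Longrightarrow> lower i \<one>\<^bsub>C i\<^esub> = \<one>\<^bsub>MV.Q\<^esub>"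
  using chang_chain.one_coradical[OF member] by (simp add: lower_coradical frac_of_one MV.one_Q)

lemma lower_bot:
  assumes "i \<in> J"
  shows "lower i \<zero>\<^bsub>C i\<^esub> = \<zero>\<^bsub>MV.Q\<^esub>"
proof -
  interpret chang_chain "C i"
    using assms by (rule member)
  show ?thesis
    using lower_neg[OF assms one_coradical] assms by (simp add: frac_of_one MV.bot_Q)
qed

lemma lower_eq_one_iff:
  assumes "i \<in> J" "x \<in> insert \<one>\<^bsub>C i\<^esub> (bl_chain.regular (C i))"
  shows "lower i x = \<one>\<^bsub>MV.Q\<^esub> \<longleftrightarrow> x = \<one>\<^bsub>C i\<^esub>"
proof
  interpret chang_chain "C i"
    using assms(1) by (rule member)
  assume *: "lower i x = \<one>\<^bsub>MV.Q\<^esub>"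
  show "x = \<one>\<^bsub>C i\<^esub>"
  proof (cases "x \<in> coradical")
    case True
    then have "frac.frac_le (frac_of i \<one>\<^bsub>C i\<^esub>) (frac_of i x)"
      using * frac_of_closed[OF assms(1) True] assms(1)
      by (simp add: lower_coradical MV.one_Q MV.q_eq_iff frac_of_one)
    then show ?thesis
      using frac_le_frac_of[OF assms(1) one_coradical True] True by (simp add: coradical_closed)
  next
    case False
    then show ?thesis
      using * frac_of_closed[OF assms(1) neg_coradical[OF assms(2) False]]
      by (simp add: lower_def MV.one_Q MV.q_eq_iff)
  qed
qed (simp add: lower_one assms)

sublocale osum: ordinal_sum MV.Q J r C
  by (intro ordinal_sum.intro ordinal_sum_axioms.intro MV.bl_chain_Q)
    (fact MV_nontrivial wf r_trans r_total member_chain)+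

definition embed :: "'i \<Rightarrow> 'c \<Rightarrow> (bool \<times> ('i \<Rightarrow> 'c) \<times> ('i \<Rightarrow> 'c)) + 'i \<times> 'c"
  where "embed i x = (if x \<in> osum.upper i then Inr (i, x) else Inl (lower i x))"

lemma embed_lower: "x \<in> insert \<one>\<^bsub>C i\<^esub> (bl_chain.regular (C i)) \<Longrightarrow> i \<in> J \<Longrightarrow> embed i x = Inl (lower i x)"
  using bl_chain.regular_iff_not_dense[OF member_chain] bl_chain.regular_closed[OF member_chain]
  by (auto simp: embed_def osum.upper_def)

lemma embed_upper: "x \<in> osum.upper i \<Longrightarrow> embed i x = Inr (i, x)"
  by (simp add: embed_def)

lemma upper_or_lower:
  assumes "i \<in> J" "x \<in> carrier (C i)"
  obtains (upper) "x \<in> osum.upper i" | (one) "x = \<one>\<^bsub>C i\<^esub>" | (regular) "x \<in> bl_chain.regular (C i)"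
  using bl_chain.regular_iff_not_dense[OF member_chain[OF assms(1)] assms(2)]
  by (auto simp: osum.upper_def)

lemma embed_closed:
  assumes "i \<in> J" "x \<in> carrier (C i)"
  shows "embed i x \<in> osum.sum_carrier"
  using assms
  by (cases rule: upper_or_lower[OF assms]) (simp_all add: embed_upper embed_lower lower_closed)

lemma embed_one: "i \<in> J \<Longrightarrow> embed i \<one>\<^bsub>C i\<^esub> = Inl \<one>\<^bsub>MV.Q\<^esub>"
  by (simp add: embed_lower lower_one)

lemma embed_bot:
  assumes "i \<in> J"
  shows "embed i \<zero>\<^bsub>C i\<^esub> = Inl \<zero>\<^bsub>MV.Q\<^esub>"
proof -
  interpret chang_chain "C i"
    using assms by (rule member)
  have "\<zero>\<^bsub>C i\<^esub> \<in> regular"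
    using nontrivial by (simp add: regular_def)
  then show ?thesis
    using assms by (simp add: embed_lower lower_bot)
qed

lemma embed_eq_one_iff:
  assumes "i \<in> J" "x \<in> carrier (C i)"
  shows "embed i x = Inl \<one>\<^bsub>MV.Q\<^esub> \<longleftrightarrow> x = \<one>\<^bsub>C i\<^esub>"
  using assms
  by (cases rule: upper_or_lower[OF assms])
    (auto simp: embed_upper embed_lower lower_eq_one_iff lower_one osum.upper_def)

text \<open>
  Mixed cases hold because a dense element \<open>d\<close> and a regular element \<open>x\<close> satisfy \<open>d * x = x\<close>, \<open>d \<rightarrow> x = x\<close>
  and \<open>x \<rightarrow> d = 1\<close>, exactly as in the ordinal sum.
\<close>

lemma embed_mult_imp:
  assumes "i \<in> J" "x \<in> carrier (C i)" "y \<in> carrier (C i)"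
  shows "embed i (x \<otimes>\<^bsub>C i\<^esub> y) = osum.sum_mult (embed i x) (embed i y)"
    and "embed i (x \<triangleright>\<^bsub>C i\<^esub> y) = osum.sum_imp (embed i x) (embed i y)"
proof -
  interpret chang_chain "C i"
    using assms(1) by (rule member)
  note i = assms(1)
  note e = embed_upper embed_lower[OF _ i] embed_one[OF i] lower_one[OF i] lower_eq_one_iff[OF i]
  have up: "a \<in> carrier (C i) \<and> a \<in> dense \<and> a \<noteq> \<one>\<^bsub>C i\<^esub>" if "a \<in> osum.upper i" for a
    using that osum.upper_closed[OF i that] by (simp add: osum.upper_def)
  have reg: "a \<in> carrier (C i) \<and> a \<noteq> \<one>\<^bsub>C i\<^esub>" if "a \<in> regular" for a
    using that by (auto simp: regular_def)
  show "embed i (x \<otimes>\<^bsub>C i\<^esub> y) = osum.sum_mult (embed i x) (embed i y)"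
  proof (cases rule: upper_or_lower[OF assms(1,2)]; cases rule: upper_or_lower[OF assms(1,3)])
    assume "x \<in> osum.upper i" "y \<in> osum.upper i"
    then show ?thesis
      using osum.upper_mult[OF i] by (simp add: e)
  next
    assume "x \<in> osum.upper i" "y \<in> regular"
    then show ?thesis
      using up[of x] reg[of y] by (simp add: e dense_mult_regular)
  next
    assume "x \<in> regular" "y \<in> osum.upper i"
    then show ?thesis
      using up[of y] reg[of x] by (simp add: e dense_mult_regular m_comm[of x])
  next
    assume "x \<in> regular" "y \<in> regular"
    then show ?thesis
      using reg[of y] by (simp add: e regular_mult lower_mult_imp(1)[OF i])
  qed (use assms lower_closed[OF i] in \<open>simp_all add: e\<close>)
  show "embed i (x \<triangleright>\<^bsub>C i\<^esub> y) = osum.sum_imp (embed i x) (embed i y)"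
  proof (cases rule: upper_or_lower[OF assms(1,2)]; cases rule: upper_or_lower[OF assms(1,3)])
    assume xy: "x \<in> osum.upper i" "y \<in> osum.upper i"
    then show ?thesis
      using osum.upper_imp[OF i xy] assms imp_eq_one_iff[of x y] by (auto simp: e)
  next
    assume "x \<in> osum.upper i" "y \<in> regular"
    then show ?thesis
      using up[of x] by (simp add: e dense_imp_regular)
  next
    assume "x \<in> regular" "y \<in> osum.upper i"
    then show ?thesis
      using up[of y] reg[of x] imp_eq_one_iff[of x y] by (simp add: e regular_le_dense)
  next
    assume xy: "x \<in> regular" "y \<in> regular"
    then show ?thesis
      using regular_or_one_imp[of x y] by (simp add: e(1,2) lower_mult_imp(2)[OF i])
  qed (use assms lower_closed[OF i] in \<open>simp_all add: e one_imp MV_chain.one_imp\<close>)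
qed

end

text \<open>
  The encoding transports the ordinal sum to a prescribed type.
\<close>

locale chang_amalgam = chang_family +
  fixes enc :: "(bool \<times> ('a \<Rightarrow> 'b) \<times> ('a \<Rightarrow> 'b)) + 'a \<times> 'b \<Rightarrow> 'd"
  assumes inj_enc: "inj enc"
begin

sublocale B: preBL_quotient osum.sum_carrier osum.sum_le osum.sum_mult osum.sum_imp
  "Inl \<one>\<^bsub>MV.Q\<^esub>" "Inl \<zero>\<^bsub>MV.Q\<^esub>" enc
proof (intro preBL_quotient.intro preBL_quotient_axioms.intro osum.preBL_sum)
  fix x y
  assume *: "x \<in> osum.sum_carrier" "y \<in> osum.sum_carrier"
  have "p = p'" if "i \<in> J" "p \<preceq>\<^bsub>C i\<^esub> p'" "p' \<preceq>\<^bsub>C i\<^esub> p" "p \<in> osum.upper i" "p' \<in> osum.upper i"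
    for i p p'
  proof -
    interpret chang_chain "C i"
      using \<open>i \<in> J\<close> by (rule member)
    show ?thesis
      using that le_antisym[of p p'] osum.upper_closed[of i] by simp
  qed
  note up_antisym = this
  have "x = y" if "osum.sum_le x y" "osum.sum_le y x"
  proof (cases rule: osum.sum_cases[OF *(1)]; cases rule: osum.sum_cases[OF *(2)])
    fix a b
    assume "x = Inl a" "a \<in> carrier MV.Q" "y = Inl b" "b \<in> carrier MV.Q"
    then show ?thesis
      using that MV_chain.le_antisym[of a b] by simp
  next
    fix i p j p'
    assume "x = Inr (i, p)" "i \<in> J" "p \<in> osum.upper i" "y = Inr (j, p')" "j \<in> J" "p' \<in> osum.upper j"
    then show ?thesis
      using that up_antisym[of i p p'] osum.r_asym[of i j] by auto
  qed (use that in simp_all)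
  then have "osum.sum_le x y \<and> osum.sum_le y x \<longleftrightarrow> x = y"
    using osum.sum_refl[OF *(1)] by blast
  then show "enc x = enc y \<longleftrightarrow> osum.sum_le x y \<and> osum.sum_le y x"
    using inj_enc by (simp add: inj_eq)
qed

lemma bl_hom_embed: "i \<in> J \<Longrightarrow> bl_hom (C i) B.Q (enc \<circ> embed i)"
  unfolding bl_hom_def
  by (auto simp: B.Q_simps embed_closed embed_one embed_bot embed_mult_imp)

lemma bl_hom_Inl: "bl_hom MV.Q B.Q (enc \<circ> Inl)"
  unfolding bl_hom_def
  by (auto simp: B.Q_simps)

lemma enc_embed_eq_one_iff:
  assumes "i \<in> J" "x \<in> carrier (C i)"
  shows "enc (embed i x) = \<one>\<^bsub>B.Q\<^esub> \<longleftrightarrow> x = \<one>\<^bsub>C i\<^esub>"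
  using embed_eq_one_iff[OF assms] inj_enc by (simp add: B.one_Q inj_eq)

lemma B_cases:
  assumes "x \<in> carrier B.Q"
  obtains (lower) a where "x = enc (Inl a)" "a \<in> carrier MV.Q"
  | (upper) i p where "x = enc (embed i p)" "i \<in> J" "p \<in> osum.upper i"
proof -
  obtain s where "x = enc s" "s \<in> osum.sum_carrier"
    using assms by (auto simp only: B.carrier_Q)
  then show thesis
    using that embed_upper by (elim osum.sum_cases) auto
qed

text \<open>
  Each element comes from the rotation or from a member of the family, and Chang's identity has one
  variable.
\<close>

lemma chang_B: "chang_chain B.Q"
proof (intro chang_chain.intro chang_chain_axioms.intro B.bl_chain_Q)
  show "\<zero>\<^bsub>B.Q\<^esub> \<noteq> \<one>\<^bsub>B.Q\<^esub>"
    using inj_enc MV_nontrivial by (simp add: B.Q_simps inj_eq)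
  fix x
  assume "x \<in> carrier B.Q"
  then show "bl_chain.bar B.Q x \<otimes>\<^bsub>B.Q\<^esub> bl_chain.bar B.Q x = bl_chain.bar B.Q (x \<otimes>\<^bsub>B.Q\<^esub> x)"
  proof (cases rule: B_cases)
    case (lower a)
    then show ?thesis
      using bl_hom_bar_square[OF MV_chang B.bl_chain_Q bl_hom_Inl, of a] by simp
  next
    case (upper i p)
    then show ?thesis
      using bl_hom_bar_square[OF member B.bl_chain_Q bl_hom_embed, of i p] osum.upper_closed by simp
  qed
qed

lemma B_involutive:
  assumes "\<And>i x. i \<in> J \<Longrightarrow> x \<in> carrier (C i) \<Longrightarrow> (x \<triangleright>\<^bsub>C i\<^esub> \<zero>\<^bsub>C i\<^esub>) \<triangleright>\<^bsub>C i\<^esub> \<zero>\<^bsub>C i\<^esub> = x"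
    and "x \<in> carrier B.Q"
  shows "(x \<triangleright>\<^bsub>B.Q\<^esub> \<zero>\<^bsub>B.Q\<^esub>) \<triangleright>\<^bsub>B.Q\<^esub> \<zero>\<^bsub>B.Q\<^esub> = x"
  using assms(2)
proof (cases rule: B_cases)
  case (lower a)
  then show ?thesis
    using bl_hom_neg_neg[OF MV.bl_chain_Q bl_hom_Inl lower(2) MV_neg_neg] by simp
next
  case (upper i p)
  then have p: "p \<in> carrier (C i)"
    by (intro osum.upper_closed)
  show ?thesis
    using upper(1) bl_hom_neg_neg[OF member_chain[OF upper(2)] bl_hom_embed[OF upper(2)] p
        assms(1)[OF upper(2) p]] by simp
qed

end

section \<open>Soundness\<close>

context bl_chain
begin

lemma interp_closed: "evaluation A v \<Longrightarrow> interp A v p \<in> carrier A"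
  by (induction p) (auto simp: evaluation_def)

lemma suffixing: "\<lbrakk>x \<in> carrier A; y \<in> carrier A; w \<in> carrier A\<rbrakk>
    \<Longrightarrow> x \<triangleright> y \<preceq> (y \<triangleright> w) \<triangleright> (x \<triangleright> w)"
proof -
  assume A: "x \<in> carrier A" "y \<in> carrier A" "w \<in> carrier A"
  have "(x \<triangleright> y) \<otimes> x \<preceq> y" "(y \<triangleright> w) \<otimes> y \<preceq> w"
    using A imp_eval[of x y] imp_eval[of y w] by (simp_all add: m_comm)
  then have "(y \<triangleright> w) \<otimes> ((x \<triangleright> y) \<otimes> x) \<preceq> w"
    using A mul_mono_right[of "(x \<triangleright> y) \<otimes> x" y "y \<triangleright> w"]
      trans[of "(y \<triangleright> w) \<otimes> ((x \<triangleright> y) \<otimes> x)" "(y \<triangleright> w) \<otimes> y" w] by simp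
  moreover have "(y \<triangleright> w) \<otimes> ((x \<triangleright> y) \<otimes> x) = (x \<triangleright> y) \<otimes> (y \<triangleright> w) \<otimes> x"
    using A by (simp add: m_ac)
  ultimately show ?thesis
    using A by (simp flip: residuated)
qed

lemma BL_sound:
  assumes "p \<in> BL" "evaluation A v"
  shows "interp A v p = \<one>"
proof -
  note c = interp_closed[OF assms(2)]
  show ?thesis
    using assms(1)
  proof induction
    case (A1 p q r)
    then show ?case
      using c by (simp add: imp_eq_one_iff suffixing)
  next
    case (A4 p q)
    have "interp A v p \<otimes> (interp A v p \<triangleright> interp A v q) = interp A v q \<otimes> (interp A v q \<triangleright> interp A v p)"
      using c by (simp add: meet_comm flip: divisibility)
    then show ?case
      using c by (simp add: imp_eq_one_iff)
  next
    case (A6 p q r)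
    have "interp A v p \<preceq> interp A v q \<or> interp A v q \<preceq> interp A v p"
      using c by (simp add: chain)
    then show ?case
    proof
      assume "interp A v p \<preceq> interp A v q"
      then have "interp A v p \<triangleright> interp A v q = \<one>"
        using c by (simp add: imp_eq_one_iff)
      then show ?thesis
        using c by (simp add: one_imp le_imp imp_eq_one_iff[THEN iffD2])
    next
      assume "interp A v q \<preceq> interp A v p"
      then have "interp A v q \<triangleright> interp A v p = \<one>"
        using c by (simp add: imp_eq_one_iff)
      then show ?thesis
        using c by (simp add: one_imp imp_eq_one_iff[THEN iffD2])
    qed
  qed (use c in \<open>simp_all add: imp_eq_one_iff imp_imp mul_le_left m_comm imp_eval le_refl\<close>)
qed

lemma interp_dbl_bar: "evaluation A v \<Longrightarrow> interp A v (dbl_bar p) = bar (interp A v p)"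
  using interp_closed[of v p]
  by (simp add: dbl_bar_def Vee_bar_def Min_conj_def bar_def imp_eq_one_iff[THEN iffD2])

lemma interp_dbl:
  "interp A v (dbl p) = neg (neg (interp A v p) \<otimes> neg (interp A v p))"
  by (simp add: dbl_def Neg_def)

lemma interp_Iff_eq_one:
  assumes "evaluation A v"
  shows "interp A v (p \<^bold>\<leftrightarrow> q) = \<one> \<longleftrightarrow> interp A v p = interp A v q"
proof -
  note c = interp_closed[OF assms]
  have "interp A v (p \<^bold>\<leftrightarrow> q) = \<one> \<longleftrightarrow> interp A v p \<triangleright> interp A v q = \<one> \<and> interp A v q \<triangleright> interp A v p = \<one>"
    using mul_le_left[of "interp A v p \<triangleright> interp A v q" "interp A v q \<triangleright> interp A v p"]
      mul_le_right[of "interp A v p \<triangleright> interp A v q" "interp A v q \<triangleright> interp A v p"] c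
    by (auto simp: Iff_def)
  also have "\<dots> \<longleftrightarrow> interp A v p = interp A v q"
    using c le_antisym[of "interp A v p" "interp A v q"] by (auto simp: imp_eq_one_iff)
  finally show ?thesis .
qed

end

lemma (in chang_chain) L_chain_BL_Chang: "L_chain BL_Chang A"
proof -
  have "interp A v p = \<one>" if "p \<in> BL_Chang" "evaluation A v" for p v
    using that BL_sound bar_square interp_closed
    by (auto simp: BL_Chang_def interp_Iff_eq_one interp_dbl_bar sq_def)
  then show ?thesis
    using bl_algebra_axioms chain by (simp add: L_chain_def L_algebra_def)
qed

lemma (in bl_chain) involutive_regular:
  "\<lbrakk>neg (neg x) = x; x \<in> carrier A\<rbrakk> \<Longrightarrow> x \<in> insert \<one> regular"
  by (auto simp: regular_def)

text \<open>
  When double negation is the identity, all elements other than \<open>1\<close> are regular, and there the two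
  doubling operations of Lukasiewicz logic and of BL agree.
\<close>

lemma (in chang_chain) L_chain_Luk_Chang:
  assumes inv: "\<And>x. x \<in> carrier A \<Longrightarrow> neg (neg x) = x"
  shows "L_chain Luk_Chang A"
proof -
  have bar: "neg (neg x \<otimes> neg x) = bar x" if "x \<in> carrier A" for x
    using involutive_regular[OF inv[OF that] that] by (simp add: bar_regular neg_mult_neg_neg)
  have "interp A v p = \<one>" if "p \<in> Luk_Chang" "evaluation A v" for p v
    using that BL_sound bar_square interp_closed
    by (auto simp: Luk_Chang_def Luk_def interp_Iff_eq_one interp_dbl sq_def bar Neg_def inv
        imp_eq_one_iff)
  then show ?thesis
    using bl_algebra_axioms chain by (simp add: L_chain_def L_algebra_def)
qed

lemma derivable_sound:
  assumes "T \<turnstile>\<^bsub>L\<^esub> p" "L_chain L A"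
  shows "T \<Turnstile>\<^bsub>A\<^esub> p"
proof -
  interpret bl_chain A
    using assms(2) by (simp add: L_chain_def L_algebra_def bl_chain_def bl_chain_axioms_def)
  have "interp A v p = \<one>\<^bsub>A\<^esub>" if v: "evaluation A v" "\<And>q. q \<in> T \<Longrightarrow> interp A v q = \<one>\<^bsub>A\<^esub>" for v
    using assms(1)
  proof induction
    case (axiom p)
    then show ?case
      using assms(2) v(1) by (simp add: L_chain_def L_algebra_def)
  next
    case (premise p)
    then show ?case
      using v(2) by simp
  next
    case (modus_ponens p q)
    then show ?case
      using interp_closed[OF v(1)] by (simp add: one_imp)
  qed
  then show ?thesis
    by (simp add: entails_def)
qed

section \<open>Prime theories\<close>

text \<open>
  Containing BL and being closed under modus ponens is all that derivations rely on, so the set of consequences of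
  \<open>T\<close>, its extension by a formula and unions of chains of theories are treated alike.
\<close>

locale fm_theory =
  fixes Th :: "fm set"
  assumes BL: "BL \<subseteq> Th"
    and mp: "\<lbrakk>p \<in> Th; p \<^bold>\<rightarrow> q \<in> Th\<rbrakk> \<Longrightarrow> q \<in> Th"
begin

lemma ax: "p \<in> BL \<Longrightarrow> p \<in> Th"
  using BL by blast

lemma syllogism: "\<lbrakk>p \<^bold>\<rightarrow> q \<in> Th; q \<^bold>\<rightarrow> r \<in> Th\<rbrakk> \<Longrightarrow> p \<^bold>\<rightarrow> r \<in> Th"
  using mp[OF _ mp[OF _ ax[OF BL.A1]]] .

lemma import_iff: "(p \<^bold>& q) \<^bold>\<rightarrow> r \<in> Th \<longleftrightarrow> p \<^bold>\<rightarrow> (q \<^bold>\<rightarrow> r) \<in> Th"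
  using mp[OF _ ax[OF BL.A5a]] mp[OF _ ax[OF BL.A5b]] by blast

lemma weakening: "p \<^bold>\<rightarrow> (q \<^bold>\<rightarrow> p) \<in> Th"
  using ax[OF BL.A2] by (simp flip: import_iff)

lemma weaken: "p \<in> Th \<Longrightarrow> q \<^bold>\<rightarrow> p \<in> Th"
  using mp weakening by blast

lemma identity: "p \<^bold>\<rightarrow> p \<in> Th"
proof -
  have "(\<^bold>\<bottom> \<^bold>\<rightarrow> \<^bold>\<bottom>) \<^bold>\<rightarrow> (p \<^bold>\<rightarrow> p) \<in> Th"
    using syllogism[OF ax[OF BL.A3] ax[OF BL.A2]] by (simp flip: import_iff)
  then show ?thesis
    using mp[OF ax[OF BL.A7]] by blast
qed

lemma exchange: "(p \<^bold>\<rightarrow> (q \<^bold>\<rightarrow> r)) \<^bold>\<rightarrow> (q \<^bold>\<rightarrow> (p \<^bold>\<rightarrow> r)) \<in> Th"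
proof -
  have "((p \<^bold>& q) \<^bold>\<rightarrow> r) \<^bold>\<rightarrow> ((q \<^bold>& p) \<^bold>\<rightarrow> r) \<in> Th"
    using mp[OF ax[OF BL.A3] ax[OF BL.A1]] .
  then show ?thesis
    using syllogism[OF ax[OF BL.A5a] syllogism[OF _ ax[OF BL.A5b]]] by blast
qed

lemma prefixing: "p \<^bold>\<rightarrow> q \<in> Th \<Longrightarrow> (a \<^bold>\<rightarrow> p) \<^bold>\<rightarrow> (a \<^bold>\<rightarrow> q) \<in> Th"
  using mp[OF _ mp[OF ax[OF BL.A1] exchange]] .

text \<open>
  Without contraction the deduction theorem reads: \<open>q\<close> follows from \<open>a\<close> iff \<open>a \<rightarrow> (a \<rightarrow> \<dots> \<rightarrow> q)\<close> is provable
  for some number of premises \<open>a\<close>.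
\<close>

abbreviation imps :: "fm \<Rightarrow> nat \<Rightarrow> fm \<Rightarrow> fm"
  where "imps a n \<equiv> (Imp a) ^^ n"

lemma imps_prefixing: "p \<^bold>\<rightarrow> q \<in> Th \<Longrightarrow> imps a n p \<^bold>\<rightarrow> imps a n q \<in> Th"
  by (induction n) (simp_all add: prefixing)

lemma imps_weaken: "p \<in> Th \<Longrightarrow> imps a n p \<in> Th"
  by (induction n) (simp_all add: weaken)

lemma imps_weaken_conclusion: "p \<^bold>\<rightarrow> imps a n p \<in> Th"
  by (induction n) (auto simp: identity intro: syllogism[OF _ weakening])

lemma imps_exchange: "imps a n (p \<^bold>\<rightarrow> q) \<^bold>\<rightarrow> (p \<^bold>\<rightarrow> imps a n q) \<in> Th"
proof (induction n)
  case 0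
  then show ?case
    by (simp add: identity)
next
  case (Suc n)
  then show ?case
    using syllogism[OF prefixing exchange] by simp
qed

lemma imps_mp:
  assumes "imps a n p \<in> Th" "imps a m (p \<^bold>\<rightarrow> q) \<in> Th"
  shows "imps a (n + m) q \<in> Th"
proof -
  have "p \<^bold>\<rightarrow> imps a m q \<in> Th"
    using assms(2) imps_exchange mp by blast
  then have "imps a n (imps a m q) \<in> Th"
    using assms(1) imps_prefixing mp by blast
  then show ?thesis
    by (simp add: funpow_add)
qed

text \<open>
  The deduction theorem: this set is the theory generated by \<open>Th\<close> and \<open>a\<close>.
\<close>

lemma fm_theory_extend: "fm_theory {q. \<exists>n. imps a n q \<in> Th}"
proof
  have "imps a 0 q \<in> Th" if "q \<in> BL" for q
    using ax that by simp
  then show "BL \<subseteq> {q. \<exists>n. imps a n q \<in> Th}"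
    by blast
  show "q \<in> {q. \<exists>n. imps a n q \<in> Th}"
    if "p \<in> {q. \<exists>n. imps a n q \<in> Th}" "p \<^bold>\<rightarrow> q \<in> {q. \<exists>n. imps a n q \<in> Th}" for p q
    using that imps_mp by blast
qed

text \<open>
  Write \<open>a\<close> and \<open>b\<close> for the two implications. The formula with \<open>k\<close> premises \<open>a\<close> and \<open>l\<close> premises \<open>b\<close> in front of
  \<open>c\<close> is provable as soon as \<open>n \<le> k\<close> or \<open>m \<le> l\<close>. Axiom \<open>A6\<close> removes a premise: if the formula is provable
  with one more \<open>a\<close> and also with one more \<open>b\<close>, then it is provable as it stands. Descending from large
  \<open>k\<close> and \<open>l\<close> reaches \<open>k = l = 0\<close>.
\<close>

lemma prelinear_cases:
  assumes "imps (p \<^bold>\<rightarrow> q) n c \<in> Th" "imps (q \<^bold>\<rightarrow> p) m c \<in> Th"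
  shows "c \<in> Th"
proof -
  let ?a = "p \<^bold>\<rightarrow> q" and ?b = "q \<^bold>\<rightarrow> p"
  have base: "imps ?a k (imps ?b l c) \<in> Th" if "n \<le> k \<or> m \<le> l" for k l
  proof (cases "n \<le> k")
    case True
    have "imps ?a n (imps ?b l c) \<in> Th"
      using mp[OF assms(1) imps_prefixing[OF imps_weaken_conclusion]] .
    then have "imps ?a ((k - n) + n) (imps ?b l c) \<in> Th"
      unfolding funpow_add comp_apply by (rule imps_weaken)
    then show ?thesis
      using True by simp
  next
    case False
    then have "imps ?b ((l - m) + m) c \<in> Th"
      unfolding funpow_add comp_apply by (intro imps_weaken assms(2))
    then show ?thesis
      using False that by (simp add: imps_weaken)
  qed
  have "imps ?a k (imps ?b l c) \<in> Th" if "(n - k) + (m - l) \<le> d" for k l d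
    using that
  proof (induction d arbitrary: k l)
    case 0
    then show ?case
      by (simp add: base)
  next
    case (Suc d)
    show ?case
    proof (cases "n \<le> k \<or> m \<le> l")
      case True
      then show ?thesis
        by (rule base)
    next
      case False
      then have a: "imps ?a (Suc k) (imps ?b l c) \<in> Th"
        and b: "imps ?a k (imps ?b (Suc l) c) \<in> Th"
        using Suc.prems by (intro Suc.IH, linarith)+
      have "?a \<^bold>\<rightarrow> imps ?a k (imps ?b l c) \<in> Th"
        using a by simp
      moreover have "?b \<^bold>\<rightarrow> imps ?a k (imps ?b l c) \<in> Th"
        using mp[OF _ imps_exchange] b by simp
      ultimately show ?thesis
        using mp[OF _ mp[OF _ ax[OF BL.A6]]] by blast
    qed
  qed
  from this[of 0 0 "n + m"] show ?thesis
    by simp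
qed

lemma imp_conj_of_theorem: "\<lbrakk>p \<in> Th\<rbrakk> \<Longrightarrow> q \<^bold>\<rightarrow> (q \<^bold>& p) \<in> Th"
proof -
  assume "p \<in> Th"
  moreover have "p \<^bold>\<rightarrow> (q \<^bold>\<rightarrow> (q \<^bold>& p)) \<in> Th"
    using ax[OF BL.A3] by (simp flip: import_iff)
  ultimately show ?thesis
    using mp by blast
qed

end

definition prime_theories :: "fm set \<Rightarrow> fm set set"
  where "prime_theories L =
    {Th. fm_theory Th \<and> L \<subseteq> Th \<and> \<^bold>\<bottom> \<notin> Th \<and> (\<forall>p q. p \<^bold>\<rightarrow> q \<in> Th \<or> q \<^bold>\<rightarrow> p \<in> Th)}"

lemma fm_theory_Union:
  assumes "\<C> \<noteq> {}" "\<And>Th. Th \<in> \<C> \<Longrightarrow> fm_theory Th"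
    "\<And>X Y. X \<in> \<C> \<Longrightarrow> Y \<in> \<C> \<Longrightarrow> X \<subseteq> Y \<or> Y \<subseteq> X"
  shows "fm_theory (\<Union>\<C>)"
proof
  show "BL \<subseteq> \<Union>\<C>"
    using assms(1,2) fm_theory.BL by blast
  show "q \<in> \<Union>\<C>" if pq: "p \<in> \<Union>\<C>" "p \<^bold>\<rightarrow> q \<in> \<Union>\<C>" for p q
  proof -
    obtain X Y where "X \<in> \<C>" "Y \<in> \<C>" "p \<in> X" "p \<^bold>\<rightarrow> q \<in> Y"
      using pq by blast
    then obtain Z where "Z \<in> \<C>" "p \<in> Z" "p \<^bold>\<rightarrow> q \<in> Z"
      using assms(3)[of X Y] by blast
    then show ?thesis
      using fm_theory.mp[OF assms(2)] by blast
  qed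
qed

text \<open>
  A theory that is maximal among those omitting \<open>c\<close> is prime: if it contained neither \<open>p \<rightarrow> q\<close> nor \<open>q \<rightarrow> p\<close>,
  then adding either of them would make \<open>c\<close> provable, and \<open>c\<close> would be provable outright by
  \<open>prelinear_cases\<close>.
\<close>

lemma prime_theory_exists:
  assumes "BL \<subseteq> L" "\<not> T \<turnstile>\<^bsub>L\<^esub> c"
  obtains Th where "Th \<in> prime_theories L" "T \<subseteq> Th" "c \<notin> Th"
proof -
  define D where "D = {p. T \<turnstile>\<^bsub>L\<^esub> p}"
  have D: "L \<subseteq> D" "T \<subseteq> D" "c \<notin> D"
    using assms derivable.axiom derivable.premise by (auto simp: D_def)
  have "fm_theory D"
  proof
    show "BL \<subseteq> D"
      using assms(1) D(1) by blast
    show "q \<in> D" if "p \<in> D" "p \<^bold>\<rightarrow> q \<in> D" for p q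
      using that derivable.modus_ponens unfolding D_def by blast
  qed
  define \<F> where "\<F> = {Th. fm_theory Th \<and> D \<subseteq> Th \<and> c \<notin> Th}"
  have "\<exists>M\<in>\<F>. \<forall>X\<in>\<F>. M \<subseteq> X \<longrightarrow> X = M"
  proof (rule subset_Zorn_nonempty)
    show "\<F> \<noteq> {}"
      using D(3) \<open>fm_theory D\<close> by (auto simp: \<F>_def)
    show "\<Union>\<C> \<in> \<F>" if "\<C> \<noteq> {}" "subset.chain \<F> \<C>" for \<C>
    proof -
      have "fm_theory (\<Union>\<C>)"
        using that by (intro fm_theory_Union) (auto simp: \<F>_def subset_chain_def)
      moreover have "\<C> \<subseteq> \<F>"
        using that(2) by (simp add: subset_chain_def)
      then have "D \<subseteq> \<Union>\<C>" "c \<notin> \<Union>\<C>"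
        using that(1) unfolding \<F>_def by blast+
      ultimately show ?thesis
        by (simp add: \<F>_def)
    qed
  qed
  then obtain M where M: "M \<in> \<F>" and max: "\<And>X. X \<in> \<F> \<Longrightarrow> M \<subseteq> X \<Longrightarrow> X = M"
    by blast
  interpret fm_theory M
    using M by (simp add: \<F>_def)
  have extend: "\<exists>n. imps a n c \<in> M" if "a \<notin> M" for a
  proof (rule ccontr)
    assume "\<nexists>n. imps a n c \<in> M"
    moreover have sub: "M \<subseteq> {q. \<exists>n. imps a n q \<in> M}"
      by (auto intro: exI[of _ 0])
    ultimately have "{q. \<exists>n. imps a n q \<in> M} \<in> \<F>"
      using M fm_theory_extend[of a] by (auto simp: \<F>_def)
    then have "{q. \<exists>n. imps a n q \<in> M} = M"
      using max sub by blast
    moreover have "imps a (Suc 0) a \<in> M"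
      using identity by simp
    ultimately show False
      using that by blast
  qed
  have "p \<^bold>\<rightarrow> q \<in> M \<or> q \<^bold>\<rightarrow> p \<in> M" for p q
  proof (rule ccontr)
    assume "\<not> ?thesis"
    then obtain n m where "imps (p \<^bold>\<rightarrow> q) n c \<in> M" "imps (q \<^bold>\<rightarrow> p) m c \<in> M"
      using extend by blast
    then have "c \<in> M"
      by (rule prelinear_cases)
    then show False
      using M by (simp add: \<F>_def)
  qed
  moreover have "\<^bold>\<bottom> \<notin> M"
    using mp[OF _ ax[OF BL.A7]] M by (auto simp: \<F>_def)
  ultimately have "M \<in> prime_theories L"
    using M D(1) fm_theory_axioms by (auto simp: prime_theories_def \<F>_def)
  then show thesis
    using that M D(2) by (auto simp: \<F>_def)
qed

section \<open>Lindenbaum chains\<close>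

locale prime_theory = fm_theory +
  assumes prime: "p \<^bold>\<rightarrow> q \<in> Th \<or> q \<^bold>\<rightarrow> p \<in> Th"
    and consistent: "\<^bold>\<bottom> \<notin> Th"
begin

text \<open>
  Totality is primeness; the other laws are theorems of BL.
\<close>

sublocale formulas: preBL_chain UNIV "\<lambda>p q. p \<^bold>\<rightarrow> q \<in> Th" Conj Imp "\<^bold>\<bottom> \<^bold>\<rightarrow> \<^bold>\<bottom>" "\<^bold>\<bottom>"
proof unfold_locales
  show "p \<^bold>\<rightarrow> r \<in> Th" if "p \<^bold>\<rightarrow> q \<in> Th" "q \<^bold>\<rightarrow> r \<in> Th" for p q r
    using that by (rule syllogism)
  show "(p \<^bold>& q) \<^bold>& r \<^bold>\<rightarrow> p \<^bold>& (q \<^bold>& r) \<in> Th" for p q r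
  proof -
    have "p \<^bold>\<rightarrow> ((q \<^bold>& r) \<^bold>\<rightarrow> (p \<^bold>& (q \<^bold>& r))) \<in> Th"
      using identity by (simp flip: import_iff)
    then show ?thesis
      using syllogism[OF _ ax[OF BL.A5b]] import_iff by blast
  qed
  show "q \<^bold>\<rightarrow> p \<^bold>& (p \<^bold>\<rightarrow> q) \<in> Th" if "q \<^bold>\<rightarrow> p \<in> Th" for p q
    using syllogism[OF imp_conj_of_theorem[OF that] ax[OF BL.A4]] .
  show "p \<^bold>\<rightarrow> p \<^bold>& (\<^bold>\<bottom> \<^bold>\<rightarrow> \<^bold>\<bottom>) \<in> Th" for p
    using imp_conj_of_theorem[OF identity] .
  show "(r \<^bold>& p) \<^bold>\<rightarrow> q \<in> Th \<longleftrightarrow> r \<^bold>\<rightarrow> (p \<^bold>\<rightarrow> q) \<in> Th" for p q r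
    by (rule import_iff)
qed (simp_all add: identity prime weaken ax BL.intros)

definition cls :: "fm \<Rightarrow> fm"
  where "cls = (\<lambda>p. SOME q. q \<in> UNIV \<and> p \<^bold>\<rightarrow> q \<in> Th \<and> q \<^bold>\<rightarrow> p \<in> Th)"

sublocale LT: preBL_quotient UNIV "\<lambda>p q. p \<^bold>\<rightarrow> q \<in> Th" Conj Imp "\<^bold>\<bottom> \<^bold>\<rightarrow> \<^bold>\<bottom>" "\<^bold>\<bottom>" cls
  unfolding cls_def by (rule formulas.preBL_quotient_some)

lemma cls_eq_one_iff: "cls p = \<one>\<^bsub>LT.Q\<^esub> \<longleftrightarrow> p \<in> Th"
proof -
  have "cls p = \<one>\<^bsub>LT.Q\<^esub> \<longleftrightarrow> (\<^bold>\<bottom> \<^bold>\<rightarrow> \<^bold>\<bottom>) \<^bold>\<rightarrow> p \<in> Th"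
    by (simp add: LT.one_Q LT.q_eq_iff weaken identity)
  also have "\<dots> \<longleftrightarrow> p \<in> Th"
    using mp[OF identity] weaken by blast
  finally show ?thesis .
qed

lemma interp_cls: "interp LT.Q (\<lambda>n. cls (Var n)) p = cls p"
  by (induction p) (simp_all add: LT.mult_Q LT.residuum_Q LT.bot_Q)

lemma cls_imp: "cls p \<triangleright>\<^bsub>LT.Q\<^esub> cls q = cls (p \<^bold>\<rightarrow> q)"
  and cls_mult: "cls p \<otimes>\<^bsub>LT.Q\<^esub> cls q = cls (p \<^bold>& q)"
  by (simp_all add: LT.residuum_Q LT.mult_Q)

sublocale LT_chain: bl_chain LT.Q
  by (rule LT.bl_chain_Q)

lemma LT_nontrivial: "\<zero>\<^bsub>LT.Q\<^esub> \<noteq> \<one>\<^bsub>LT.Q\<^esub>"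
  using consistent by (simp add: LT.bot_Q cls_eq_one_iff)

lemma LT_cases:
  assumes "x \<in> carrier LT.Q"
  obtains p where "x = cls p"
  using assms by (auto simp: LT.carrier_Q)

lemma evaluation_cls: "evaluation LT.Q (\<lambda>n. cls (Var n))"
  by (simp add: evaluation_def LT.carrier_Q)

lemma cls_eq_of_Iff: "p \<^bold>\<leftrightarrow> q \<in> Th \<Longrightarrow> cls p = cls q"
  using LT_chain.interp_Iff_eq_one[OF evaluation_cls, of p q] by (simp add: interp_cls cls_eq_one_iff)

lemma cls_dbl_bar: "cls (dbl_bar p) = LT_chain.bar (cls p)"
  using LT_chain.interp_dbl_bar[OF evaluation_cls, of p] by (simp add: interp_cls)

lemma chang_LT_BL_Chang:
  assumes "BL_Chang \<subseteq> Th"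
  shows "chang_chain LT.Q"
proof (intro chang_chain.intro chang_chain_axioms.intro LT.bl_chain_Q LT_nontrivial)
  fix x
  assume "x \<in> carrier LT.Q"
  then obtain p where p: "x = cls p"
    by (rule LT_cases)
  have "sq (dbl_bar p) \<^bold>\<leftrightarrow> dbl_bar (sq p) \<in> Th"
    using assms by (auto simp: BL_Chang_def)
  then have "cls (sq (dbl_bar p)) = cls (dbl_bar (sq p))"
    by (rule cls_eq_of_Iff)
  then show "LT_chain.bar x \<otimes>\<^bsub>LT.Q\<^esub> LT_chain.bar x = LT_chain.bar (x \<otimes>\<^bsub>LT.Q\<^esub> x)"
    by (simp add: p cls_dbl_bar sq_def flip: cls_mult)
qed

lemma LT_involutive:
  assumes "Luk \<subseteq> Th" "x \<in> carrier LT.Q"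
  shows "LT_chain.neg (LT_chain.neg x) = x"
proof -
  obtain p where p: "x = cls p"
    using assms(2) by (rule LT_cases)
  have "\<^bold>\<not> \<^bold>\<not> p \<^bold>\<rightarrow> p \<in> Th"
    using assms(1) by (auto simp: Luk_def)
  then have "cls (\<^bold>\<not> \<^bold>\<not> p) \<triangleright>\<^bsub>LT.Q\<^esub> cls p = \<one>\<^bsub>LT.Q\<^esub>"
    by (simp add: cls_imp cls_eq_one_iff)
  then have "cls (\<^bold>\<not> \<^bold>\<not> p) \<preceq>\<^bsub>LT.Q\<^esub> cls p"
    using LT_chain.imp_eq_one_iff[of "cls (\<^bold>\<not> \<^bold>\<not> p)" "cls p"] by (simp add: LT.carrier_Q)
  moreover have "cls (\<^bold>\<not> \<^bold>\<not> p) = LT_chain.neg (LT_chain.neg x)"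
    by (simp add: p Neg_def LT.bot_Q cls_imp)
  ultimately show ?thesis
    using assms(2) p by (simp add: LT_chain.le_antisym LT_chain.le_neg_neg)
qed

text \<open>
  In a Lukasiewicz theory double negation is the identity, so \<open>bar\<close> is the class of \<open>dbl\<close>.
\<close>

lemma chang_LT_Luk_Chang:
  assumes "Luk_Chang \<subseteq> Th"
  shows "chang_chain LT.Q"
proof (intro chang_chain.intro chang_chain_axioms.intro LT.bl_chain_Q LT_nontrivial)
  fix x
  assume x: "x \<in> carrier LT.Q"
  then obtain p where p: "x = cls p"
    by (rule LT_cases)
  have Luk: "Luk \<subseteq> Th"
    using assms by (simp add: Luk_Chang_def)
  have bar: "LT_chain.bar (cls p) = cls (dbl p)" for p
  proof -
    have c: "cls p \<in> carrier LT.Q"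
      by (simp add: LT.carrier_Q)
    have "cls p \<in> insert \<one>\<^bsub>LT.Q\<^esub> LT_chain.regular"
      using LT_involutive[OF Luk c] c by (rule LT_chain.involutive_regular)
    then show ?thesis
      using LT_chain.interp_dbl[of "\<lambda>n. cls (Var n)" p]
      by (simp add: interp_cls LT_chain.bar_regular LT_chain.neg_mult_neg_neg)
  qed
  have "sq (dbl p) \<^bold>\<leftrightarrow> dbl (sq p) \<in> Th"
    using assms by (auto simp: Luk_Chang_def)
  then have "cls (sq (dbl p)) = cls (dbl (sq p))"
    by (rule cls_eq_of_Iff)
  then show "LT_chain.bar x \<otimes>\<^bsub>LT.Q\<^esub> LT_chain.bar x = LT_chain.bar (x \<otimes>\<^bsub>LT.Q\<^esub> x)"
    by (simp add: p bar sq_def cls_mult)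
qed

end

text \<open>
  A total function of the theory, as needed for the members of a family; the value is meaningful for
  prime theories.
\<close>

definition lindenbaum_chain :: "fm set \<Rightarrow> fm bl_structure"
  where "lindenbaum_chain Th = preBL_quotient.Q UNIV (\<lambda>p q. p \<^bold>\<rightarrow> q \<in> Th) Conj Imp
    (\<^bold>\<bottom> \<^bold>\<rightarrow> \<^bold>\<bottom>) \<^bold>\<bottom> (prime_theory.cls Th)"

section \<open>The universal chains\<close>

lemma (in chang_amalgam) interp_embed:
  assumes "i \<in> J" "evaluation (C i) v"
  shows "interp B.Q (enc \<circ> embed i \<circ> v) p = enc (embed i (interp (C i) v p))"
proof -
  interpret chang_chain "C i"
    using assms(1) by (rule member)
  note h = bl_hom_embed[OF assms(1)]
  show ?thesis
    by (induction p)
      (simp_all add: interp_closed[OF assms(2)] bl_hom_bot[OF h, unfolded comp_apply]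
        bl_hom_mult[OF h, unfolded comp_apply] bl_hom_imp[OF h, unfolded comp_apply])
qed

lemma ex_wf_total: "\<exists>r. wf r \<and> trans r \<and> (\<forall>x y. x \<noteq> y \<longrightarrow> (x, y) \<in> r \<or> (y, x) \<in> r)"
proof -
  obtain r :: "'a rel" where r: "well_order_on UNIV r"
    using well_order_on by blast
  have "wf (r - Id)"
    using r by (simp add: well_order_on_def)
  moreover have "trans (r - Id)"
    using r by (auto simp: well_order_on_def linear_order_on_def partial_order_on_def
        preorder_on_def intro: trans_diff_Id)
  moreover have "(x, y) \<in> r - Id \<or> (y, x) \<in> r - Id" if "x \<noteq> y" for x y
    using r that by (auto simp: well_order_on_def linear_order_on_def total_on_def)
  ultimately show ?thesis
    by blast
qed

instance fm :: countable
  by countable_datatype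

text \<open>
  The elements of the ordinal sum are functions on prime theories with values in formulas, so there
  are at most as many as sets of reals. A pair of such functions is encoded by its graph, with a
  numeric tag telling the components apart.
\<close>

lemma ex_inj_fm_data:
  "\<exists>enc :: (bool \<times> (fm set \<Rightarrow> fm) \<times> (fm set \<Rightarrow> fm)) + fm set \<times> fm \<Rightarrow> nat set set. inj enc"
proof -
  define code :: "fm set \<times> fm \<times> nat \<Rightarrow> nat set"
    where "code = (\<lambda>(T, p, n). (\<lambda>x. prod_encode (0, to_nat x)) ` T \<union>
      {prod_encode (1, to_nat p), prod_encode (2, n)})"
  have T: "x \<in> T \<longleftrightarrow> prod_encode (0, to_nat x) \<in> code (T, p, n)"
    and p: "y = p \<longleftrightarrow> prod_encode (1, to_nat y) \<in> code (T, p, n)"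
    and n: "m = n \<longleftrightarrow> prod_encode (2, m) \<in> code (T, p, n)" for T p n x y m
    by (auto simp: code_def prod_encode_eq)
  have inj_code: "inj code"
  proof (rule injI)
    fix a b
    assume eq: "code a = code b"
    obtain T p n T' p' n' where ab: "a = (T, p, n)" "b = (T', p', n')"
      by (metis prod.exhaust)
    have "x \<in> T \<longleftrightarrow> x \<in> T'" for x
      using T[of x T p n] T[of x T' p' n'] eq by (simp add: ab)
    moreover have "p = p'"
      using p[of p p T n] p[of p p' T' n'] eq by (simp add: ab)
    moreover have "n = n'"
      using n[of n n T p] n[of n n' T' p'] eq by (simp add: ab)
    ultimately have "T = T'" "p = p'" "n = n'"
      by blast+
    then show "a = b"
      by (simp add: ab)
  qed
  define graph :: "(bool \<times> (fm set \<Rightarrow> fm) \<times> (fm set \<Rightarrow> fm)) + fm set \<times> fm \<Rightarrow> (fm set \<times> fm \<times> nat) set"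
    where "graph u = (case u of
        Inl (b, f, g) \<Rightarrow> {(T, f T, 0) |T. True} \<union> {(T, g T, 1) |T. True} \<union>
          (if b then {({}, \<^bold>\<bottom>, 2)} else {})
      | Inr (T, p) \<Rightarrow> {(T, p, 3)})" for u
  have "inj graph"
  proof (rule injI)
    fix u v
    assume eq: "graph u = graph v"
    have mem: "(T, p, k) \<in> graph u \<longleftrightarrow> (T, p, k) \<in> graph v" for T p k
      by (simp add: eq)
    show "u = v"
    proof (cases u; cases v)
      fix a b
      assume uv: "u = Inl a" "v = Inl b"
      obtain c f g c' f' g' where ab: "a = (c, f, g)" "b = (c', f', g')"
        by (metis prod.exhaust)
      have "f T = f' T" "g T = g' T" for T
        using mem[of T "f T" 0] mem[of T "g T" 1] by (auto simp: uv ab graph_def split: if_splits)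
      moreover have "c = c'"
        using mem[of "{}" "\<^bold>\<bottom>" 2] by (auto simp: uv ab graph_def split: if_splits)
      ultimately show "u = v"
        by (auto simp: uv ab)
    next
      fix a b
      assume uv: "u = Inr a" "v = Inr b"
      then show "u = v"
        using mem[of "fst a" "snd a" 3] by (auto simp: graph_def split: prod.splits)
    next
      fix a b
      assume uv: "u = Inl a" "v = Inr b"
      then show "u = v"
        using mem[of "{}" "fst (snd a) {}" 0] by (auto simp: graph_def split: prod.splits)
    next
      fix a b
      assume uv: "u = Inr a" "v = Inl b"
      then show "u = v"
        using mem[of "{}" "fst (snd b) {}" 0] by (auto simp: graph_def split: prod.splits)
    qed
  qed
  then have "inj (\<lambda>u. code ` graph u)"
    using inj_code by (simp add: inj_def inj_image_eq_iff)
  then show ?thesis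
    by blast
qed

definition involutive :: "('a, 'm) bl_structure_scheme \<Rightarrow> bool"
  where "involutive A \<longleftrightarrow> (\<forall>x\<in>carrier A. (x \<triangleright>\<^bsub>A\<^esub> \<zero>\<^bsub>A\<^esub>) \<triangleright>\<^bsub>A\<^esub> \<zero>\<^bsub>A\<^esub> = x)"

text \<open>
  The family consists of the Lindenbaum chains of all prime theories. For a theory \<open>Th\<close> the evaluation
  that sends each variable to the image of its class gives value \<open>1\<close> exactly to the members of \<open>Th\<close>.
\<close>

lemma universal_chain_exists:
  assumes "BL \<subseteq> L"
    and "\<And>Th. Th \<in> prime_theories L \<Longrightarrow> chang_chain (lindenbaum_chain Th)"
  shows "\<exists>A :: bl_universe bl_structure. chang_chain A \<and>
    (\<forall>T p. T \<Turnstile>\<^bsub>A\<^esub> p \<longrightarrow> T \<turnstile>\<^bsub>L\<^esub> p) \<and>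
    ((\<forall>Th\<in>prime_theories L. involutive (lindenbaum_chain Th)) \<longrightarrow> involutive A)"
proof -
  from ex_wf_total obtain r :: "fm set rel"
    where r: "wf r \<and> trans r \<and> (\<forall>x y. x \<noteq> y \<longrightarrow> (x, y) \<in> r \<or> (y, x) \<in> r)" ..
  obtain enc :: "(bool \<times> (fm set \<Rightarrow> fm) \<times> (fm set \<Rightarrow> fm)) + fm set \<times> fm \<Rightarrow> nat set set"
    where "inj enc"
    using ex_inj_fm_data by blast
  then interpret chang_amalgam "prime_theories L" r lindenbaum_chain enc
    using r assms(2)
    by (intro chang_amalgam.intro chang_family.intro chang_amalgam_axioms.intro) auto
  have complete: "T \<turnstile>\<^bsub>L\<^esub> p" if "T \<Turnstile>\<^bsub>B.Q\<^esub> p" for T p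
  proof (rule ccontr)
    assume "\<not> T \<turnstile>\<^bsub>L\<^esub> p"
    then obtain Th where Th: "Th \<in> prime_theories L" "T \<subseteq> Th" "p \<notin> Th"
      using prime_theory_exists[OF assms(1)] by blast
    interpret P: prime_theory Th
      using Th(1) by (simp add: prime_theories_def prime_theory_def prime_theory_axioms_def)
    have eq: "lindenbaum_chain Th = P.LT.Q"
      by (simp add: lindenbaum_chain_def)
    define v where "v = enc \<circ> embed Th \<circ> (\<lambda>n. P.cls (Var n))"
    have ev: "evaluation (lindenbaum_chain Th) (\<lambda>n. P.cls (Var n))"
      using P.evaluation_cls by (simp add: eq)
    have interp_v: "interp B.Q v s = enc (embed Th (P.cls s))" for s
      unfolding v_def using interp_embed[OF Th(1) ev, of s] by (simp add: eq P.interp_cls)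
    have one: "interp B.Q v s = \<one>\<^bsub>B.Q\<^esub> \<longleftrightarrow> s \<in> Th" for s
      using enc_embed_eq_one_iff[OF Th(1), of "P.cls s"] interp_v[of s]
      by (simp add: eq P.LT.carrier_Q P.cls_eq_one_iff)
    have "evaluation B.Q v"
      using bl_hom_closed[OF bl_hom_embed[OF Th(1)]] ev by (simp add: evaluation_def v_def)
    then show False
      using that Th(2,3) one unfolding entails_def by blast
  qed
  have "involutive B.Q" if "\<forall>Th\<in>prime_theories L. involutive (lindenbaum_chain Th)"
    using B_involutive that by (simp add: involutive_def)
  then show ?thesis
    using chang_B complete by blast
qed

theorem theorem3p12:
  "\<exists>(A :: bl_universe bl_structure) (B :: bl_universe bl_structure).
     L_chain Luk_Chang A \<and> L_chain BL_Chang B \<and>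
     strongly_complete Luk_Chang A \<and> strongly_complete BL_Chang B"
proof -
  have prime: "prime_theory Th" "L \<subseteq> Th" if "Th \<in> prime_theories L" for Th L
    using that by (simp_all add: prime_theories_def prime_theory_def prime_theory_axioms_def)
  have BL: "BL \<subseteq> Luk_Chang" "BL \<subseteq> BL_Chang"
    by (auto simp: Luk_Chang_def Luk_def BL_Chang_def)
  have chang_Luk: "chang_chain (lindenbaum_chain Th)" if "Th \<in> prime_theories Luk_Chang" for Th
    using prime_theory.chang_LT_Luk_Chang[OF prime[OF that]] by (simp add: lindenbaum_chain_def)
  have chang_BL: "chang_chain (lindenbaum_chain Th)" if "Th \<in> prime_theories BL_Chang" for Th
    using prime_theory.chang_LT_BL_Chang[OF prime[OF that]] by (simp add: lindenbaum_chain_def)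
  from universal_chain_exists[OF BL(1) chang_Luk] obtain A :: "bl_universe bl_structure"
    where A: "chang_chain A \<and> (\<forall>T p. T \<Turnstile>\<^bsub>A\<^esub> p \<longrightarrow> T \<turnstile>\<^bsub>Luk_Chang\<^esub> p) \<and>
      ((\<forall>Th\<in>prime_theories Luk_Chang. involutive (lindenbaum_chain Th)) \<longrightarrow> involutive A)" ..
  from universal_chain_exists[OF BL(2) chang_BL] obtain B :: "bl_universe bl_structure"
    where B: "chang_chain B \<and> (\<forall>T p. T \<Turnstile>\<^bsub>B\<^esub> p \<longrightarrow> T \<turnstile>\<^bsub>BL_Chang\<^esub> p) \<and>
      ((\<forall>Th\<in>prime_theories BL_Chang. involutive (lindenbaum_chain Th)) \<longrightarrow> involutive B)" ..
  have "involutive (lindenbaum_chain Th)" if "Th \<in> prime_theories Luk_Chang" for Th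
  proof -
    have "Luk \<subseteq> Th"
      using prime(2)[OF that] by (simp add: Luk_Chang_def)
    then show ?thesis
      using prime_theory.LT_involutive[OF prime(1)[OF that]]
      unfolding involutive_def lindenbaum_chain_def by blast
  qed
  then have "involutive A"
    using A by blast
  then have "L_chain Luk_Chang A"
    using A chang_chain.L_chain_Luk_Chang[of A] unfolding involutive_def by blast
  moreover have "L_chain BL_Chang B"
    using B chang_chain.L_chain_BL_Chang by blast
  ultimately show ?thesis
    using A B derivable_sound unfolding strongly_complete_def by blast
qed

end
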